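(* Given $s \in (-1/d, 0)$, there exist $0 < r_0 < 1$ and $\alpha = \alpha(s,r,d)$ such that for $r \in (r_0, 1)$ and independent random vectors $X$ and $Y$ in $\mathbb{R}^d$ with $s$-concave densities, $$N_r(X+Y)^{\alpha} \geq N_r(X)^{\alpha} + N_r(Y)^{\alpha}.$$ In particular, one can take $$r_0 = \left(1-\frac{2}{1+\sqrt{3}}\Big(1+\frac{1}{sd}\Big)\right)^{-1},$$ $$\alpha = \left( 1 + \frac{\log r + (r+1)\log \frac{r+1}{2r} + C(s)}{(1-r)\log 2} \right)^{-1},$$ where $$C(s) = \frac{2}{d} \sum_{k=1}^d \left( \log\left(1+\frac{ks}{r}\right) + r\log(1+ks) - (r+1)\log\left(1 + \frac{ks(r+1)}{2r}\right) \right).$$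
   Context: For a random vector $X$ in $\mathbb{R}^d$ with density $f$ with respect to Lebesgue measure and $r \in (0,1)\cup(1,\infty)$, the $r$-R\'enyi entropy is $h_r(X) = \frac{1}{1-r}\log \int_{\mathbb{R}^d} f(x)^r\,dx$, and the $r$-R\'enyi entropy power is $N_r(X) = e^{2h_r(X)/d}$. For $s<0$, a function $f:\mathbb{R}^d\to[0,\infty)$ is called $s$-concave if $f((1-\lambda)x+\lambda y) \geq ((1-\lambda)f(x)^s+\lambda f(y)^s)^{1/s}$ for all $x,y\in\mathbb{R}^d$ with $f(x)f(y)>0$ and all $\lambda\in(0,1)$.
   Formalization: For the explicit r_0 and α, the inequality is claimed only for those r in (r_0,1) with α > 0, which includes all r close enough to 1; where the formula gives α < 0 (e.g. d=1, s=-1/2, r=3/5, X and Y uniform on [0,1]) the printed claim is false. *)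

theory Defs
  imports "HOL-Probability.Probability"
begin

definition ln_ennreal :: "ennreal \<Rightarrow> ereal" where
  "ln_ennreal x = (if x = 0 then -\<infinity> else if x = \<infinity> then \<infinity> else ereal (ln (enn2real x)))"

definition exp_ereal :: "ereal \<Rightarrow> ennreal" where
  "exp_ereal x = (case x of ereal t \<Rightarrow> ennreal (exp t) | PInfty \<Rightarrow> \<infinity> | MInfty \<Rightarrow> 0)"

definition powr_ennreal :: "ennreal \<Rightarrow> real \<Rightarrow> ennreal" where
  "powr_ennreal x a = exp_ereal (ereal a * ln_ennreal x)"

lemma powr_ennreal_ennreal:
  assumes "0 < x"
  shows "powr_ennreal (ennreal x) a = ennreal (x powr a)"
  using assms by (simp add: powr_ennreal_def ln_ennreal_def exp_ereal_def powr_def)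

text \<open>The density of \<open>X\<close> is taken to be the Radon--Nikodym derivative of its law. It is finite
  almost everywhere, so \<open>enn2real\<close> only alters it on a null set, and any other density of \<open>X\<close>
  gives the same entropy (see \<open>renyi_entropy_distributed\<close> below). The integral may be infinite,
  hence the extended-real value.\<close>

definition renyi_entropy ::
  "real \<Rightarrow> 'w measure \<Rightarrow> ('w \<Rightarrow> 'a::euclidean_space) \<Rightarrow> ereal" where
  "renyi_entropy r M X =
     ereal (1 / (1 - r)) *
     ln_ennreal (\<integral>\<^sup>+ x. ennreal (enn2real (RN_deriv lborel (distr M lborel X) x) powr r) \<partial>lborel)"

definition renyi_power ::
  "real \<Rightarrow> 'w measure \<Rightarrow> ('w \<Rightarrow> 'a::euclidean_space) \<Rightarrow> ennreal" where
  "renyi_power r M X = exp_ereal (ereal (2 / real DIM('a)) * renyi_entropy r M X)"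

lemma renyi_entropy_distributed:
  fixes X :: "'w \<Rightarrow> 'a::euclidean_space" and f :: "'a \<Rightarrow> real"
  assumes X: "distributed M lborel X (\<lambda>x. ennreal (f x))" and nn: "\<And>x. 0 \<le> f x"
  shows "renyi_entropy r M X =
    ereal (1 / (1 - r)) * ln_ennreal (\<integral>\<^sup>+ x. ennreal (f x powr r) \<partial>lborel)"
proof -
  have d: "density lborel (\<lambda>x. ennreal (f x)) = distr M lborel X"
    and m: "(\<lambda>x. ennreal (f x)) \<in> borel_measurable lborel"
    using X by (auto simp: distributed_def)
  have "AE x in lborel. ennreal (f x) = RN_deriv lborel (distr M lborel X) x"
    by (rule sigma_finite_measure.RN_deriv_unique[OF sigma_finite_lborel m d])
  then have "AE x in lborel.
      ennreal (enn2real (RN_deriv lborel (distr M lborel X) x) powr r) = ennreal (f x powr r)"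
  proof eventually_elim
    case (elim x)
    then show ?case using nn[of x] by (metis enn2real_ennreal)
  qed
  then show ?thesis
    unfolding renyi_entropy_def by (subst nn_integral_cong_AE) auto
qed

definition s_concave :: "real \<Rightarrow> ('a::real_vector \<Rightarrow> real) \<Rightarrow> bool" where
  "s_concave s f \<longleftrightarrow>
     (\<forall>x. 0 \<le> f x) \<and>
     (\<forall>x y. \<forall>l\<in>{0<..<1}. 0 < f x * f y \<longrightarrow>
        ((1 - l) * f x powr s + l * f y powr s) powr (1 / s) \<le> f ((1 - l) *\<^sub>R x + l *\<^sub>R y))"

definition has_s_concave_density ::
  "real \<Rightarrow> 'w measure \<Rightarrow> ('w \<Rightarrow> 'a::euclidean_space) \<Rightarrow> bool" where
  "has_s_concave_density s M X \<longleftrightarrow>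
     (\<exists>f. s_concave s f \<and> distributed M lborel X (\<lambda>x. ennreal (f x)))"

definition epi_r0 :: "real \<Rightarrow> nat \<Rightarrow> real" where
  "epi_r0 s d = inverse (1 - 2 / (1 + sqrt 3) * (1 + 1 / (s * real d)))"

definition epi_C :: "real \<Rightarrow> real \<Rightarrow> nat \<Rightarrow> real" where
  "epi_C s r d =
     2 / real d * (\<Sum>k=1..d.
        ln (1 + real k * s / r) + r * ln (1 + real k * s)
        - (r + 1) * ln (1 + real k * s * (r + 1) / (2 * r)))"

text \<open>The quantity inverted here tends to 1 as \<open>r\<close> tends to 1, but it can be negative for \<open>r\<close> close
  to \<open>epi_r0 s d\<close>; for instance \<open>d = 1\<close>, \<open>s = -1/2\<close>, \<open>r = 3/5\<close> gives about \<open>-2.43\<close>, whereas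
  \<open>epi_r0 s d = 1 / sqrt 3\<close>. A nonpositive exponent can never satisfy the entropy power inequality,
  since adding an independent vector does not decrease the entropy.\<close>

definition epi_alpha :: "real \<Rightarrow> real \<Rightarrow> nat \<Rightarrow> real" where
  "epi_alpha s r d =
     inverse (1 + (ln r + (r + 1) * ln ((r + 1) / (2 * r)) + epi_C s r d) / ((1 - r) * ln 2))"

end

theory Submission
  imports Defs
begin

text \<open>Let \<open>d\<close> be the dimension, \<open>c = (1 - r) / r\<close>, and for \<open>0 < l < 1\<close> put \<open>m = 1 - l\<close>, \<open>p = 1 / (1 + l * c)\<close> and
  \<open>q = 1 / (1 + m * c)\<close>, so that \<open>r < p, q < 1\<close>. The inequality comes from two lower bounds, one for a
  convolution and one for a single density, and from an optimisation over \<open>l\<close>.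

  The first bound is the sharp reverse Young inequality \<open>reverse_Young\<close>: the \<open>r\<close>-norm of \<open>f * g\<close> is at
  least a Gaussian constant times the \<open>p\<close>-norm of \<open>f\<close> times the \<open>q\<close>-norm of \<open>g\<close>. On the line it is proved
  by transporting Gaussians to the probability densities proportional to \<open>f^p\<close> and \<open>g^q\<close>; higher
  dimensions follow one coordinate at a time, by the reverse Minkowski inequality.

  The second bound is \<open>s_concave_moment_log_concave\<close>: for an \<open>s\<close>-concave \<open>f\<close> the product of
  \<open>(p + s) (p + 2 s) ... (p + d s)\<close> and the integral of \<open>f^p\<close> is log-concave in \<open>p\<close>. As
  \<open>r < p < 1\<close> and \<open>f\<close> has integral 1, the integral of \<open>f^p\<close> is bounded below by a constant times
  a power of the integral of \<open>f^r\<close>. The proof writes the integral of \<open>f^p\<close>, up to Gamma factors, as a moment of a function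
  of one variable that is log-concave by Prekopa--Leindler, and then applies Borell's comparison of
  moments.

  Both bounds together say that
  \<open>ln N(X + Y) \<ge> \<Lambda> l + l * ln (N X) + m * ln (N Y)\<close> with \<open>\<Lambda> l = H l - deficit l / c\<close>, where \<open>N\<close> is
  the entropy power and \<open>H\<close> the binary entropy. With \<open>l = N X powr \<alpha> / (N X powr \<alpha> + N Y powr \<alpha>)\<close>
  the right-hand side times \<open>\<alpha>\<close> becomes \<open>\<alpha> * \<Lambda> l - H l + ln (N X powr \<alpha> + N Y powr \<alpha>)\<close>, so
  that \<open>\<alpha> * \<Lambda> l \<ge> H l\<close> for all \<open>l\<close> is enough. The exponent \<open>epi_alpha\<close> gives equality at \<open>l = 1/2\<close>, and
  the remaining point is that \<open>deficit l / H l\<close> is largest there (\<open>deficit_le_entropy\<close>). This is the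
  place where \<open>epi_r0\<close> enters: the quotient of the second derivatives of \<open>deficit\<close> and \<open>H\<close> is monotone on
  \<open>(0, 1/2)\<close> as soon as \<open>y = - d s c / (1 + d s)\<close> satisfies \<open>y^2 + 2 y \<le> 2\<close>, that is
  \<open>y \<le> sqrt 3 - 1\<close>, and this bound on \<open>c\<close> follows from \<open>r > epi_r0\<close>.

  When the integral of \<open>f^r\<close> is infinite, so is that of \<open>(f * g)^r\<close> (\<open>nn_integral_conv_powe_ge\<close>), and
  there is nothing to optimise.\<close>

section \<open>Powers, Hoelder and Minkowski inequalities for extended nonnegative functions\<close>

notation powr_ennreal (infixr \<open>powe\<close> 80)

lemma powe_0 [simp]: "0 < a \<Longrightarrow> 0 powe a = 0"
  by (simp add: powr_ennreal_def ln_ennreal_def exp_ereal_def)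

lemma powe_0_neg: "a < 0 \<Longrightarrow> 0 powe a = \<top>"
  by (simp add: powr_ennreal_def ln_ennreal_def exp_ereal_def)

lemma powe_top [simp]: "0 < a \<Longrightarrow> \<top> powe a = \<top>"
  by (simp add: powr_ennreal_def ln_ennreal_def exp_ereal_def)

lemma powe_top_neg: "a < 0 \<Longrightarrow> \<top> powe a = 0"
  by (simp add: powr_ennreal_def ln_ennreal_def exp_ereal_def)

lemma powe_ennreal: "0 < x \<Longrightarrow> ennreal x powe a = ennreal (x powr a)"
  by (rule powr_ennreal_ennreal)

lemma powe_ennreal': "0 \<le> x \<Longrightarrow> 0 < a \<Longrightarrow> ennreal x powe a = ennreal (x powr a)"
  by (cases "x = 0") (auto simp: powe_ennreal)

lemma powe_1 [simp]: "x powe 1 = x"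
  by (cases "x = 0"; cases x) (auto simp: powe_ennreal)

lemma ennreal_three_cases:
  obtains (zero) "x = 0" | (real) y where "0 < y" "x = ennreal y" | (top) "x = \<top>"
  by (cases x rule: ennreal_cases) (metis ennreal_0 less_eq_real_def)+

lemma powe_mult: "0 < a \<Longrightarrow> (x * y) powe a = x powe a * y powe a"
proof -
  assume a: "0 < a"
  have nz: "0 < t \<Longrightarrow> t powr a \<noteq> 0" "0 < t \<Longrightarrow> \<not> t powr a \<le> 0" for t :: real by auto
  show ?thesis
    by (cases x rule: ennreal_three_cases; cases y rule: ennreal_three_cases)
       (use a in \<open>auto simp: powe_ennreal powr_mult nz ennreal_mult'[symmetric] ennreal_mult_top ennreal_top_mult ennreal_mult_eq_top_iff\<close>)
qed

lemma powe_powe: "0 < a \<Longrightarrow> (x powe a) powe b = x powe (a * b)"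
proof -
  assume a: "0 < a"
  consider "b = 0" | "0 < b" | "b < 0" by linarith
  then show ?thesis
  proof cases
    case 1
    have "y powe 0 = 1" for y by (simp add: powr_ennreal_def exp_ereal_def zero_ereal_def[symmetric]) (simp add: zero_ereal_def)
    with 1 show ?thesis by simp
  next
    case 2 then show ?thesis using a
      by (cases x rule: ennreal_three_cases) (auto simp: powe_ennreal powr_powr)
  next
    case 3 then show ?thesis using a
      by (cases x rule: ennreal_three_cases)
         (auto simp: powe_ennreal powr_powr powe_0_neg powe_top_neg mult_pos_neg)
  qed
qed

lemma powe_add: "0 < a \<Longrightarrow> 0 < b \<Longrightarrow> x powe (a + b) = x powe a * x powe b"
  by (cases x rule: ennreal_three_cases)
     (auto simp: powe_ennreal powr_add ennreal_mult)

lemma powe_mono: "0 < a \<Longrightarrow> x \<le> y \<Longrightarrow> x powe a \<le> y powe a"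
  by (cases x rule: ennreal_three_cases; cases y rule: ennreal_three_cases)
     (auto simp: powe_ennreal intro!: ennreal_leI powr_mono2 simp: top_unique)

lemma powe_le_cancel: "0 < a \<Longrightarrow> x powe a \<le> y powe a \<Longrightarrow> x \<le> y"
  using powe_mono[of "1 / a" "x powe a" "y powe a"] by (simp add: powe_powe)

lemma powe_eq_0_iff [simp]: "0 < a \<Longrightarrow> x powe a = 0 \<longleftrightarrow> x = 0"
  by (cases x rule: ennreal_three_cases) (auto simp: powe_ennreal)

lemma powe_eq_top_iff [simp]: "0 < a \<Longrightarrow> x powe a = \<top> \<longleftrightarrow> x = \<top>"
  by (cases x rule: ennreal_three_cases) (auto simp: powe_ennreal)

lemma measurable_powe [measurable]: "(\<lambda>x. x powe a) \<in> borel_measurable borel"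
proof -
  have "(\<lambda>x. x powe a) = (\<lambda>x. if x = 0 then 0 powe a else if x = \<top> then \<top> powe a else ennreal (enn2real x powr a))"
    by (rule ext) (case_tac x rule: ennreal_three_cases, auto simp: powe_ennreal)
  then show ?thesis by simp
qed

text \<open>Raising to a positive power is an order isomorphism, hence commutes with suprema.\<close>

lemma powe_SUP:
  assumes a: "0 < a"
  shows "(SUP i\<in>I. x i) powe a = (SUP i\<in>I. x i powe a)"
proof (rule antisym)
  have "(SUP i\<in>I. x i) \<le> (SUP i\<in>I. x i powe a) powe (1 / a)"
  proof (rule SUP_least)
    fix i assume "i \<in> I"
    then have "x i powe a \<le> (SUP i\<in>I. x i powe a)" by (rule SUP_upper)
    from powe_mono[OF _ this, of "1 / a"] a show "x i \<le> (SUP i\<in>I. x i powe a) powe (1 / a)"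
      by (simp add: powe_powe)
  qed
  from powe_mono[OF a this] a show "(SUP i\<in>I. x i) powe a \<le> (SUP i\<in>I. x i powe a)"
    by (simp add: powe_powe)
  show "(SUP i\<in>I. x i powe a) \<le> (SUP i\<in>I. x i) powe a"
    by (intro SUP_least powe_mono[OF a] SUP_upper)
qed

lemma powe_AM_GM:
  assumes l: "0 < l" "l < 1"
  shows "x powe l * y powe (1 - l) \<le> ennreal l * x + ennreal (1 - l) * y"
proof -
  have *: "ennreal (u powr l) * ennreal (v powr (1 - l)) \<le> ennreal l * ennreal u + ennreal (1 - l) * ennreal v"
    if "0 < u" "0 < v" for u v
    using Youngs_inequality_0[of l "1 - l" u v] l that
    by (auto simp: ennreal_mult[symmetric] ennreal_plus[symmetric] simp del: ennreal_plus intro!: ennreal_leI)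
  consider "x = 0 \<or> y = 0" | "x = \<top> \<or> y = \<top>" | u v where "0 < u" "0 < v" "x = ennreal u" "y = ennreal v"
    by (cases x rule: ennreal_three_cases; cases y rule: ennreal_three_cases) auto
  then show ?thesis
  proof cases
    case 1 then show ?thesis using l by auto
  next
    case 2 then show ?thesis using l by (auto simp: ennreal_mult_top)
  next
    case 3 then show ?thesis using *[of u v] by (simp add: powe_ennreal)
  qed
qed

text \<open>The quasi-norm of \<open>L\<^sup>p\<close> for \<open>p = 1 / e\<close>. The reciprocal is the parameter because the
  exponents of Young's inequality are affine in it.\<close>

abbreviation qnorm :: "'a measure \<Rightarrow> real \<Rightarrow> ('a \<Rightarrow> ennreal) \<Rightarrow> ennreal" where
  "qnorm M e f \<equiv> (\<integral>\<^sup>+x. f x powe (1 / e) \<partial>M) powe e"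

text \<open>Normalise both integrals to 1 and integrate the weighted inequality between the arithmetic and
  the geometric mean.\<close>

lemma nn_integral_Hoelder:
  assumes [measurable]: "u \<in> borel_measurable M" "v \<in> borel_measurable M"
    and l: "0 < l" "l < 1"
  shows "(\<integral>\<^sup>+x. u x powe l * v x powe (1 - l) \<partial>M) \<le>
     (\<integral>\<^sup>+x. u x \<partial>M) powe l * (\<integral>\<^sup>+x. v x \<partial>M) powe (1 - l)"
proof -
  let ?U = "\<integral>\<^sup>+x. u x \<partial>M" and ?V = "\<integral>\<^sup>+x. v x \<partial>M"
  consider "?U = 0" | "?V = 0" | "?U \<noteq> 0" "?V \<noteq> 0" "?U = \<top> \<or> ?V = \<top>"
    | "?U \<noteq> 0" "?V \<noteq> 0" "?U \<noteq> \<top>" "?V \<noteq> \<top>" by blast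
  then show ?thesis
  proof cases
    case 1
    then have "AE x in M. u x = 0" by (simp add: nn_integral_0_iff_AE)
    then have "(\<integral>\<^sup>+x. u x powe l * v x powe (1 - l) \<partial>M) = (\<integral>\<^sup>+x. 0 \<partial>M)"
      by (intro nn_integral_cong_AE) (use l in auto)
    then show ?thesis by simp
  next
    case 2
    then have "AE x in M. v x = 0" by (simp add: nn_integral_0_iff_AE)
    then have "(\<integral>\<^sup>+x. u x powe l * v x powe (1 - l) \<partial>M) = (\<integral>\<^sup>+x. 0 \<partial>M)"
      by (intro nn_integral_cong_AE) (use l in auto)
    then show ?thesis by simp
  next
    case 3
    then have "?U powe l * ?V powe (1 - l) = \<top>"
      using l by (auto simp: ennreal_mult_eq_top_iff)
    then show ?thesis by simp
  next
    case 4
    obtain U where U: "0 < U" "?U = ennreal U"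
      using 4 by (cases ?U rule: ennreal_three_cases) auto
    obtain V where V: "0 < V" "?V = ennreal V"
      using 4 by (cases ?V rule: ennreal_three_cases) auto
    let ?C = "?U powe l * ?V powe (1 - l)"
    have pw: "u x powe l * v x powe (1 - l) \<le>
        ?C * (ennreal (l / U) * u x + ennreal ((1 - l) / V) * v x)" for x
    proof -
      have "u x = ?U * (ennreal (1 / U) * u x)" "v x = ?V * (ennreal (1 / V) * v x)"
        using U V by (simp_all add: mult.assoc[symmetric] ennreal_mult[symmetric])
      then have "u x powe l * v x powe (1 - l) =
          (?U * (ennreal (1 / U) * u x)) powe l * (?V * (ennreal (1 / V) * v x)) powe (1 - l)"
        by simp
      also have "\<dots> = (?U powe l * (ennreal (1 / U) * u x) powe l) * (?V powe (1 - l) * (ennreal (1 / V) * v x) powe (1 - l))"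
        using l by (subst (1 2) powe_mult) auto
      also have "\<dots> = ?C * ((ennreal (1 / U) * u x) powe l * (ennreal (1 / V) * v x) powe (1 - l))"
        by (simp only: mult_ac)
      also have "\<dots> \<le> ?C * (ennreal l * (ennreal (1 / U) * u x) + ennreal (1 - l) * (ennreal (1 / V) * v x))"
        by (intro mult_left_mono powe_AM_GM l) auto
      finally show ?thesis
        using U V l by (simp add: mult.assoc[symmetric] ennreal_mult[symmetric])
    qed
    have "(\<integral>\<^sup>+x. u x powe l * v x powe (1 - l) \<partial>M) \<le>
      (\<integral>\<^sup>+x. ?C * (ennreal (l / U) * u x + ennreal ((1 - l) / V) * v x) \<partial>M)"
      by (intro nn_integral_mono pw)
    also have "\<dots> = ?C * (ennreal (l / U) * ?U + ennreal ((1 - l) / V) * ?V)"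
      by (simp add: nn_integral_cmult nn_integral_add)
    also have "ennreal (l / U) * ?U + ennreal ((1 - l) / V) * ?V = 1"
      using U V l by (simp add: ennreal_mult[symmetric] ennreal_plus[symmetric] del: ennreal_plus)
    finally show ?thesis by simp
  qed
qed

text \<open>With \<open>B y\<close> the integral of \<open>H x y\<close> over \<open>x\<close>, apply Hoelder's inequality to
  \<open>H^r = (H * B^(r - 1))^r * (B^r)^(1 - r)\<close> for each \<open>x\<close> and integrate the result over \<open>x\<close>. The
  points with \<open>B y = 0\<close> are harmless, because there \<open>H\<close> vanishes almost everywhere.\<close>

lemma reverse_Minkowski:
  fixes H :: "'a \<Rightarrow> 'b \<Rightarrow> ennreal"
  assumes "sigma_finite_measure M" "sigma_finite_measure N"
    and [measurable]: "(\<lambda>(x, y). H x y) \<in> borel_measurable (M \<Otimes>\<^sub>M N)"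
    and r: "0 < r" "r < 1"
  shows "(\<integral>\<^sup>+x. (\<integral>\<^sup>+y. H x y powe r \<partial>N) powe (1 / r) \<partial>M) \<le>
     (\<integral>\<^sup>+y. (\<integral>\<^sup>+x. H x y \<partial>M) powe r \<partial>N) powe (1 / r)"
proof -
  interpret M: sigma_finite_measure M by fact
  interpret N: sigma_finite_measure N by fact
  interpret P: pair_sigma_finite M N by unfold_locales
  define B where "B y = (\<integral>\<^sup>+x. H x y \<partial>M)" for y
  define Z where "Z = (\<integral>\<^sup>+y. B y powe r \<partial>N)"
  have [measurable]: "B \<in> borel_measurable N" unfolding B_def by measurable
  show ?thesis
  proof (cases "Z = \<top>")
    case True then show ?thesis using r by (simp add: Z_def B_def)
  next
    case False
    have "AE y in N. B y powe r \<noteq> \<top>"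
      using nn_integral_PInf_AE[of "\<lambda>y. B y powe r" N] False by (simp add: Z_def)
    then have fin: "AE y in N. B y \<noteq> \<top>" using r by simp
    have "(\<integral>\<^sup>+x. \<integral>\<^sup>+y. H x y * indicator {0} (B y) \<partial>N \<partial>M) = (\<integral>\<^sup>+y. \<integral>\<^sup>+x. H x y * indicator {0} (B y) \<partial>M \<partial>N)"
      by (rule P.Fubini'[symmetric]) measurable
    also have "\<dots> = (\<integral>\<^sup>+y. B y * indicator {0} (B y) \<partial>N)"
      by (intro nn_integral_cong) (simp add: B_def nn_integral_multc)
    also have "\<dots> = (\<integral>\<^sup>+y. 0 \<partial>N)"
      by (intro nn_integral_cong) (auto split: split_indicator)
    also have "\<dots> = 0" by simp
    finally have "AE x in M. (\<integral>\<^sup>+y. H x y * indicator {0} (B y) \<partial>N) = 0"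
      by (subst (asm) nn_integral_0_iff_AE) auto
    then have zero: "AE x in M. AE y in N. B y = 0 \<longrightarrow> H x y = 0"
    proof (rule AE_mp)
      show "AE x in M. (\<integral>\<^sup>+y. H x y * indicator {0} (B y) \<partial>N) = 0 \<longrightarrow> (AE y in N. B y = 0 \<longrightarrow> H x y = 0)"
      proof (rule AE_I2, rule impI)
      fix x assume x: "x \<in> space M" "(\<integral>\<^sup>+y. H x y * indicator {0} (B y) \<partial>N) = 0"
      then have [measurable]: "(\<lambda>y. H x y) \<in> borel_measurable N"
        using measurable_Pair2[OF assms(3), of x] by simp
      from x show "AE y in N. B y = 0 \<longrightarrow> H x y = 0"
        by (subst (asm) nn_integral_0_iff_AE) (auto elim!: eventually_mono split: split_indicator_asm)
      qed
    qed
    have "AE x in M. (\<integral>\<^sup>+y. H x y powe r \<partial>N) powe (1 / r) \<le>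
       Z powe ((1 - r) / r) * (\<integral>\<^sup>+y. H x y * B y powe (r - 1) \<partial>N)"
      using zero
    proof (rule AE_mp)
      show "AE x in M. (AE y in N. B y = 0 \<longrightarrow> H x y = 0) \<longrightarrow> (\<integral>\<^sup>+y. H x y powe r \<partial>N) powe (1 / r) \<le>
          Z powe ((1 - r) / r) * (\<integral>\<^sup>+y. H x y * B y powe (r - 1) \<partial>N)"
      proof (rule AE_I2, rule impI)
      fix x assume x: "x \<in> space M" "AE y in N. B y = 0 \<longrightarrow> H x y = 0"
      then have [measurable]: "(\<lambda>y. H x y) \<in> borel_measurable N"
        using measurable_Pair2[OF assms(3), of x] by simp
      have "(\<integral>\<^sup>+y. H x y powe r \<partial>N) \<le> (\<integral>\<^sup>+y. (H x y * B y powe (r - 1)) powe r * (B y powe r) powe (1 - r) \<partial>N)"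
      proof (rule nn_integral_mono_AE)
        show "AE y in N. H x y powe r \<le> (H x y * B y powe (r - 1)) powe r * (B y powe r) powe (1 - r)"
          using x(2) fin
        proof eventually_elim
          case (elim y)
          show ?case
          proof (cases "B y" rule: ennreal_three_cases)
            case (real b)
            have "(B y powe (r - 1)) powe r * (B y powe r) powe (1 - r) = ennreal (b powr ((r - 1) * r + r * (1 - r)))"
              using real by (simp add: powe_ennreal powr_powr powr_add ennreal_mult)
            also have "\<dots> = 1" using real by (simp add: algebra_simps)
            finally show ?thesis using r by (simp add: powe_mult mult.assoc)
          qed (use elim r in auto)
        qed
      qed
      also have "\<dots> \<le> (\<integral>\<^sup>+y. H x y * B y powe (r - 1) \<partial>N) powe r * Z powe (1 - r)"
        unfolding Z_def by (intro nn_integral_Hoelder r) auto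
      finally have "(\<integral>\<^sup>+y. H x y powe r \<partial>N) powe (1 / r) \<le>
        ((\<integral>\<^sup>+y. H x y * B y powe (r - 1) \<partial>N) powe r * Z powe (1 - r)) powe (1 / r)"
        using r by (intro powe_mono) auto
      then show "(\<integral>\<^sup>+y. H x y powe r \<partial>N) powe (1 / r) \<le>
       Z powe ((1 - r) / r) * (\<integral>\<^sup>+y. H x y * B y powe (r - 1) \<partial>N)"
        using r by (simp add: powe_mult powe_powe mult.commute)
      qed
    qed
    then have "(\<integral>\<^sup>+x. (\<integral>\<^sup>+y. H x y powe r \<partial>N) powe (1 / r) \<partial>M) \<le>
       (\<integral>\<^sup>+x. Z powe ((1 - r) / r) * (\<integral>\<^sup>+y. H x y * B y powe (r - 1) \<partial>N) \<partial>M)"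
      by (rule nn_integral_mono_AE)
    also have "\<dots> = Z powe ((1 - r) / r) * (\<integral>\<^sup>+x. \<integral>\<^sup>+y. H x y * B y powe (r - 1) \<partial>N \<partial>M)"
      by (rule nn_integral_cmult) measurable
    also have "(\<integral>\<^sup>+x. \<integral>\<^sup>+y. H x y * B y powe (r - 1) \<partial>N \<partial>M) = (\<integral>\<^sup>+y. \<integral>\<^sup>+x. H x y * B y powe (r - 1) \<partial>M \<partial>N)"
      by (rule P.Fubini'[symmetric]) measurable
    also have "\<dots> = (\<integral>\<^sup>+y. B y * B y powe (r - 1) \<partial>N)"
      by (intro nn_integral_cong) (simp add: B_def nn_integral_multc)
    also have "\<dots> \<le> Z" unfolding Z_def
    proof (rule nn_integral_mono)
      fix y show "B y * B y powe (r - 1) \<le> B y powe r"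
        by (cases "B y" rule: ennreal_three_cases)
           (use r in \<open>auto simp: powe_ennreal ennreal_mult[symmetric] powr_mult_base powe_top_neg\<close>)
    qed
    also have "Z powe ((1 - r) / r) * Z = Z powe ((1 - r) / r + 1)"
      using r by (subst powe_add) auto
    also have "(1 - r) / r + 1 = 1 / r" using r by (simp add: field_simps)
    finally show ?thesis by (simp add: Z_def B_def mult_left_mono)
  qed
qed

section \<open>Monotone transport on the line\<close>

text \<open>An increasing map may miss part of the line, so only an inequality holds; it is the direction
  that a lower bound by transport uses.\<close>

lemma nn_integral_increasing_substitution_le:
  fixes S S' :: "real \<Rightarrow> real" and H :: "real \<Rightarrow> ennreal"
  assumes [measurable]: "H \<in> borel_measurable borel"
    and d: "\<And>z. (S has_real_derivative S' z) (at z)"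
    and c: "continuous_on UNIV S'" and p: "\<And>z. 0 \<le> S' z"
  shows "(\<integral>\<^sup>+z. H (S z) * ennreal (S' z) \<partial>lborel) \<le> (\<integral>\<^sup>+x. H x \<partial>lborel)"
proof -
  have S: "continuous_on UNIV S" using d DERIV_continuous_on by blast
  have [measurable]: "S \<in> borel_measurable borel" "S' \<in> borel_measurable borel"
    using S c by (simp_all add: borel_measurable_continuous_onI)
  have "(\<integral>\<^sup>+z. H (S z) * ennreal (S' z) \<partial>lborel) =
      (\<integral>\<^sup>+z. (SUP n::nat. H (S z) * ennreal (S' z) * indicator {-real n..real n} z) \<partial>lborel)"
  proof (rule nn_integral_cong)
    fix z :: real
    obtain n :: nat where n: "\<bar>z\<bar> \<le> real n" using real_arch_simple by blast
    show "H (S z) * ennreal (S' z) = (SUP n::nat. H (S z) * ennreal (S' z) * indicator {-real n..real n} z)"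
    proof (rule antisym)
      show "H (S z) * ennreal (S' z) \<le> (SUP n::nat. H (S z) * ennreal (S' z) * indicator {-real n..real n} z)"
        by (rule SUP_upper2[of n]) (use n in \<open>auto simp: abs_le_iff indicator_def\<close>)
      show "(SUP n::nat. H (S z) * ennreal (S' z) * indicator {-real n..real n} z) \<le> H (S z) * ennreal (S' z)"
        by (rule SUP_least) (auto split: split_indicator)
    qed
  qed
  also have "\<dots> = (SUP n::nat. \<integral>\<^sup>+z. H (S z) * ennreal (S' z) * indicator {-real n..real n} z \<partial>lborel)"
    by (rule nn_integral_monotone_convergence_SUP)
       (auto simp: incseq_def le_fun_def split: split_indicator)
  also have "\<dots> \<le> (\<integral>\<^sup>+x. H x \<partial>lborel)"
  proof (rule SUP_least)
    fix n :: nat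
    show "(\<integral>\<^sup>+z. H (S z) * ennreal (S' z) * indicator {-real n..real n} z \<partial>lborel) \<le> (\<integral>\<^sup>+x. H x \<partial>lborel)"
    proof (cases "n = 0")
      case True
      have "(\<integral>\<^sup>+z. H (S z) * ennreal (S' z) * indicator {-real n..real n} z \<partial>lborel) = (\<integral>\<^sup>+z. 0 \<partial>(lborel::real measure))"
        by (rule nn_integral_cong_AE, rule AE_mp[OF AE_lborel_singleton[of 0]])
           (auto simp: True split: split_indicator)
      then show ?thesis by simp
    next
      case False
      have "(\<integral>\<^sup>+x. H x * indicator {S (-real n)..S (real n)} x \<partial>lborel) =
          (\<integral>\<^sup>+z. H (S z) * ennreal (S' z) * indicator {-real n..real n} z \<partial>lborel)"
        by (rule nn_integral_substitution_aux)
           (use False d c p in \<open>auto intro: continuous_on_subset\<close>)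
      then have "(\<integral>\<^sup>+z. H (S z) * ennreal (S' z) * indicator {-real n..real n} z \<partial>lborel) =
          (\<integral>\<^sup>+x. H x * indicator {S (-real n)..S (real n)} x \<partial>lborel)" by simp
      also have "\<dots> \<le> (\<integral>\<^sup>+x. H x \<partial>lborel)"
        by (intro nn_integral_mono) (auto split: split_indicator)
      finally show ?thesis .
    qed
  qed
  finally show ?thesis .
qed

text \<open>\<open>T\<close> is the quantile function of the density \<open>F\<close> composed with the distribution function of the
  density \<open>G\<close>; its derivative is the change of variables formula.\<close>

lemma monotone_transport:
  fixes F G :: "real \<Rightarrow> real"
  assumes F: "continuous_on UNIV F" "\<And>x. 0 < F x" "(\<integral>\<^sup>+x. ennreal (F x) \<partial>lborel) = 1"
    and G: "continuous_on UNIV G" "\<And>x. 0 < G x" "(\<integral>\<^sup>+x. ennreal (G x) \<partial>lborel) = 1"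
  obtains T where "\<And>u. (T has_real_derivative G u / F (T u)) (at u)"
proof -
  have cdf_facts: "(\<forall>x. (A has_real_derivative F x) (at x)) \<and> strict_mono A \<and>
      (A \<longlongrightarrow> 0) at_bot \<and> (A \<longlongrightarrow> 1) at_top"
    if F: "continuous_on UNIV F" "\<And>x. 0 < F x" "(\<integral>\<^sup>+x. ennreal (F x) \<partial>lborel) = 1"
      and A: "A = cdf (density lborel (\<lambda>x. ennreal (F x)))" for F :: "real \<Rightarrow> real" and A
  proof -
    have [measurable]: "F \<in> borel_measurable borel" using F(1) by (rule borel_measurable_continuous_onI)
    interpret D: prob_space "density lborel (\<lambda>x. ennreal (F x))"
      by (rule prob_spaceI) (simp add: emeasure_density F(3))
    interpret D: real_distribution "density lborel (\<lambda>x. ennreal (F x))"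
      by unfold_locales simp
    have diff: "A y = A x + integral {x..y} F" if "x \<le> y" for x y
    proof (cases "x = y")
      case False
      then have "x < y" using that by simp
      have hi: "(F has_integral integral {x..y} F) {x..y}"
        by (intro integrable_integral integrable_continuous_real continuous_on_subset[OF F(1)]) auto
      have nn: "0 \<le> integral {x..y} F"
        using hi F(2) by (intro integral_nonneg) (auto simp: less_imp_le)
      have "emeasure (density lborel (\<lambda>x. ennreal (F x))) {x<..y} = (\<integral>\<^sup>+t. ennreal (F t) * indicator {x<..y} t \<partial>lborel)"
        by (simp add: emeasure_density)
      also have "\<dots> = (\<integral>\<^sup>+t. ennreal (F t) * indicator {x..y} t \<partial>lborel)"
        by (rule nn_integral_cong_AE, rule AE_mp[OF AE_lborel_singleton[of x]])
           (auto split: split_indicator)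
      also have "\<dots> = ennreal (integral {x..y} F)"
        by (rule nn_integral_has_integral_lebesgue'[OF _ hi]) (simp add: F(2) less_imp_le)
      finally have "D.prob {x<..y} = integral {x..y} F"
        using nn by (simp add: D.emeasure_eq_measure)
      then show ?thesis using D.cdf_diff_eq[OF \<open>x < y\<close>] A by simp
    qed simp
    have der: "(A has_real_derivative F x) (at x)" for x
    proof -
      have "((\<lambda>y. A (x - 1) + integral {x - 1..y} F) has_real_derivative F x) (at x within {x - 1..x + 1})"
        by (rule DERIV_add[OF DERIV_const integral_has_real_derivative, THEN DERIV_cong])
           (auto intro: continuous_on_subset[OF F(1)])
      then have "(A has_real_derivative F x) (at x within {x - 1..x + 1})"
        by (rule has_field_derivative_transform_within[where d = 1]) (use diff in auto)
      then have "(A has_real_derivative F x) (at x within {x - 1<..<x + 1})"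
        by (rule has_field_derivative_subset) auto
      then show ?thesis by (subst (asm) at_within_open) auto
    qed
    have "strict_mono A"
    proof (rule strict_monoI)
      fix x y :: real assume "x < y"
      then show "A x < A y" by (rule DERIV_pos_imp_increasing) (use der F(2) in blast)
    qed
    moreover have "(A \<longlongrightarrow> 0) at_bot" "(A \<longlongrightarrow> 1) at_top"
      using D.cdf_lim_at_bot D.cdf_lim_at_top_prob A by simp_all
    ultimately show ?thesis using der by blast
  qed
  define A where "A = cdf (density lborel (\<lambda>x. ennreal (F x)))"
  define B where "B = cdf (density lborel (\<lambda>x. ennreal (G x)))"
  note A = cdf_facts[OF F A_def] and B = cdf_facts[OF G B_def]
  have rangeA: "\<exists>x. A x = y" if y: "0 < y" "y < 1" for y
  proof -
    have "eventually (\<lambda>x. A x < y) at_bot" "eventually (\<lambda>x. y < A x) at_top"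
      using A y by (auto intro: order_tendstoD)
    then obtain x0 x1 where x: "A x0 < y" "y < A x1"
      by (meson eventually_happens trivial_limit_at_bot_linorder trivial_limit_at_top_linorder)
    then have "x0 \<le> x1" using A by (metis linorder_le_cases less_le_trans not_less strict_mono_less_eq)
    moreover have "continuous_on {x0..x1} A" using A by (intro DERIV_continuous_on) (auto intro: has_field_derivative_at_within)
    ultimately show ?thesis using IVT'[of A x0 y x1] x by auto
  qed
  have B01: "0 < B u" "B u < 1" for u
  proof -
    have "0 \<le> B (u - 1)"
    proof (rule tendsto_upperbound)
      show "(B \<longlongrightarrow> 0) at_bot" using B by simp
      show "eventually (\<lambda>x. B x \<le> B (u - 1)) at_bot"
        using B by (auto simp: eventually_at_bot_linorder strict_mono_less_eq)
    qed simp
    moreover have "B (u + 1) \<le> 1"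
    proof (rule tendsto_lowerbound)
      show "(B \<longlongrightarrow> 1) at_top" using B by simp
      show "eventually (\<lambda>x. B (u + 1) \<le> B x) at_top"
        using B by (auto simp: eventually_at_top_linorder strict_mono_less_eq)
    qed simp
    moreover have "B (u - 1) < B u" "B u < B (u + 1)" using B by (auto simp: strict_mono_less)
    ultimately show "0 < B u" "B u < 1" by linarith+
  qed
  have inj: "inj A" using A strict_mono_imp_inj_on by blast
  have AI: "A (inv A y) = y" if "0 < y" "y < 1" for y
    using rangeA[OF that] by (metis f_inv_into_f rangeI)
  have "((\<lambda>u. inv A (B u)) has_real_derivative G u / F (inv A (B u))) (at u)" for u
  proof -
    have "isCont (inv A) (A (inv A (B u)))"
      by (rule isCont_inverse_function[where d = 1])
         (use A inj in \<open>auto intro: DERIV_isCont\<close>)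
    then have "isCont (inv A) (B u)" using AI[OF B01] by simp
    then have "(inv A has_real_derivative inverse (F (inv A (B u)))) (at (B u))"
      using A F(2) B01 AI by (intro DERIV_inverse_function[where a = 0 and b = 1]) (auto simp: less_imp_neq[symmetric])
    then show ?thesis 
      using DERIV_chain2[of "inv A" "inverse (F (inv A (B u)))" B u "G u" UNIV] B by (simp add: field_simps)
  qed
  then show thesis by (rule that)
qed

section \<open>The sharp reverse Young inequality on the line\<close>

text \<open>The sharp constant of the reverse Young inequality on the line, that is its value on Gaussians
  (\<open>young_const_gaussian\<close>).\<close>

definition young_const :: "real \<Rightarrow> real \<Rightarrow> real" where
  "young_const c l = sqrt ((1 + c) powr (1 + c) /
     (l powr (l * c) * (1 + l * c) powr (1 + l * c) *
      ((1 - l) powr ((1 - l) * c) * (1 + (1 - l) * c) powr (1 + (1 - l) * c))))"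

text \<open>The linear map \<open>(z, w) \<mapsto> (l * z + w, (1 - l) * z - w)\<close> has determinant \<open>-1\<close>, and \<open>z\<close> is the
  sum of the two new coordinates.\<close>

lemma nn_integral_rotate:
  fixes Q :: "real \<Rightarrow> real \<Rightarrow> ennreal" and l :: real
  assumes [measurable]: "(\<lambda>(u, v). Q u v) \<in> borel_measurable (lborel \<Otimes>\<^sub>M lborel)"
  shows "(\<integral>\<^sup>+v. \<integral>\<^sup>+u. Q u v \<partial>lborel \<partial>lborel) =
    (\<integral>\<^sup>+w. \<integral>\<^sup>+z. Q (l * z + w) ((1 - l) * z - w) \<partial>lborel \<partial>lborel)"
proof -
  have [measurable]: "(\<lambda>(u, v). Q u v) \<in> borel_measurable (borel \<Otimes>\<^sub>M borel)"
    using assms by (simp cong: measurable_cong_sets)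
  have "(\<integral>\<^sup>+v. \<integral>\<^sup>+u. Q u v \<partial>lborel \<partial>lborel) = (\<integral>\<^sup>+v. \<integral>\<^sup>+z. Q (z - v) v \<partial>lborel \<partial>lborel)"
  proof (rule nn_integral_cong)
    fix v :: real
    show "(\<integral>\<^sup>+u. Q u v \<partial>lborel) = (\<integral>\<^sup>+z. Q (z - v) v \<partial>lborel)"
      by (subst nn_integral_real_affine[where c = 1 and t = "- v"]) auto
  qed
  also have "\<dots> = (\<integral>\<^sup>+z. \<integral>\<^sup>+v. Q (z - v) v \<partial>lborel \<partial>lborel)"
    by (rule lborel_pair.Fubini') measurable
  also have "\<dots> = (\<integral>\<^sup>+z. \<integral>\<^sup>+w. Q (l * z + w) ((1 - l) * z - w) \<partial>lborel \<partial>lborel)"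
  proof (rule nn_integral_cong)
    fix z :: real
    show "(\<integral>\<^sup>+v. Q (z - v) v \<partial>lborel) = (\<integral>\<^sup>+w. Q (l * z + w) ((1 - l) * z - w) \<partial>lborel)"
      by (subst nn_integral_real_affine[where c = "-1" and t = "(1 - l) * z"]) (auto simp: algebra_simps)
  qed
  also have "\<dots> = (\<integral>\<^sup>+w. \<integral>\<^sup>+z. Q (l * z + w) ((1 - l) * z - w) \<partial>lborel \<partial>lborel)"
    by (rule lborel_pair.Fubini'[symmetric]) measurable
  finally show ?thesis .
qed

text \<open>The graph of the convex function \<open>x powr - c\<close> lies above its tangent at \<open>y\<close>.\<close>

lemma neg_powr_tangent:
  fixes x y c :: real
  assumes "0 < x" "0 < y" "0 < c"
  shows "(1 + c) * y powr - c - c * (y powr (- c - 1) * x) \<le> x powr - c"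
proof -
  have "1 + c - c * (x / y) \<le> 1 - c * ln (x / y)"
    using mult_left_mono[OF ln_le_minus_one[of "x / y"], of c] assms by (simp add: right_diff_distrib)
  also have "\<dots> \<le> exp (- c * ln (x / y))" using exp_ge_add_one_self[of "- c * ln (x / y)"] by simp
  also have "\<dots> = (x / y) powr - c" using assms by (simp add: powr_def)
  finally have "y powr - c * (1 + c - c * (x / y)) \<le> y powr - c * (x / y) powr - c"
    by (intro mult_left_mono) auto
  also have "\<dots> = x powr - c" using assms by (simp add: powr_mult[symmetric])
  finally show ?thesis using assms by (simp add: powr_diff algebra_simps)
qed

lemma nn_integral_gaussian:
  assumes "0 < v"
  shows "(\<integral>\<^sup>+x. ennreal (exp (- x\<^sup>2 / (2 * v))) \<partial>lborel) = ennreal (sqrt (2 * pi * v))"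
proof -
  have "exp (- x\<^sup>2 / (2 * v)) = sqrt (2 * pi * v) * normal_density 0 (sqrt v) x" for x
    using assms by (simp add: normal_density_def field_simps)
  then have "(\<integral>\<^sup>+x. ennreal (exp (- x\<^sup>2 / (2 * v))) \<partial>lborel) =
      (\<integral>\<^sup>+x. ennreal (sqrt (2 * pi * v)) * ennreal (normal_density 0 (sqrt v) x) \<partial>lborel)"
    using assms by (simp add: ennreal_mult'[symmetric])
  also have "\<dots> = ennreal (sqrt (2 * pi * v)) * (\<integral>\<^sup>+x. ennreal (normal_density 0 (sqrt v) x) \<partial>lborel)"
    by (rule nn_integral_cmult) simp
  also have "(\<integral>\<^sup>+x. ennreal (normal_density 0 (sqrt v) x) \<partial>lborel) = 1"
    using assms by (subst nn_integral_eq_integral) auto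
  finally show ?thesis by simp
qed

lemma normal_density_nn_integral:
  "0 < \<sigma> \<Longrightarrow> (\<integral>\<^sup>+x. ennreal (normal_density 0 \<sigma> x) \<partial>lborel) = 1"
  by (subst nn_integral_eq_integral) auto

text \<open>The variance is chosen so that the power \<open>1 + l * c\<close> of the density has the exponent
  \<open>- u\<^sup>2 / (2 * l)\<close>, in which \<open>c\<close> no longer appears.\<close>

lemma normal_density_powr:
  assumes "0 < l" "0 < c"
  shows "normal_density 0 (sqrt (l * (1 + l * c))) u powr (1 + l * c) =
    (2 * pi * (l * (1 + l * c))) powr (- ((1 + l * c) / 2)) * exp (- u\<^sup>2 / (2 * l))"
proof -
  have p: "0 < 1 + l * c" "0 < 2 * pi * (l * (1 + l * c))" using assms by (simp_all add: add_pos_pos)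
  have "normal_density 0 (sqrt (l * (1 + l * c))) u =
      (2 * pi * (l * (1 + l * c))) powr (- (1 / 2)) * exp (- u\<^sup>2 / (2 * (l * (1 + l * c))))"
    using p assms by (simp add: normal_density_def powr_minus powr_half_sqrt field_simps)
  also have "\<dots> powr (1 + l * c) = (2 * pi * (l * (1 + l * c))) powr (- (1 / 2) * (1 + l * c)) *
      exp (- u\<^sup>2 / (2 * (l * (1 + l * c))) * (1 + l * c))"
    by (simp add: powr_mult powr_powr exp_powr_real)
  also have "- u\<^sup>2 / (2 * (l * (1 + l * c))) * (1 + l * c) = - u\<^sup>2 / (2 * l)"
  proof -
    have e: "- x / (2 * (a * k)) * k = - x / (2 * a)" if "k \<noteq> 0" for x a k :: real
      using that by (cases "a = 0") (auto simp: divide_simps)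
    show ?thesis using p(1) by (intro e) simp
  qed
  finally show ?thesis by simp
qed

text \<open>The left-hand side collects the factors that the Gaussian integrals in
  \<open>reverse_Young_transport\<close> leave over; the powers of \<open>2 * pi\<close> cancel.\<close>

lemma young_const_gaussian:
  assumes "0 < l" "l < 1" "0 < c"
  shows "(2 * pi * (l * (1 + l * c))) powr (- ((1 + l * c) / 2)) *
    (2 * pi * ((1 - l) * (1 + (1 - l) * c))) powr (- ((1 + (1 - l) * c) / 2)) *
    sqrt (2 * pi * (l * (1 - l))) * (2 * pi * (1 + c)) powr ((1 + c) / 2) = young_const c l"
    (is "?L = _")
proof -
  define m where "m = 1 - l"
  have m: "0 < m" "m = 1 - l" "l + m = 1" using assms by (auto simp: m_def)
  define a where "a = 1 + l * c"
  define b where "b = 1 + m * c"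
  have ab: "0 < a" "0 < b" using assms m by (auto simp: a_def b_def add_pos_pos)
  have "a + b = 2 + (l + m) * c" by (simp add: a_def b_def algebra_simps)
  then have ab_sum: "a + b = 2 + c" using m by simp
  have yc: "young_const c l = sqrt ((1 + c) powr (1 + c) / (l powr (l * c) * a powr a * (m powr (m * c) * b powr b)))"
    by (simp add: young_const_def a_def b_def m_def)
  have p: "0 < young_const c l" unfolding yc using assms m ab by simp
  have lnr: "ln (young_const c l) = ((1 + c) * ln (1 + c) - (l * c * ln l + a * ln a + (m * c * ln m + b * ln b))) / 2"
    unfolding yc using assms m ab by (simp add: ln_sqrt ln_div ln_mult ln_powr)
  have L: "?L = (2 * pi * (l * a)) powr (- (a / 2)) * (2 * pi * (m * b)) powr (- (b / 2)) *
      sqrt (2 * pi * (l * m)) * (2 * pi * (1 + c)) powr ((1 + c) / 2)"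
    by (simp add: a_def b_def m_def)
  have pL: "0 < ?L" unfolding L using assms m ab by simp
  define P where "P = ln (2 * pi)"
  have lm: "ln (2 * pi * x) = P + ln x" if "0 < x" for x
    using that by (simp add: P_def ln_mult)
  have sq: "ln (sqrt (2 * pi * (l * m))) = (P + (ln l + ln m)) / 2"
    using lm[of "l * m"] assms m by (simp add: ln_sqrt ln_mult)
  have pw: "ln ((2 * pi * x) powr e) = e * (P + ln x)" if "0 < x" for x e
    using that by (simp add: ln_powr lm)
  have "ln ?L = - (a / 2) * (P + (ln l + ln a)) + - (b / 2) * (P + (ln m + ln b)) +
      (P + (ln l + ln m)) / 2 + (1 + c) / 2 * (P + ln (1 + c))"
  proof -
    have ln4: "ln (w * x * y * z) = ln w + ln x + ln y + ln z" if "0 < w" "0 < x" "0 < y" "0 < z" for w x y z :: real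
      using that by (simp add: ln_mult)
    have pos: "0 < (2 * pi * (l * a)) powr (- (a / 2))" "0 < (2 * pi * (m * b)) powr (- (b / 2))"
        "0 < sqrt (2 * pi * (l * m))" "0 < (2 * pi * (1 + c)) powr ((1 + c) / 2)"
      using assms m ab by simp_all
    have la: "ln (l * a) = ln l + ln a" and mb: "ln (m * b) = ln m + ln b"
      using assms m ab by (simp_all add: ln_mult)
    have pos': "0 < l * a" "0 < m * b" "0 < 1 + c" using assms m ab by simp_all
    show ?thesis
      unfolding L ln4[OF pos] sq pw[OF pos'(1)] pw[OF pos'(2)] pw[OF pos'(3)] la mb ..
  qed
  also have "\<dots> = ((1 + c) * ln (1 + c) - (l * c * ln l + a * ln a + (m * c * ln m + b * ln b))) / 2 +
      P * (2 + c - (a + b)) / 2 + ln l * (1 + l * c - a) / 2 + ln m * (1 + m * c - b) / 2"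
    by (simp add: field_simps)
  also have "\<dots> = ln (young_const c l)" by (simp add: lnr ab_sum) (simp add: a_def b_def)
  finally show ?thesis using p pL by simp
qed

lemma young_const_pos: "0 < l \<Longrightarrow> l < 1 \<Longrightarrow> 0 < c \<Longrightarrow> 0 < young_const c l"
proof -
  assume a: "0 < l" "l < 1" "0 < c"
  then have "0 < 1 + l * c" "0 < 1 + (1 - l) * c" by (auto intro!: add_pos_pos)
  with a show ?thesis unfolding young_const_def by simp
qed

text \<open>The reverse Young inequality in dual form: its third function is replaced by a probability
  density \<open>\<Phi>\<close> with a negative exponent. Let \<open>T\<close> and \<open>U\<close> transport Gaussians to \<open>F\<close> and \<open>G\<close>. In the
  variables \<open>u\<close>, \<open>v\<close> with \<open>x = T u\<close>, \<open>y = U v\<close>, the integrand is a Gaussian factor times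
  \<open>(T'^l * U'^m * \<Phi> (T u + U v))^(- c)\<close>, where \<open>m = 1 - l\<close>. Replace \<open>T'^l * U'^m\<close> by the larger
  \<open>l * T' + m * U'\<close>. For fixed \<open>w\<close> this is the derivative of \<open>T u + U v\<close> along the line
  \<open>u = l * z + w\<close>, \<open>v = m * z - w\<close>, so that \<open>\<rho> w z\<close>, its product with \<open>\<Phi> (T u + U v)\<close>, has integral at
  most 1 over \<open>z\<close>. The variances of the Gaussians are such that the Gaussian factor splits into a function of \<open>z\<close>
  and a function of \<open>w\<close>. The integral over \<open>z\<close> is then minimal when \<open>\<rho> w\<close> is the Gaussian density \<open>\<rho>0\<close>, which
  no longer involves \<open>F\<close>, \<open>G\<close> and \<open>\<Phi>\<close>.\<close>

lemma reverse_Young_transport: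
  fixes F G \<Phi> :: "real \<Rightarrow> real"
  assumes F: "continuous_on UNIV F" "\<And>x. 0 < F x" "(\<integral>\<^sup>+x. ennreal (F x) \<partial>lborel) = 1"
    and G: "continuous_on UNIV G" "\<And>x. 0 < G x" "(\<integral>\<^sup>+x. ennreal (G x) \<partial>lborel) = 1"
    and P: "\<Phi> \<in> borel_measurable borel" "\<And>x. 0 < \<Phi> x" "(\<integral>\<^sup>+x. ennreal (\<Phi> x) \<partial>lborel) \<le> 1"
    and c: "0 < c" and l: "0 < l" "l < 1"
  shows "ennreal (young_const c l) \<le> (\<integral>\<^sup>+y. \<integral>\<^sup>+x.
      ennreal (F x powr (1 + l * c) * G y powr (1 + (1 - l) * c) * \<Phi> (x + y) powr - c) \<partial>lborel \<partial>lborel)"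
proof -
  define m where "m = 1 - l"
  have m: "0 < m" "l + m = 1" using l by (auto simp: m_def)
  \<comment> \<open>These variances make the mixed term \<open>z * w\<close> disappear from the exponent.\<close>
  define Fs where "Fs = normal_density 0 (sqrt (l * (1 + l * c)))"
  define Gs where "Gs = normal_density 0 (sqrt (m * (1 + m * c)))"
  have sd: "0 < l * (1 + l * c)" "0 < m * (1 + m * c)" using l m c by (auto intro!: mult_pos_pos add_pos_pos)
  have Fs: "continuous_on UNIV Fs" "\<And>x. 0 < Fs x" "(\<integral>\<^sup>+x. ennreal (Fs x) \<partial>lborel) = 1"
    and Gs: "continuous_on UNIV Gs" "\<And>x. 0 < Gs x" "(\<integral>\<^sup>+x. ennreal (Gs x) \<partial>lborel) = 1"
    using sd normal_density_nn_integral[of "sqrt (l * (1 + l * c))"] normal_density_nn_integral[of "sqrt (m * (1 + m * c))"]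
    unfolding Fs_def Gs_def
    by (simp_all add: normal_density_pos)
       (auto simp: normal_density_def[abs_def] intro!: continuous_intros)
  obtain T where T: "\<And>u. (T has_real_derivative Fs u / F (T u)) (at u)"
    using monotone_transport[OF F Fs] by blast
  obtain U where U: "\<And>u. (U has_real_derivative Gs u / G (U u)) (at u)"
    using monotone_transport[OF G Gs] by blast
  define T' where "T' u = Fs u / F (T u)" for u
  define U' where "U' u = Gs u / G (U u)" for u
  have cT: "continuous_on UNIV T" "continuous_on UNIV U"
    using T U by (auto intro!: DERIV_continuous_on)
  have cT': "continuous_on UNIV T'" "continuous_on UNIV U'"
    unfolding T'_def U'_def using F(2) G(2)
    by (auto intro!: continuous_intros Fs Gs continuous_on_compose2[OF F(1)] continuous_on_compose2[OF G(1)] cT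
         simp: less_imp_neq[symmetric])
  have pT: "0 < T' u" "0 < U' u" for u
    unfolding T'_def U'_def using F(2) G(2) Fs Gs by auto
  note [measurable] = P(1) borel_measurable_continuous_onI[OF F(1)] borel_measurable_continuous_onI[OF G(1)]
    borel_measurable_continuous_onI[OF cT(1)] borel_measurable_continuous_onI[OF cT(2)]
    borel_measurable_continuous_onI[OF cT'(1)] borel_measurable_continuous_onI[OF cT'(2)]
    borel_measurable_continuous_onI[OF Fs(1)] borel_measurable_continuous_onI[OF Gs(1)]
  define \<Psi> where "\<Psi> x y = F x powr (1 + l * c) * G y powr (1 + m * c) * \<Phi> (x + y) powr - c" for x y
  have [measurable]: "(\<lambda>(x, y). \<Psi> x y) \<in> borel_measurable (borel \<Otimes>\<^sub>M borel)"
    unfolding \<Psi>_def by measurable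
  define Q where "Q u v = \<Psi> (T u) (U v) * (T' u * U' v)" for u v
  have [measurable]: "(\<lambda>(x, y). Q x y) \<in> borel_measurable (borel \<Otimes>\<^sub>M borel)"
    unfolding Q_def by measurable
  have "(\<integral>\<^sup>+v. \<integral>\<^sup>+u. ennreal (Q u v) \<partial>lborel \<partial>lborel) =
      (\<integral>\<^sup>+v. (\<integral>\<^sup>+u. ennreal (\<Psi> (T u) (U v)) * ennreal (T' u) \<partial>lborel) * ennreal (U' v) \<partial>lborel)"
  proof (rule nn_integral_cong)
    fix v :: real
    have "(\<integral>\<^sup>+u. ennreal (Q u v) \<partial>lborel) = (\<integral>\<^sup>+u. ennreal (\<Psi> (T u) (U v)) * ennreal (T' u) * ennreal (U' v) \<partial>lborel)"
    proof (rule nn_integral_cong)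
      fix u :: real
      have "0 \<le> \<Psi> (T u) (U v)" unfolding \<Psi>_def by simp
      then show "ennreal (Q u v) = ennreal (\<Psi> (T u) (U v)) * ennreal (T' u) * ennreal (U' v)"
        unfolding Q_def using pT[of u] pT[of v] by (simp only: ennreal_mult less_imp_le mult_nonneg_nonneg mult.assoc)
    qed
    then show "(\<integral>\<^sup>+u. ennreal (Q u v) \<partial>lborel) = (\<integral>\<^sup>+u. ennreal (\<Psi> (T u) (U v)) * ennreal (T' u) \<partial>lborel) * ennreal (U' v)"
      by (simp add: nn_integral_multc)
  qed
  also have "\<dots> \<le> (\<integral>\<^sup>+v. (\<integral>\<^sup>+x. ennreal (\<Psi> x (U v)) \<partial>lborel) * ennreal (U' v) \<partial>lborel)"
    by (intro nn_integral_mono mult_right_mono nn_integral_increasing_substitution_le)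
       (use T cT' pT in \<open>auto simp: T'_def[symmetric] less_imp_le\<close>)
  also have "\<dots> \<le> (\<integral>\<^sup>+y. \<integral>\<^sup>+x. ennreal (\<Psi> x y) \<partial>lborel \<partial>lborel)"
    by (rule nn_integral_increasing_substitution_le[where H = "\<lambda>y. \<integral>\<^sup>+x. ennreal (\<Psi> x y) \<partial>lborel"])
       (use U cT' pT in \<open>auto simp: U'_def[symmetric] less_imp_le\<close>)
  finally have 1: "(\<integral>\<^sup>+v. \<integral>\<^sup>+u. ennreal (Q u v) \<partial>lborel \<partial>lborel) \<le> (\<integral>\<^sup>+y. \<integral>\<^sup>+x. ennreal (\<Psi> x y) \<partial>lborel \<partial>lborel)" .
  have 2: "(\<integral>\<^sup>+v. \<integral>\<^sup>+u. ennreal (Q u v) \<partial>lborel \<partial>lborel) =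
      (\<integral>\<^sup>+w. \<integral>\<^sup>+z. ennreal (Q (l * z + w) (m * z - w)) \<partial>lborel \<partial>lborel)"
    unfolding m_def by (rule nn_integral_rotate[where Q = "\<lambda>u v. ennreal (Q u v)"]) measurable
  define \<kappa> where "\<kappa> = (2 * pi * (l * (1 + l * c))) powr (- ((1 + l * c) / 2)) *
    (2 * pi * (m * (1 + m * c))) powr (- ((1 + m * c) / 2))"
  define L where "L = (2 * pi * (1 + c)) powr ((1 + c) / 2)"
  define \<rho>0 where "\<rho>0 = normal_density 0 (sqrt (1 + c))"
  define \<rho> where "\<rho> w z = \<Phi> (T (l * z + w) + U (m * z - w)) * (l * T' (l * z + w) + m * U' (m * z - w))" for w z
  have \<kappa>: "0 < \<kappa>" unfolding \<kappa>_def using sd by (intro mult_pos_pos) (simp_all only: powr_gt_zero, auto)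
  have L: "0 < L" unfolding L_def using c by simp
  have \<rho>0: "0 < \<rho>0 z" for z unfolding \<rho>0_def using c by (intro normal_density_pos) auto
  have \<rho>: "0 < \<rho> w z" for w z
    unfolding \<rho>_def using P(2) l m pT by (auto intro!: mult_pos_pos add_pos_pos)
  have [measurable]: "\<rho> w \<in> borel_measurable borel" for w unfolding \<rho>_def by measurable
  have [measurable]: "\<rho>0 \<in> borel_measurable borel" unfolding \<rho>0_def by measurable
  have Q_ge: "Q (l * z + w) (m * z - w) \<ge> \<kappa> * exp (- w\<^sup>2 / (2 * (l * m))) * (exp (- z\<^sup>2 / 2) * \<rho> w z powr - c)" for w z
  proof -
    define u where "u = l * z + w"
    define v where "v = m * z - w"
    have FT: "F (T u) = Fs u / T' u" "G (U v) = Gs v / U' v"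
      using F(2)[of "T u"] G(2)[of "U v"] Fs(2)[of u] Gs(2)[of v] by (simp_all add: T'_def U'_def)
    have gm: "T' u powr l * U' v powr m \<le> l * T' u + m * U' v"
      using Youngs_inequality_0[of l m "T' u" "U' v"] l m pT by (simp add: less_imp_le)
    have ex: "exp (- u\<^sup>2 / (2 * l)) * exp (- v\<^sup>2 / (2 * m)) = exp (- w\<^sup>2 / (2 * (l * m))) * exp (- z\<^sup>2 / 2)"
    proof -
      have "u\<^sup>2 / l = l * z\<^sup>2 + 2 * z * w + w\<^sup>2 / l" "v\<^sup>2 / m = m * z\<^sup>2 - 2 * z * w + w\<^sup>2 / m"
        unfolding u_def v_def using l m(1) by (simp_all add: field_simps power2_eq_square)
      then have "u\<^sup>2 / l + v\<^sup>2 / m = (l + m) * z\<^sup>2 + (w\<^sup>2 / l + w\<^sup>2 / m)"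
        by (simp add: algebra_simps)
      also have "w\<^sup>2 / l + w\<^sup>2 / m = (l + m) * w\<^sup>2 / (l * m)"
        using l m(1) by (simp add: field_simps)
      finally have "u\<^sup>2 / l + v\<^sup>2 / m = z\<^sup>2 + w\<^sup>2 / (l * m)" by (simp add: m(2))
      moreover have "- u\<^sup>2 / (2 * l) + - v\<^sup>2 / (2 * m) = - (u\<^sup>2 / l + v\<^sup>2 / m) / 2"
        using l m(1) by (simp add: field_simps)
      moreover have "- w\<^sup>2 / (2 * (l * m)) + - z\<^sup>2 / 2 = - (z\<^sup>2 + w\<^sup>2 / (l * m)) / 2"
        using l m(1) by (simp add: field_simps)
      ultimately show ?thesis by (simp only: exp_add[symmetric])
    qed
    have "Q u v = (Fs u powr (1 + l * c) * Gs v powr (1 + m * c)) *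
        (T' u powr - (l * c) * U' v powr - (m * c)) * \<Phi> (T u + U v) powr - c"
    proof -
      have pt: "(a / t) powr (1 + e) * t = a powr (1 + e) * t powr - e" if "0 < a" "0 < t" for a t e :: real
        using that by (simp add: powr_divide powr_minus divide_simps) (simp add: powr_add)
      have "Q u v = ((Fs u / T' u) powr (1 + l * c) * T' u) * ((Gs v / U' v) powr (1 + m * c) * U' v) * \<Phi> (T u + U v) powr - c"
        unfolding Q_def \<Psi>_def FT by (simp only: mult_ac)
      also have "\<dots> = (Fs u powr (1 + l * c) * T' u powr - (l * c)) * (Gs v powr (1 + m * c) * U' v powr - (m * c)) * \<Phi> (T u + U v) powr - c"
        using pT Fs(2) Gs(2) by (simp only: pt)
      finally show ?thesis by (simp only: mult_ac)
    qed
    also have "T' u powr - (l * c) * U' v powr - (m * c) = (T' u powr l * U' v powr m) powr - c"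
      by (simp add: powr_mult powr_powr)
    also have "Fs u powr (1 + l * c) * Gs v powr (1 + m * c) = \<kappa> * (exp (- u\<^sup>2 / (2 * l)) * exp (- v\<^sup>2 / (2 * m)))"
      unfolding Fs_def Gs_def \<kappa>_def using l m c by (simp add: normal_density_powr)
    also note ex
    finally have "Q u v = \<kappa> * (exp (- w\<^sup>2 / (2 * (l * m))) * exp (- z\<^sup>2 / 2)) *
       (T' u powr l * U' v powr m) powr - c * \<Phi> (T u + U v) powr - c" .
    also have "\<dots> \<ge> \<kappa> * (exp (- w\<^sup>2 / (2 * (l * m))) * exp (- z\<^sup>2 / 2)) *
       (l * T' u + m * U' v) powr - c * \<Phi> (T u + U v) powr - c"
    proof -
      have "0 < T' u powr l * U' v powr m" using pT[of u] pT[of v] by simp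
      then have "(l * T' u + m * U' v) powr - c \<le> (T' u powr l * U' v powr m) powr - c"
        using c gm by (intro powr_mono2') auto
      then show ?thesis using \<kappa> by (intro mult_right_mono mult_left_mono) auto
    qed
    also have "\<kappa> * (exp (- w\<^sup>2 / (2 * (l * m))) * exp (- z\<^sup>2 / 2)) *
       (l * T' u + m * U' v) powr - c * \<Phi> (T u + U v) powr - c =
       \<kappa> * exp (- w\<^sup>2 / (2 * (l * m))) * (exp (- z\<^sup>2 / 2) * \<rho> w z powr - c)"
      unfolding \<rho>_def u_def[symmetric] v_def[symmetric] by (simp add: powr_mult mult_ac)
    finally show ?thesis unfolding u_def v_def .
  qed
  \<comment> \<open>Along \<open>\<rho>0\<close> the slope of the tangent used below is constant, so that only the integral of \<open>\<rho> w\<close> matters.\<close>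
  have kL: "exp (- z\<^sup>2 / 2) * \<rho>0 z powr (- c - 1) = L" for z
  proof -
    have "\<rho>0 z = (2 * pi * (1 + c)) powr (- (1 / 2)) * exp (- z\<^sup>2 / (2 * (1 + c)))"
      unfolding \<rho>0_def normal_density_def using c by (simp add: powr_minus powr_half_sqrt field_simps)
    then have "\<rho>0 z powr (- c - 1) = (2 * pi * (1 + c)) powr (- (1 / 2) * (- c - 1)) * exp (- z\<^sup>2 / (2 * (1 + c)) * (- c - 1))"
      by (simp add: powr_mult powr_powr exp_powr_real)
    also have "- z\<^sup>2 / (2 * (1 + c)) * (- c - 1) = z\<^sup>2 / 2" using c by (simp add: field_simps)
    also have "- (1 / 2) * (- c - 1) = (1 + c) / 2" by (simp add: field_simps)
    finally show ?thesis unfolding L_def by (simp add: exp_minus)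
  qed
  have inner: "ennreal L \<le> (\<integral>\<^sup>+z. ennreal (exp (- z\<^sup>2 / 2) * \<rho> w z powr - c) \<partial>lborel)" for w
  proof -
    have pt: "(1 + c) * L * \<rho>0 z \<le> exp (- z\<^sup>2 / 2) * \<rho> w z powr - c + c * L * \<rho> w z" for z
    proof -
      define A B R where "A = \<rho>0 z powr - c" and "B = \<rho>0 z powr (- c - 1)" and "R = \<rho> w z powr - c"
      define e where "e = exp (- z\<^sup>2 / 2)"
      have "(1 + c) * A - c * (B * \<rho> w z) \<le> R"
        unfolding A_def B_def R_def by (rule neg_powr_tangent[OF \<rho> \<rho>0 c])
      then have "e * ((1 + c) * A - c * (B * \<rho> w z)) \<le> e * R"
        by (intro mult_left_mono) (simp_all add: e_def)
      moreover have "A = B * \<rho>0 z"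
        using \<rho>0[of z] by (simp add: A_def B_def powr_diff)
      moreover have "L = e * B" unfolding e_def B_def using kL[of z] by simp
      ultimately have "(1 + c) * L * \<rho>0 z \<le> e * R + c * L * \<rho> w z" by (simp add: algebra_simps)
      then show ?thesis by (simp only: e_def R_def)
    qed
    have dS: "((\<lambda>z. T (l * z + w) + U (m * z - w)) has_real_derivative (l * T' (l * z + w) + m * U' (m * z - w))) (at z)" for z
      unfolding T'_def U'_def
      by (auto intro!: derivative_eq_intros DERIV_chain2[OF T] DERIV_chain2[OF U] simp: mult.commute)
    have "(\<integral>\<^sup>+z. ennreal (\<rho> w z) \<partial>lborel) = (\<integral>\<^sup>+z. ennreal (\<Phi> (T (l * z + w) + U (m * z - w))) * ennreal (l * T' (l * z + w) + m * U' (m * z - w)) \<partial>lborel)"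
      unfolding \<rho>_def using P(2) by (intro nn_integral_cong ennreal_mult') (simp add: less_imp_le)
    also have "\<dots> \<le> (\<integral>\<^sup>+x. ennreal (\<Phi> x) \<partial>lborel)"
      by (rule nn_integral_increasing_substitution_le)
         (use dS l m pT cT' in \<open>auto intro!: continuous_intros add_nonneg_nonneg mult_nonneg_nonneg
           continuous_on_compose2[OF cT'(1)] continuous_on_compose2[OF cT'(2)] simp: less_imp_le\<close>)
    also note P(3)
    finally have \<rho>1: "(\<integral>\<^sup>+z. ennreal (\<rho> w z) \<partial>lborel) \<le> 1" .
    have "ennreal L + ennreal (c * L) = ennreal ((1 + c) * L) * (\<integral>\<^sup>+z. ennreal (\<rho>0 z) \<partial>lborel)"
      unfolding \<rho>0_def using c L by (subst normal_density_nn_integral) (auto simp: algebra_simps ennreal_plus[symmetric] simp del: ennreal_plus)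
    also have "\<dots> = (\<integral>\<^sup>+z. ennreal ((1 + c) * L * \<rho>0 z) \<partial>lborel)"
      using c L by (subst nn_integral_cmult[symmetric]) (auto simp: ennreal_mult')
    also have "\<dots> \<le> (\<integral>\<^sup>+z. ennreal (exp (- z\<^sup>2 / 2) * \<rho> w z powr - c) + ennreal (c * L) * ennreal (\<rho> w z) \<partial>lborel)"
      using c L \<rho> pt
      by (intro nn_integral_mono) (auto simp: ennreal_mult'[symmetric] ennreal_plus[symmetric] less_imp_le simp del: ennreal_plus intro!: ennreal_leI)
    also have "\<dots> = (\<integral>\<^sup>+z. ennreal (exp (- z\<^sup>2 / 2) * \<rho> w z powr - c) \<partial>lborel) + ennreal (c * L) * (\<integral>\<^sup>+z. ennreal (\<rho> w z) \<partial>lborel)"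
      by (simp add: nn_integral_add nn_integral_cmult)
    also have "\<dots> \<le> (\<integral>\<^sup>+z. ennreal (exp (- z\<^sup>2 / 2) * \<rho> w z powr - c) \<partial>lborel) + ennreal (c * L)"
      using mult_left_mono[OF \<rho>1, of "ennreal (c * L)"] by (intro add_left_mono) simp
    finally show ?thesis
      unfolding add.commute[of _ "ennreal (c * L)"] ennreal_add_left_cancel_le by simp
  qed
  have "ennreal (young_const c l) = ennreal (\<kappa> * L) * (\<integral>\<^sup>+w. ennreal (exp (- w\<^sup>2 / (2 * (l * m)))) \<partial>lborel)"
    using l m c \<kappa> L young_const_gaussian[of l c] nn_integral_gaussian[of "l * m"]
    by (simp add: ennreal_mult'[symmetric] \<kappa>_def L_def m_def[symmetric] mult_ac)
  also have "\<dots> = (\<integral>\<^sup>+w. ennreal (\<kappa> * exp (- w\<^sup>2 / (2 * (l * m)))) * ennreal L \<partial>lborel)"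
    using \<kappa> L by (subst nn_integral_cmult[symmetric]) (auto simp: ennreal_mult'[symmetric] mult_ac)
  also have "\<dots> \<le> (\<integral>\<^sup>+w. ennreal (\<kappa> * exp (- w\<^sup>2 / (2 * (l * m)))) * (\<integral>\<^sup>+z. ennreal (exp (- z\<^sup>2 / 2) * \<rho> w z powr - c) \<partial>lborel) \<partial>lborel)"
    by (intro nn_integral_mono mult_left_mono inner) auto
  also have "\<dots> = (\<integral>\<^sup>+w. \<integral>\<^sup>+z. ennreal (\<kappa> * exp (- w\<^sup>2 / (2 * (l * m))) * (exp (- z\<^sup>2 / 2) * \<rho> w z powr - c)) \<partial>lborel \<partial>lborel)"
    using \<kappa> by (simp add: nn_integral_cmult ennreal_mult')
  also have "\<dots> \<le> (\<integral>\<^sup>+w. \<integral>\<^sup>+z. ennreal (Q (l * z + w) (m * z - w)) \<partial>lborel \<partial>lborel)"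
    by (intro nn_integral_mono ennreal_leI Q_ge)
  also note 2[symmetric]
  also note 1
  finally show ?thesis unfolding \<Psi>_def m_def .
qed

lemma powe_strict_mono: "0 < a \<Longrightarrow> x < y \<Longrightarrow> x powe a < y powe a"
  using powe_le_cancel[of a y x] by (meson not_less)

text \<open>Continuity holds because raising to a positive power is an order isomorphism.\<close>

lemma tendsto_powe:
  assumes a: "0 < a" and X: "(X \<longlongrightarrow> x) F"
  shows "((\<lambda>n. X n powe a) \<longlongrightarrow> x powe a) F"
proof (rule order_tendstoI)
  fix y assume "y < x powe a"
  with a have "y powe (1 / a) < x"
    using powe_strict_mono[of "1 / a" y "x powe a"] by (simp add: powe_powe)
  with X have "eventually (\<lambda>n. y powe (1 / a) < X n) F" by (rule order_tendstoD)
  then show "eventually (\<lambda>n. y < X n powe a) F"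
  proof eventually_elim
    case (elim n)
    with a show ?case using powe_strict_mono[of a "y powe (1 / a)" "X n"] by (simp add: powe_powe)
  qed
next
  fix y assume "x powe a < y"
  with a have "x < y powe (1 / a)"
    using powe_strict_mono[of "1 / a" "x powe a" y] by (simp add: powe_powe)
  with X have "eventually (\<lambda>n. X n < y powe (1 / a)) F" by (rule order_tendstoD)
  then show "eventually (\<lambda>n. X n powe a < y) F"
  proof eventually_elim
    case (elim n)
    with a show ?case using powe_strict_mono[of a "X n" "y powe (1 / a)"] by (simp add: powe_powe)
  qed
qed

definition conv :: "('a::euclidean_space \<Rightarrow> ennreal) \<Rightarrow> ('a \<Rightarrow> ennreal) \<Rightarrow> 'a \<Rightarrow> ennreal" where
  "conv f g z = (\<integral>\<^sup>+y. f (z - y) * g y \<partial>lborel)"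

lemma measurable_conv [measurable]:
  assumes [measurable]: "f \<in> borel_measurable borel" "g \<in> borel_measurable borel"
  shows "conv f g \<in> borel_measurable borel"
  unfolding conv_def by measurable

lemma conv_mono: "(\<And>x. f x \<le> f' x) \<Longrightarrow> (\<And>x. g x \<le> g' x) \<Longrightarrow> conv f g z \<le> conv f' g' z"
  unfolding conv_def by (intro nn_integral_mono mult_mono) auto

lemma AE_lborel_reflect:
  fixes P :: "real \<Rightarrow> bool"
  assumes "AE x in lborel. P x"
  shows "AE y in lborel. P (z - y)"
proof -
  obtain N where N: "N \<in> null_sets lborel" "{x. \<not> P x} \<subseteq> N"
    using assms by (auto elim: AE_E2 simp: eventually_ae_filter)
  then have [measurable]: "N \<in> sets borel" by (auto simp: null_sets_def)
  have "AE y in lborel. z + (- 1) * y \<notin> N"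
    by (rule AE_borel_affine) (use AE_not_in[OF N(1)] in auto)
  then show ?thesis by eventually_elim (use N(2) in auto)
qed

lemma not_AE_lborel_False: "\<not> (AE x in (lborel :: real measure). False)"
  by (simp add: AE_iff_null null_sets_def)

text \<open>The majorant for truncations: it is positive and its convolution square has finite integrals
  of all positive powers.\<close>

abbreviation (input) bump :: "real \<Rightarrow> real" where "bump x \<equiv> exp (- x\<^sup>2)"

lemma bump_powr_integral_finite:
  assumes "0 < p"
  shows "(\<integral>\<^sup>+x. ennreal ((M * bump x) powr p) \<partial>lborel) < \<top>"
proof -
  have "(M * bump x) powr p = M powr p * exp (- x\<^sup>2 / (2 * (1 / (2 * p))))" for x
    using assms by (simp add: powr_mult exp_powr_real)
  then have "(\<integral>\<^sup>+x. ennreal ((M * bump x) powr p) \<partial>lborel) =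
      ennreal (M powr p) * (\<integral>\<^sup>+x. ennreal (exp (- x\<^sup>2 / (2 * (1 / (2 * p))))) \<partial>lborel)"
    by (subst nn_integral_cmult[symmetric]) (auto simp: ennreal_mult')
  also have "\<dots> = ennreal (M powr p) * ennreal (sqrt (2 * pi * (1 / (2 * p))))"
    using assms by (subst nn_integral_gaussian) auto
  finally show ?thesis by (simp add: ennreal_mult_less_top)
qed

lemma conv_bump:
  "conv (\<lambda>x. ennreal (bump x)) (\<lambda>x. ennreal (bump x)) z = ennreal (sqrt (pi / 2) * exp (- z\<^sup>2 / 2))"
proof -
  have "conv (\<lambda>x. ennreal (bump x)) (\<lambda>x. ennreal (bump x)) z =
      (\<integral>\<^sup>+y. ennreal (exp (- z\<^sup>2 / 2) * exp (- (y - z / 2)\<^sup>2 / (2 * (1 / 4)))) \<partial>lborel)"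
    unfolding conv_def
    by (intro nn_integral_cong) (auto simp: ennreal_mult'[symmetric] exp_add[symmetric] power2_eq_square field_simps)
  also have "\<dots> = ennreal (exp (- z\<^sup>2 / 2)) * (\<integral>\<^sup>+y. ennreal (exp (- (y - z / 2)\<^sup>2 / (2 * (1 / 4)))) \<partial>lborel)"
    by (subst nn_integral_cmult[symmetric]) (auto simp: ennreal_mult')
  also have "(\<integral>\<^sup>+y. ennreal (exp (- (y - z / 2)\<^sup>2 / (2 * (1 / 4)))) \<partial>lborel) = (\<integral>\<^sup>+y. ennreal (exp (- y\<^sup>2 / (2 * (1 / 4)))) \<partial>lborel)"
    by (subst nn_integral_real_affine[where c = 1 and t = "z / 2"]) auto
  also have "\<dots> = ennreal (sqrt (2 * pi * (1 / 4)))" by (rule nn_integral_gaussian) simp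
  finally show ?thesis by (simp add: ennreal_mult'[symmetric] mult.commute)
qed

text \<open>Use \<open>reverse_Young_transport\<close> for the probability densities proportional to \<open>f^(1 / a)\<close>,
  \<open>g^(1 / b)\<close> and \<open>h^r\<close>, where \<open>h\<close> is the convolution. Since \<open>r * c = 1 - r\<close>, the double integral there is a
  constant times that of \<open>f x * g y * h (x + y)^(r - 1)\<close>, which is the integral of \<open>h^r\<close>.\<close>

lemma reverse_Young_positive:
  fixes f g :: "real \<Rightarrow> real"
  assumes f: "continuous_on UNIV f" "\<And>x. 0 < f x" "\<And>x. f x \<le> M * bump x"
    and g: "continuous_on UNIV g" "\<And>x. 0 < g x" "\<And>x. g x \<le> M * bump x"
    and c: "0 < c" and l: "0 < l" "l < 1"
  shows "ennreal (young_const c l) *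
      (qnorm lborel (1 + l * c) (\<lambda>x. ennreal (f x)) *
       qnorm lborel (1 + (1 - l) * c) (\<lambda>x. ennreal (g x))) \<le>
    qnorm lborel (1 + c) (conv (\<lambda>x. ennreal (f x)) (\<lambda>x. ennreal (g x)))"
proof -
  define a where "a = 1 + l * c"
  define b where "b = 1 + (1 - l) * c"
  define r where "r = 1 / (1 + c)"
  have a: "0 < a" "0 < 1 / a" and b: "0 < b" "0 < 1 / b" and r: "0 < r" "r < 1" "1 + c = 1 / r" "r * c = 1 - r"
  proof -
    show ab: "0 < a" "0 < b" using l c by (auto simp: a_def b_def intro!: add_pos_pos)
    then show "0 < 1 / a" "0 < 1 / b" by simp_all
    show "0 < r" "r < 1" "1 + c = 1 / r" "r * c = 1 - r" using c by (auto simp: r_def field_simps)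
  qed
  note [measurable] = borel_measurable_continuous_onI[OF f(1)] borel_measurable_continuous_onI[OF g(1)]
  have M: "0 < M" using f(2)[of 0] f(3)[of 0] by simp
  have norm: "\<exists>P>0. (\<integral>\<^sup>+x. ennreal (f x) powe (1 / a) \<partial>lborel) = ennreal P"
    if "\<And>x. 0 < f x" "\<And>x. f x \<le> M * bump x" "f \<in> borel_measurable borel" "0 < a" for f :: "real \<Rightarrow> real" and a
  proof -
    note that(3)[measurable]
    have "(\<integral>\<^sup>+x. ennreal (f x) powe (1 / a) \<partial>lborel) \<le> (\<integral>\<^sup>+x. ennreal ((M * bump x) powr (1 / a)) \<partial>lborel)"
      using that by (intro nn_integral_mono) (auto simp: powe_ennreal less_imp_le intro!: ennreal_leI powr_mono2)
    also have "\<dots> < \<top>" using that by (intro bump_powr_integral_finite) simp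
    finally have fin: "(\<integral>\<^sup>+x. ennreal (f x) powe (1 / a) \<partial>lborel) \<noteq> \<top>" by simp
    have "(\<integral>\<^sup>+x. ennreal (f x) powe (1 / a) \<partial>lborel) \<noteq> 0"
    proof
      assume "(\<integral>\<^sup>+x. ennreal (f x) powe (1 / a) \<partial>lborel) = 0"
      then have "AE x in lborel. ennreal (f x) powe (1 / a) = 0"
        by (subst (asm) nn_integral_0_iff_AE) auto
      then have "AE x in (lborel :: real measure). False"
        by eventually_elim (use that in \<open>auto simp: powe_ennreal less_imp_neq[symmetric]\<close>)
      then show False by (simp add: not_AE_lborel_False)
    qed
    with fin show ?thesis
      by (cases "(\<integral>\<^sup>+x. ennreal (f x) powe (1 / a) \<partial>lborel)" rule: ennreal_three_cases) auto
  qed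
  obtain P where P: "0 < P" "(\<integral>\<^sup>+x. ennreal (f x) powe (1 / a) \<partial>lborel) = ennreal P"
    using norm[of f a] f a by auto
  obtain Q where Q: "0 < Q" "(\<integral>\<^sup>+x. ennreal (g x) powe (1 / b) \<partial>lborel) = ennreal Q"
    using norm[of g b] g b by auto
  define hE where "hE = conv (\<lambda>x. ennreal (f x)) (\<lambda>x. ennreal (g x))"
  have [measurable]: "hE \<in> borel_measurable borel" unfolding hE_def by measurable
  have hE_ex: "\<exists>y>0. hE z = ennreal y" for z
  proof -
    have "hE z \<le> conv (\<lambda>x. ennreal (M * bump x)) (\<lambda>x. ennreal (M * bump x)) z"
      unfolding hE_def by (intro conv_mono ennreal_leI f g)
    also have "\<dots> = ennreal (M * M) * conv (\<lambda>x. ennreal (bump x)) (\<lambda>x. ennreal (bump x)) z"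
      unfolding conv_def using M
      by (subst nn_integral_cmult[symmetric]) (auto simp: ennreal_mult'[symmetric] mult_ac intro!: nn_integral_cong)
    also have "\<dots> < \<top>" unfolding conv_bump by (simp add: ennreal_mult_less_top)
    finally have fin: "hE z \<noteq> \<top>" by simp
    have "hE z \<noteq> 0"
    proof
      assume "hE z = 0"
      then have "AE y in lborel. ennreal (f (z - y)) * ennreal (g y) = 0"
        unfolding hE_def conv_def by (subst (asm) nn_integral_0_iff_AE) auto
      then have "AE x in (lborel :: real measure). False"
        by eventually_elim (use f(2) g(2) in \<open>simp add: less_imp_neq[symmetric] not_le\<close>)
      then show False by (simp add: not_AE_lborel_False)
    qed
    with fin show ?thesis by (cases "hE z" rule: ennreal_three_cases) auto
  qed
  define h where "h z = enn2real (hE z)" for z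
  have h: "0 < h z" "hE z = ennreal (h z)" for z
    using hE_ex[of z] by (auto simp: h_def)
  have [measurable]: "h \<in> borel_measurable borel" unfolding h_def by measurable
  define HH where "HH = (\<integral>\<^sup>+z. hE z powe r \<partial>lborel)"
  have HH: "HH = (\<integral>\<^sup>+z. ennreal (h z powr r) \<partial>lborel)"
    unfolding HH_def h(2) using h(1) by (simp add: powe_ennreal)
  have main: "ennreal (young_const c l) * (ennreal P powe a * ennreal Q powe b) \<le> HH powe (1 + c)"
  proof (cases "HH = \<top>")
    case True then show ?thesis using c by simp
  next
    case False
    have "HH \<noteq> 0"
    proof
      assume "HH = 0"
      then have "AE z in lborel. ennreal (h z powr r) = 0"
        unfolding HH by (subst (asm) nn_integral_0_iff_AE) auto
      then have "AE x in (lborel :: real measure). False"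
        by eventually_elim (use h(1) in \<open>simp add: less_imp_neq[symmetric] not_le\<close>)
      then show False by (simp add: not_AE_lborel_False)
    qed
    with False obtain K where K: "0 < K" "HH = ennreal K"
      by (cases HH rule: ennreal_three_cases) auto
    have dens: "(\<integral>\<^sup>+x. ennreal (f x powr e / P) \<partial>lborel) = 1"
      if "(\<integral>\<^sup>+x. ennreal (f x powr e) \<partial>lborel) = ennreal P" "0 < P" "f \<in> borel_measurable borel"
      for f :: "real \<Rightarrow> real" and e P
    proof -
      have "(\<integral>\<^sup>+x. ennreal (f x powr e / P) \<partial>lborel) = (\<integral>\<^sup>+x. ennreal (f x powr e) * ennreal (1 / P) \<partial>lborel)"
        using that by (simp add: ennreal_mult[symmetric])
      also have "\<dots> = ennreal P * ennreal (1 / P)"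
        using that by (subst nn_integral_multc) auto
      finally show ?thesis using that(2) by (simp add: ennreal_mult'[symmetric])
    qed
    have cp: "continuous_on UNIV (\<lambda>x. f x powr e / P)" if "continuous_on UNIV f" "\<And>x. 0 < f x" "0 < P"
      for f :: "real \<Rightarrow> real" and e P
      using that by (intro continuous_intros) (auto simp: less_imp_neq[symmetric])
    have intf: "(\<integral>\<^sup>+x. ennreal (f x powr (1 / a)) \<partial>lborel) = ennreal P"
      and intg: "(\<integral>\<^sup>+x. ennreal (g x powr (1 / b)) \<partial>lborel) = ennreal Q"
      using P Q f(2) g(2) by (simp_all add: powe_ennreal)
    have 1: "ennreal (young_const c l) \<le> (\<integral>\<^sup>+y. \<integral>\<^sup>+x.
      ennreal ((f x powr (1 / a) / P) powr (1 + l * c) * (g y powr (1 / b) / Q) powr (1 + (1 - l) * c) * (h (x + y) powr r / K) powr - c) \<partial>lborel \<partial>lborel)"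
      by (rule reverse_Young_transport)
         (use cp[OF f(1,2)] P cp[OF g(1,2)] Q f(2) g(2) h K dens[OF intf P(1)] dens[OF intg Q(1)] dens[of h r K] HH c l in
           \<open>auto simp: less_imp_neq[symmetric]\<close>)
    have pw: "(f x powr (1 / a) / P) powr (1 + l * c) * (g y powr (1 / b) / Q) powr (1 + (1 - l) * c) * (h (x + y) powr r / K) powr - c
        = (K powr c / (P powr a * Q powr b)) * (f x * g y * h (x + y) powr (r - 1))" for x y
    proof -
      have "(f x powr (1 / a) / P) powr (1 + l * c) = f x / P powr a"
        using f(2)[of x] P a by (simp add: a_def[symmetric] powr_divide powr_powr)
      moreover have "(g y powr (1 / b) / Q) powr (1 + (1 - l) * c) = g y / Q powr b"
        using g(2)[of y] Q b by (simp add: b_def[symmetric] powr_divide powr_powr)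
      moreover have "(h (x + y) powr r / K) powr - c = K powr c * h (x + y) powr (r - 1)"
      proof -
        have e: "r - 1 = - (r * c)" using r(4) by simp
        show ?thesis unfolding e using h(1)[of "x + y"] K by (simp add: powr_divide powr_powr powr_minus field_simps)
      qed
      ultimately show ?thesis by simp
    qed
    have "(\<integral>\<^sup>+y. \<integral>\<^sup>+x. ennreal (f x * g y * h (x + y) powr (r - 1)) \<partial>lborel \<partial>lborel) =
        (\<integral>\<^sup>+y. \<integral>\<^sup>+z. ennreal (f (z - y) * g y * h z powr (r - 1)) \<partial>lborel \<partial>lborel)"
    proof (rule nn_integral_cong)
      fix y :: real
      show "(\<integral>\<^sup>+x. ennreal (f x * g y * h (x + y) powr (r - 1)) \<partial>lborel) = (\<integral>\<^sup>+z. ennreal (f (z - y) * g y * h z powr (r - 1)) \<partial>lborel)"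
        by (subst nn_integral_real_affine[where c = 1 and t = "- y"]) auto
    qed
    also have "\<dots> = (\<integral>\<^sup>+z. \<integral>\<^sup>+y. ennreal (f (z - y) * g y * h z powr (r - 1)) \<partial>lborel \<partial>lborel)"
      by (rule lborel_pair.Fubini') measurable
    also have "\<dots> = (\<integral>\<^sup>+z. hE z * ennreal (h z powr (r - 1)) \<partial>lborel)"
      unfolding hE_def conv_def using f(2) g(2)
      by (intro nn_integral_cong, subst nn_integral_multc[symmetric])
         (auto simp: ennreal_mult' less_imp_le intro!: nn_integral_cong)
    also have "\<dots> = HH"
      unfolding HH using h(1) by (intro nn_integral_cong)
        (simp add: h(2) ennreal_mult'[symmetric] less_imp_le powr_mult_base)
    finally have 2: "(\<integral>\<^sup>+y. \<integral>\<^sup>+x. ennreal (f x * g y * h (x + y) powr (r - 1)) \<partial>lborel \<partial>lborel) = ennreal K"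
      by (simp add: K)
    define k where "k = K powr c / (P powr a * Q powr b)"
    have k: "0 < k" using P Q K by (simp add: k_def)
    have "ennreal (young_const c l) \<le> ennreal k * ennreal K"
      using 1 unfolding pw 2[symmetric] k_def[symmetric] using k
      by (simp add: ennreal_mult' less_imp_le nn_integral_cmult)
    then have "young_const c l \<le> K powr c / (P powr a * Q powr b) * K"
      using k K by (simp add: ennreal_mult'[symmetric] less_imp_le k_def)
    then have "young_const c l * (P powr a * Q powr b) \<le> K powr (1 + c)"
      using P Q K by (simp add: field_simps powr_add)
    then show ?thesis
      using P Q K young_const_pos[OF l c] by (simp add: powe_ennreal ennreal_mult'[symmetric] less_imp_le ennreal_leI)
  qed
  then show ?thesis unfolding HH_def hE_def P(2)[symmetric] Q(2)[symmetric] a_def b_def r_def .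
qed

text \<open>A measurable function is an almost everywhere limit of continuous ones. Clipping these
  between 0 and \<open>M * bump\<close> and adding \<open>bump / (n + 1)\<close> makes them positive with a common majorant, so that all
  three integrals converge.\<close>

lemma reverse_Young_dominated:
  fixes f g :: "real \<Rightarrow> real"
  assumes f: "f \<in> borel_measurable borel" "\<And>x. 0 \<le> f x" "\<And>x. f x \<le> M * bump x"
    and g: "g \<in> borel_measurable borel" "\<And>x. 0 \<le> g x" "\<And>x. g x \<le> M * bump x"
    and c: "0 < c" and l: "0 < l" "l < 1"
  shows "ennreal (young_const c l) *
      (qnorm lborel (1 + l * c) (\<lambda>x. ennreal (f x)) *
       qnorm lborel (1 + (1 - l) * c) (\<lambda>x. ennreal (g x))) \<le>
    qnorm lborel (1 + c) (conv (\<lambda>x. ennreal (f x)) (\<lambda>x. ennreal (g x)))"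
proof -
  define a where "a = 1 + l * c"
  define b where "b = 1 + (1 - l) * c"
  have a: "0 < a" and b: "0 < b" using l c by (auto simp: a_def b_def intro!: add_pos_pos)
  have M: "0 \<le> M" using f(2)[of 0] f(3)[of 0] by simp
  have approx: "\<exists>F :: nat \<Rightarrow> real \<Rightarrow> real. (\<forall>n. continuous_on UNIV (F n)) \<and> (\<forall>n x. 0 < F n x \<and> F n x \<le> (M + 1) * bump x) \<and>
      (AE x in lborel. (\<lambda>n. F n x) \<longlonglongrightarrow> f x)"
    if f: "f \<in> borel_measurable borel" "\<And>x. 0 \<le> f x" "\<And>x. f x \<le> M * bump x" for f :: "real \<Rightarrow> real"
  proof -
    have "f measurable_on UNIV"
      using f by (intro lebesgue_measurable_imp_measurable_on_real) (auto intro: measurable_completion)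
    then obtain N G where N: "negligible N" and G: "\<And>n. continuous_on UNIV (G n)"
        "\<And>x. x \<notin> N \<Longrightarrow> (\<lambda>n. G n x) \<longlonglongrightarrow> f x"
      unfolding measurable_on_def by auto
    define F where "F n x = max 0 (min (G n x) (M * bump x)) + 1 / real (Suc n) * bump x" for n x
    have "continuous_on UNIV (F n)" for n
      unfolding F_def by (intro continuous_intros G)
    moreover have "0 < F n x \<and> F n x \<le> (M + 1) * bump x" for n x
    proof -
      have "max 0 (min (G n x) (M * bump x)) \<le> M * bump x" using M by simp
      moreover have "1 / real (Suc n) * bump x \<le> 1 * bump x" by (intro mult_right_mono) auto
      moreover have "0 < 1 / real (Suc n) * bump x" by simp
      ultimately show ?thesis unfolding F_def distrib_right by linarith
    qed
    moreover have "AE x in lborel. x \<notin> N"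
      using AE_not_in[of N lebesgue] N by (simp add: negligible_iff_null_sets AE_completion_iff)
    then have "AE x in lborel. (\<lambda>n. F n x) \<longlonglongrightarrow> f x"
    proof eventually_elim
      case (elim x)
      have "(\<lambda>n. F n x) \<longlonglongrightarrow> max 0 (min (f x) (M * bump x)) + 0 * bump x"
        unfolding F_def by (intro tendsto_intros G elim LIMSEQ_Suc[OF lim_1_over_n])
      then show ?case using f by simp
    qed
    ultimately show ?thesis by blast
  qed
  obtain F where F: "\<And>n. continuous_on UNIV (F n)" "\<And>n x. 0 < F n x" "\<And>n x. F n x \<le> (M + 1) * bump x"
      "AE x in lborel. (\<lambda>n. F n x) \<longlonglongrightarrow> f x"
    using approx[OF f] by blast
  obtain G where G: "\<And>n. continuous_on UNIV (G n)" "\<And>n x. 0 < G n x" "\<And>n x. G n x \<le> (M + 1) * bump x"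
      "AE x in lborel. (\<lambda>n. G n x) \<longlonglongrightarrow> g x"
    using approx[OF g] by blast
  note [measurable] = f(1) g(1) borel_measurable_continuous_onI[OF F(1)] borel_measurable_continuous_onI[OF G(1)]
  let ?b = "\<lambda>x. ennreal ((M + 1) * bump x)"
  have lim: "(\<lambda>n. qnorm lborel a (\<lambda>x. ennreal (F n x))) \<longlonglongrightarrow> qnorm lborel a (\<lambda>x. ennreal (f x))"
    and fin: "qnorm lborel a (\<lambda>x. ennreal (f x)) \<noteq> \<top>"
    if "\<And>n x. 0 < F n x" "\<And>n x. F n x \<le> (M + 1) * bump x" "AE x in lborel. (\<lambda>n. F n x) \<longlonglongrightarrow> f x"
      "\<And>n. F n \<in> borel_measurable borel" "f \<in> borel_measurable borel" "0 < a" "\<And>x. 0 \<le> f x" "\<And>x. f x \<le> M * bump x"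
    for F :: "nat \<Rightarrow> real \<Rightarrow> real" and f a
  proof -
    note [measurable] = that(4,5)
    have w: "(\<integral>\<^sup>+x. ?b x powe (1 / a) \<partial>lborel) < \<infinity>"
      using bump_powr_integral_finite[of "1 / a" "M + 1"] M \<open>0 < a\<close>
      by (simp add: powe_ennreal)
    show "(\<lambda>n. qnorm lborel a (\<lambda>x. ennreal (F n x))) \<longlonglongrightarrow> qnorm lborel a (\<lambda>x. ennreal (f x))"
    proof (intro tendsto_powe \<open>0 < a\<close> nn_integral_dominated_convergence[where w = "\<lambda>x. ?b x powe (1 / a)"] w)
      show "AE x in lborel. (\<lambda>i. ennreal (F i x) powe (1 / a)) \<longlonglongrightarrow> ennreal (f x) powe (1 / a)"
        using that(3) by eventually_elim (intro tendsto_powe tendsto_ennrealI, use \<open>0 < a\<close> in auto)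
    qed (use that in \<open>auto intro!: AE_I2 powe_mono ennreal_leI\<close>)
    have "f x \<le> (M + 1) * bump x" for x
      using that(8)[of x] exp_gt_zero[of "- x\<^sup>2"] unfolding distrib_right by linarith
    then have "(\<integral>\<^sup>+x. ennreal (f x) powe (1 / a) \<partial>lborel) \<le> (\<integral>\<^sup>+x. ?b x powe (1 / a) \<partial>lborel)"
      using \<open>0 < a\<close> by (intro nn_integral_mono powe_mono ennreal_leI) auto
    with w show "qnorm lborel a (\<lambda>x. ennreal (f x)) \<noteq> \<top>"
      using \<open>0 < a\<close> by (auto simp: top_unique)
  qed
  have cb: "conv ?b ?b z = ennreal ((M + 1) * (M + 1) * (sqrt (pi / 2) * exp (- z\<^sup>2 / 2)))" for z
  proof -
    have "conv ?b ?b z = ennreal ((M + 1) * (M + 1)) * conv (\<lambda>x. ennreal (bump x)) (\<lambda>x. ennreal (bump x)) z"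
      unfolding conv_def using M
      by (subst nn_integral_cmult[symmetric]) (auto simp: ennreal_mult'[symmetric] mult_ac intro!: nn_integral_cong)
    then show ?thesis using M by (simp add: conv_bump ennreal_mult'[symmetric])
  qed
  have limc: "(\<lambda>n. conv (\<lambda>x. ennreal (F n x)) (\<lambda>x. ennreal (G n x)) z) \<longlonglongrightarrow> conv (\<lambda>x. ennreal (f x)) (\<lambda>x. ennreal (g x)) z" for z
    unfolding conv_def
  proof (rule nn_integral_dominated_convergence[where w = "\<lambda>y. ?b (z - y) * ?b y"])
    show "(\<integral>\<^sup>+y. ?b (z - y) * ?b y \<partial>lborel) < \<infinity>" using cb[of z] by (simp add: conv_def)
    show "AE y in lborel. (\<lambda>i. ennreal (F i (z - y)) * ennreal (G i y)) \<longlonglongrightarrow> ennreal (f (z - y)) * ennreal (g y)"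
      using AE_lborel_reflect[OF F(4), of z] G(4)
      by eventually_elim (intro tendsto_mult_ennreal tendsto_ennrealI, auto)
    show "AE y in lborel. ennreal (F j (z - y)) * ennreal (G j y) \<le> ?b (z - y) * ?b y" for j
      by (intro AE_I2 mult_mono ennreal_leI F G) auto
  qed auto
  have limR: "(\<lambda>n. qnorm lborel (1 + c) (conv (\<lambda>x. ennreal (F n x)) (\<lambda>x. ennreal (G n x)))) \<longlonglongrightarrow>
      qnorm lborel (1 + c) (conv (\<lambda>x. ennreal (f x)) (\<lambda>x. ennreal (g x)))"
  proof (intro tendsto_powe nn_integral_dominated_convergence[where w = "\<lambda>z. conv ?b ?b z powe (1 / (1 + c))"])
    have "conv ?b ?b z powe (1 / (1 + c)) = ennreal (((M + 1) * (M + 1) * sqrt (pi / 2)) powr (1 / (1 + c))) *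
        ennreal (exp (- z\<^sup>2 / (2 * (1 + c))))" for z
      unfolding cb using M c
      by (simp add: powe_ennreal powr_mult exp_powr_real ennreal_mult'[symmetric] mult_ac)
    then have "(\<integral>\<^sup>+z. conv ?b ?b z powe (1 / (1 + c)) \<partial>lborel) =
       ennreal (((M + 1) * (M + 1) * sqrt (pi / 2)) powr (1 / (1 + c))) * ennreal (sqrt (2 * pi * (1 + c)))"
      using nn_integral_gaussian[of "1 + c"] c by (simp add: nn_integral_cmult)
    then show "(\<integral>\<^sup>+z. conv ?b ?b z powe (1 / (1 + c)) \<partial>lborel) < \<infinity>"
      by (simp add: ennreal_mult_less_top)
    show "AE z in lborel. (\<lambda>i. conv (\<lambda>x. ennreal (F i x)) (\<lambda>x. ennreal (G i x)) z powe (1 / (1 + c))) \<longlonglongrightarrow>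
      conv (\<lambda>x. ennreal (f x)) (\<lambda>x. ennreal (g x)) z powe (1 / (1 + c))"
      using c by (intro AE_I2 tendsto_powe limc) auto
    show "AE z in lborel. conv (\<lambda>x. ennreal (F j x)) (\<lambda>x. ennreal (G j x)) z powe (1 / (1 + c)) \<le> conv ?b ?b z powe (1 / (1 + c))" for j
      using c by (intro AE_I2 powe_mono conv_mono ennreal_leI F G) auto
  qed (use c in auto)
  have "ennreal (young_const c l) *
      (qnorm lborel a (\<lambda>x. ennreal (f x)) *
       qnorm lborel b (\<lambda>x. ennreal (g x))) \<le>
    qnorm lborel (1 + c) (conv (\<lambda>x. ennreal (f x)) (\<lambda>x. ennreal (g x)))"
  proof (rule LIMSEQ_le[OF _ limR])
    have f1: "qnorm lborel a (\<lambda>x. ennreal (f x)) \<noteq> \<top>"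
      by (rule fin[of F]) (use F f a in auto)
    have g1: "qnorm lborel b (\<lambda>x. ennreal (g x)) \<noteq> \<top>"
      by (rule fin[of G]) (use G g b in auto)
    have f2: "(\<lambda>n. qnorm lborel a (\<lambda>x. ennreal (F n x))) \<longlonglongrightarrow> qnorm lborel a (\<lambda>x. ennreal (f x))"
      by (rule lim) (use F f a in auto)
    have g2: "(\<lambda>n. qnorm lborel b (\<lambda>x. ennreal (G n x))) \<longlonglongrightarrow> qnorm lborel b (\<lambda>x. ennreal (g x))"
      by (rule lim) (use G g b in auto)
    show "(\<lambda>n. ennreal (young_const c l) * (qnorm lborel a (\<lambda>x. ennreal (F n x)) *
       qnorm lborel b (\<lambda>x. ennreal (G n x)))) \<longlonglongrightarrow>
      ennreal (young_const c l) * (qnorm lborel a (\<lambda>x. ennreal (f x)) *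
       qnorm lborel b (\<lambda>x. ennreal (g x)))"
      using f1 g1 by (intro tendsto_mult_ennreal f2 g2 tendsto_const) (auto simp: ennreal_mult_eq_top_iff)
    show "\<exists>N. \<forall>n\<ge>N. ennreal (young_const c l) * (qnorm lborel a (\<lambda>x. ennreal (F n x)) *
       qnorm lborel b (\<lambda>x. ennreal (G n x))) \<le>
       qnorm lborel (1 + c) (conv (\<lambda>x. ennreal (F n x)) (\<lambda>x. ennreal (G n x)))"
      unfolding a_def b_def by (intro exI allI impI reverse_Young_positive[where M = "M + 1"] F G c l)
  qed
  then show ?thesis unfolding a_def b_def .
qed

lemma SUP_inf_bump: "(SUP n::nat. inf x (ennreal (real n * bump t))) = (x :: ennreal)"
proof -
  have "(SUP n::nat. inf x (ennreal (real n * bump t))) = inf x (SUP n::nat. ennreal (real n * bump t))"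
    by (rule inf_SUP[symmetric])
  also have "(SUP n::nat. ennreal (real n * bump t)) = (SUP n::nat. of_nat n * ennreal (bump t))"
    by (simp add: ennreal_mult' ennreal_of_nat_eq_real_of_nat)
  also have "\<dots> = \<top>"
    by (subst SUP_mult_right_ennreal[symmetric], subst ennreal_SUP_of_nat_eq_top) (simp add: ennreal_top_mult)
  finally show ?thesis by simp
qed

text \<open>Monotone convergence along the truncations of \<open>f\<close> and \<open>g\<close> at multiples of \<open>bump\<close>. The two
  truncation levels are independent, which lets one supremum be taken after the other.\<close>

theorem reverse_Young_line:
  fixes f g :: "real \<Rightarrow> ennreal"
  assumes [measurable]: "f \<in> borel_measurable borel" "g \<in> borel_measurable borel"
    and c: "0 < c" and l: "0 < l" "l < 1"
  shows "ennreal (young_const c l) *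
      (qnorm lborel (1 + l * c) f *
       qnorm lborel (1 + (1 - l) * c) g) \<le>
    qnorm lborel (1 + c) (conv f g)"
proof -
  define a where "a = 1 + l * c"
  define b where "b = 1 + (1 - l) * c"
  have a: "0 < a" and b: "0 < b" using l c by (auto simp: a_def b_def intro!: add_pos_pos)
  define R where "R = qnorm lborel (1 + c) (conv f g)"
  define tr :: "(real \<Rightarrow> ennreal) \<Rightarrow> nat \<Rightarrow> real \<Rightarrow> ennreal" where "tr f n x = inf (f x) (ennreal (real n * bump x))" for f n x
  have [measurable]: "tr f n \<in> borel_measurable borel" if [measurable]: "f \<in> borel_measurable borel" for f n
    unfolding tr_def by measurable
  have tr_real: "tr f n x = ennreal (enn2real (tr f n x))" "enn2real (tr f n x) \<le> real n * bump x" for f n x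
  proof -
    have le: "tr f n x \<le> ennreal (real n * bump x)" unfolding tr_def by simp
    then have "tr f n x < \<top>" using ennreal_less_top le_less_trans by blast
    then show "tr f n x = ennreal (enn2real (tr f n x))" by simp
    show "enn2real (tr f n x) \<le> real n * bump x"
      using enn2real_mono[OF le] by simp
  qed
  define A where "A f e n = qnorm lborel e (tr f n)" for f e n
  have SUP_A: "(SUP n. A f e n) = qnorm lborel e f"
    if [measurable]: "f \<in> borel_measurable borel" and e: "0 < e" for f e
  proof -
    have "(SUP n. A f e n) = (SUP n. \<integral>\<^sup>+x. tr f n x powe (1 / e) \<partial>lborel) powe e"
      unfolding A_def by (rule powe_SUP[OF e, symmetric])
    also have "(SUP n. \<integral>\<^sup>+x. tr f n x powe (1 / e) \<partial>lborel) = (\<integral>\<^sup>+x. (SUP n. tr f n x powe (1 / e)) \<partial>lborel)"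
    proof (rule nn_integral_monotone_convergence_SUP[symmetric])
      show "incseq (\<lambda>n x. tr f n x powe (1 / e))"
        unfolding tr_def using e
        by (intro incseq_SucI le_funI powe_mono inf_mono order_refl ennreal_leI mult_right_mono) auto
    qed auto
    also have "(\<lambda>x. SUP n. tr f n x powe (1 / e)) = (\<lambda>x. f x powe (1 / e))"
      using e by (auto simp: powe_SUP[symmetric] tr_def SUP_inf_bump)
    finally show ?thesis .
  qed
  have step: "ennreal (young_const c l) * (A f a m * A g b n) \<le> R" for m n
  proof -
    define k where "k = max m n"
    let ?f = "\<lambda>x. enn2real (tr f m x)" and ?g = "\<lambda>x. enn2real (tr g n x)"
    have "real m * bump x \<le> real k * bump x" "real n * bump x \<le> real k * bump x" for x
      by (intro mult_right_mono; simp add: k_def)+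
    then have "ennreal (young_const c l) *
      (qnorm lborel (1 + l * c) (\<lambda>x. ennreal (?f x)) *
       qnorm lborel (1 + (1 - l) * c) (\<lambda>x. ennreal (?g x))) \<le>
      qnorm lborel (1 + c) (conv (\<lambda>x. ennreal (?f x)) (\<lambda>x. ennreal (?g x)))"
      by (intro reverse_Young_dominated[where M = "real k"] c l)
         (auto intro: order_trans[OF tr_real(2)])
    also have "\<dots> \<le> R"
      unfolding R_def tr_real(1)[symmetric] using c
      by (intro powe_mono nn_integral_mono conv_mono) (auto simp: tr_def)
    finally show ?thesis unfolding A_def a_def b_def tr_real(1)[symmetric] .
  qed
  have "ennreal (young_const c l) * ((SUP m. A f a m) * (SUP n. A g b n)) \<le> R"
    unfolding SUP_mult_left_ennreal SUP_mult_right_ennreal by (intro SUP_least step)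
  then show ?thesis
    unfolding SUP_A[OF assms(1) a] SUP_A[OF assms(2) b] unfolding a_def b_def R_def .
qed

section \<open>The reverse Young inequality in all dimensions\<close>

text \<open>Convolution on the product space over a finite index set. The difference is restricted to \<open>I\<close>
  because the points of the product space are undefined outside of \<open>I\<close>.\<close>

definition coord_conv :: "'i set \<Rightarrow> (('i \<Rightarrow> real) \<Rightarrow> ennreal) \<Rightarrow> (('i \<Rightarrow> real) \<Rightarrow> ennreal) \<Rightarrow> ('i \<Rightarrow> real) \<Rightarrow> ennreal" where
  "coord_conv I f g z = (\<integral>\<^sup>+y. f (\<lambda>i\<in>I. z i - y i) * g y \<partial>(\<Pi>\<^sub>M i\<in>I. lborel))"

lemma sigma_finite_PiM_lborel: "finite I \<Longrightarrow> sigma_finite_measure (\<Pi>\<^sub>M i\<in>I. lborel :: real measure)"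
  by (intro product_sigma_finite.sigma_finite product_sigma_finite.intro sigma_finite_lborel)

text \<open>Induction on the number of coordinates. For a fixed last coordinate \<open>t\<close> of the convolution,
  the reverse Minkowski inequality moves the integral over the last coordinate \<open>s\<close> out of the \<open>r\<close>-norm;
  the induction hypothesis turns the integrand into \<open>u (t - s) * v s\<close>, where \<open>u\<close> and \<open>v\<close> are the norms of the
  slices of \<open>f\<close> and \<open>g\<close>; and the one-dimensional inequality applies to the convolution of \<open>u\<close> and \<open>v\<close>.\<close>

theorem reverse_Young_coordinates:
  fixes f g :: "('i \<Rightarrow> real) \<Rightarrow> ennreal"
  assumes I: "finite I" and c: "0 < c" and l: "0 < l" "l < 1"
  shows "f \<in> borel_measurable (\<Pi>\<^sub>M i\<in>I. lborel) \<Longrightarrow> g \<in> borel_measurable (\<Pi>\<^sub>M i\<in>I. lborel) \<Longrightarrow>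
    ennreal (young_const c l) ^ card I *
      (qnorm (\<Pi>\<^sub>M i\<in>I. lborel) (1 + l * c) f *
       qnorm (\<Pi>\<^sub>M i\<in>I. lborel) (1 + (1 - l) * c) g) \<le>
    qnorm (\<Pi>\<^sub>M i\<in>I. lborel) (1 + c) (coord_conv I f g)"
  using I
proof (induction I arbitrary: f g rule: finite_induct)
  case empty
  interpret product_sigma_finite "\<lambda>_::'i. lborel :: real measure" by standard
  have "0 < 1 + l * c" "0 < 1 + (1 - l) * c" using l c by (auto intro!: add_pos_pos)
  then show ?case using c
    by (simp add: PiM_empty nn_integral_count_space_finite max.absorb2 coord_conv_def powe_powe restrict_def)
next
  case (insert i I)
  interpret product_sigma_finite "\<lambda>_::'i. lborel :: real measure" by standard
  let ?P = "\<Pi>\<^sub>M i\<in>I. lborel :: real measure"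
  let ?PI = "\<Pi>\<^sub>M i\<in>insert i I. lborel :: real measure"
  define a where "a = 1 + l * c"
  define b where "b = 1 + (1 - l) * c"
  define r where "r = 1 / (1 + c)"
  have a: "0 < a" and b: "0 < b" using l c by (auto simp: a_def b_def intro!: add_pos_pos)
  have r: "0 < r" "r < 1" "1 / r = 1 + c" using c by (auto simp: r_def field_simps)
  note [measurable] = insert.prems
  have upd [measurable]: "(\<lambda>x. (F x)(i := h x)) \<in> N \<rightarrow>\<^sub>M ?PI"
    if "F \<in> N \<rightarrow>\<^sub>M ?P" "h \<in> N \<rightarrow>\<^sub>M lborel" for F h and N :: "'n measure"
    using that by (intro measurable_fun_upd[where J = I]) auto
  interpret P: sigma_finite_measure ?P by (rule sigma_finite_PiM_lborel[OF insert.hyps(1)])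
  define fs where "fs s y = f (y(i := s))" for s y
  define gs where "gs s y = g (y(i := s))" for s y
  have [measurable]: "fs s \<in> borel_measurable ?P" "gs s \<in> borel_measurable ?P" for s
    unfolding fs_def gs_def by measurable
  define u where "u s = qnorm ?P a (fs s)" for s
  define v where "v s = qnorm ?P b (gs s)" for s
  have [measurable]: "u \<in> borel_measurable borel" "v \<in> borel_measurable borel"
    unfolding u_def v_def fs_def gs_def by measurable
  have diff [measurable]: "(\<lambda>x. \<lambda>j\<in>I. F x j - G x j) \<in> N \<rightarrow>\<^sub>M ?P"
    if "F \<in> N \<rightarrow>\<^sub>M ?P" "G \<in> N \<rightarrow>\<^sub>M ?P" for F G and N :: "'n measure"
  proof (rule measurable_restrict)
    fix j assume "j \<in> I"
    with that show "(\<lambda>x. F x j - G x j) \<in> N \<rightarrow>\<^sub>M lborel"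
      using measurable_compose[OF that(1) measurable_component_singleton[OF \<open>j \<in> I\<close>]]
        measurable_compose[OF that(2) measurable_component_singleton[OF \<open>j \<in> I\<close>]] by simp
  qed
  have split: "coord_conv (insert i I) f g (z(i := t)) = (\<integral>\<^sup>+s. coord_conv I (fs (t - s)) (gs s) z \<partial>lborel)"
    if "z \<in> space ?P" for z t
  proof -
    have e: "(\<lambda>j\<in>insert i I. (z(i := t)) j - (y(i := s)) j) = (\<lambda>j\<in>I. z j - y j)(i := t - s)" for y s
      using insert.hyps(2) by (auto simp: fun_eq_iff)
    have m: "(\<lambda>y. f (\<lambda>j\<in>insert i I. (z(i := t)) j - y j) * g y) \<in> borel_measurable ?PI"
    proof -
      have "(\<lambda>y. \<lambda>j\<in>insert i I. (z(i := t)) j - y j) \<in> ?PI \<rightarrow>\<^sub>M ?PI"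
        by (rule measurable_restrict) auto
      then show ?thesis by measurable
    qed
    show ?thesis
      unfolding coord_conv_def
      by (subst product_nn_integral_insert_rev[OF insert.hyps m]) (simp only: e fs_def gs_def)
  qed
  have [measurable]: "(\<lambda>(s, z). coord_conv I (fs (t - s)) (gs s) z) \<in> borel_measurable (lborel \<Otimes>\<^sub>M ?P)" for t
    unfolding coord_conv_def fs_def gs_def by measurable
  have slice: "(ennreal (young_const c l) ^ card I * conv u v t) powe r \<le>
      (\<integral>\<^sup>+z. coord_conv (insert i I) f g (z(i := t)) powe r \<partial>?P)" for t
  proof -
    have "ennreal (young_const c l) ^ card I * conv u v t =
        (\<integral>\<^sup>+s. ennreal (young_const c l) ^ card I * (u (t - s) * v s) \<partial>lborel)"
      unfolding conv_def by (rule nn_integral_cmult[symmetric]) measurable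
    also have "\<dots> \<le> (\<integral>\<^sup>+s. (\<integral>\<^sup>+z. coord_conv I (fs (t - s)) (gs s) z powe r \<partial>?P) powe (1 / r) \<partial>lborel)"
      unfolding u_def v_def a_def b_def r(3) unfolding r_def by (intro nn_integral_mono insert.IH) measurable
    also have "\<dots> \<le> (\<integral>\<^sup>+z. (\<integral>\<^sup>+s. coord_conv I (fs (t - s)) (gs s) z \<partial>lborel) powe r \<partial>?P) powe (1 / r)"
      by (rule reverse_Minkowski) (use r in \<open>auto intro: sigma_finite_lborel P.sigma_finite_measure_axioms\<close>)
    also have "(\<integral>\<^sup>+z. (\<integral>\<^sup>+s. coord_conv I (fs (t - s)) (gs s) z \<partial>lborel) powe r \<partial>?P) =
        (\<integral>\<^sup>+z. coord_conv (insert i I) f g (z(i := t)) powe r \<partial>?P)"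
      by (intro nn_integral_cong) (simp add: split)
    finally show ?thesis using powe_mono[OF r(1)] r(1) by (fastforce simp: powe_powe)
  qed
  have mc: "coord_conv (insert i I) f g \<in> borel_measurable ?PI"
  proof -
    interpret PI: sigma_finite_measure ?PI by (rule sigma_finite_PiM_lborel) (use insert.hyps in simp)
    have "(\<lambda>x. \<lambda>j\<in>insert i I. fst x j - snd x j) \<in> ?PI \<Otimes>\<^sub>M ?PI \<rightarrow>\<^sub>M ?PI"
      by (rule measurable_restrict) auto
    then have "(\<lambda>(z, y). f (\<lambda>j\<in>insert i I. z j - y j) * g y) \<in> borel_measurable (?PI \<Otimes>\<^sub>M ?PI)"
      by (simp add: split_beta') measurable
    from PI.borel_measurable_nn_integral[OF this] show ?thesis by (simp add: coord_conv_def[abs_def])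
  qed
  have fubf: "(\<integral>\<^sup>+s. u s powe (1 / a) \<partial>lborel) = (\<integral>\<^sup>+x. f x powe (1 / a) \<partial>?PI)"
    using a by (subst product_nn_integral_insert_rev[OF insert.hyps]) (auto simp: u_def fs_def powe_powe)
  have fubg: "(\<integral>\<^sup>+s. v s powe (1 / b) \<partial>lborel) = (\<integral>\<^sup>+x. g x powe (1 / b) \<partial>?PI)"
    using b by (subst product_nn_integral_insert_rev[OF insert.hyps]) (auto simp: v_def gs_def powe_powe)
  have "ennreal (young_const c l) ^ card (insert i I) *
      (qnorm ?PI a f * qnorm ?PI b g)
    = ennreal (young_const c l) ^ card I * (ennreal (young_const c l) *
      (qnorm lborel a u * qnorm lborel b v))"
    using insert.hyps by (simp add: fubf fubg mult_ac)
  also have "\<dots> \<le> ennreal (young_const c l) ^ card I * (\<integral>\<^sup>+t. conv u v t powe r \<partial>lborel) powe (1 + c)"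
    unfolding a_def b_def r_def by (intro mult_left_mono reverse_Young_line c l) auto
  also have "\<dots> = ((\<integral>\<^sup>+t. (ennreal (young_const c l) ^ card I * conv u v t) powe r \<partial>lborel)) powe (1 / r)"
    unfolding r(3)[symmetric] using r(1,2) by (simp add: powe_mult nn_integral_cmult powe_powe)
  also have "\<dots> \<le> (\<integral>\<^sup>+t. \<integral>\<^sup>+z. coord_conv (insert i I) f g (z(i := t)) powe r \<partial>?P \<partial>lborel) powe (1 / r)"
    using r(1) by (intro powe_mono nn_integral_mono slice) auto
  also have "(\<integral>\<^sup>+t. \<integral>\<^sup>+z. coord_conv (insert i I) f g (z(i := t)) powe r \<partial>?P \<partial>lborel) =
      (\<integral>\<^sup>+z. coord_conv (insert i I) f g z powe r \<partial>?PI)"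
    using mc by (subst product_nn_integral_insert_rev[OF insert.hyps]) auto
  finally show ?case unfolding a_def b_def r(3) unfolding r_def .
qed

lemma nn_integral_lborel_coordinates:
  fixes f :: "'a::euclidean_space \<Rightarrow> ennreal"
  assumes "f \<in> borel_measurable borel"
  shows "(\<integral>\<^sup>+x. f x \<partial>lborel) = (\<integral>\<^sup>+w. f (\<Sum>b\<in>Basis. w b *\<^sub>R b) \<partial>(\<Pi>\<^sub>M b\<in>Basis. lborel))"
  using assms by (subst lborel_eq) (auto simp: nn_integral_distr)

theorem reverse_Young:
  fixes f g :: "'a::euclidean_space \<Rightarrow> ennreal"
  assumes [measurable]: "f \<in> borel_measurable borel" "g \<in> borel_measurable borel"
    and c: "0 < c" and l: "0 < l" "l < 1"
  shows "ennreal (young_const c l) ^ DIM('a) *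
      (qnorm lborel (1 + l * c) f *
       qnorm lborel (1 + (1 - l) * c) g) \<le>
    qnorm lborel (1 + c) (conv f g)"
proof -
  define S :: "('a \<Rightarrow> real) \<Rightarrow> 'a" where "S w = (\<Sum>b\<in>Basis. w b *\<^sub>R b)" for w
  have [measurable]: "S \<in> (\<Pi>\<^sub>M b\<in>Basis. lborel) \<rightarrow>\<^sub>M borel" unfolding S_def by measurable
  have "conv f g (S z) = coord_conv Basis (f \<circ> S) (g \<circ> S) z" for z
  proof -
    have "S (\<lambda>i\<in>Basis. z i - y i) = S z - S y" for y
      by (simp add: S_def scaleR_diff_left sum_subtractf)
    then show ?thesis
      unfolding conv_def coord_conv_def by (subst nn_integral_lborel_coordinates) (auto simp: S_def[symmetric])
  qed
  then show ?thesis
    using reverse_Young_coordinates[OF finite_Basis c l, of "f \<circ> S" "g \<circ> S"]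
    by (subst (1 2 3) nn_integral_lborel_coordinates) (auto simp: S_def[symmetric] o_def)
qed

text \<open>For \<open>r < 1\<close> averaging over translates increases the integral of the \<open>r\<close>-th power; this is
  the reverse Minkowski inequality with the weight \<open>g\<close>.\<close>

lemma nn_integral_conv_powe_ge:
  fixes f g :: "'a::euclidean_space \<Rightarrow> ennreal"
  assumes [measurable]: "f \<in> borel_measurable borel" "g \<in> borel_measurable borel"
    and r: "0 < r" "r < 1" and g: "(\<integral>\<^sup>+x. g x \<partial>lborel) = 1"
  shows "(\<integral>\<^sup>+x. f x powe r \<partial>lborel) \<le> (\<integral>\<^sup>+x. conv f g x powe r \<partial>lborel)"
proof -
  have tr: "(\<integral>\<^sup>+z. F (z - y) \<partial>lborel) = (\<integral>\<^sup>+z. F z \<partial>lborel)" if [measurable]: "F \<in> borel_measurable borel" for F :: "'a \<Rightarrow> ennreal" and y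
  proof -
    have "(\<integral>\<^sup>+z. F z \<partial>lborel) = (\<integral>\<^sup>+z. F z \<partial>distr lborel borel ((+) (- y)))" by (simp add: lborel_distr_plus)
    also have "\<dots> = (\<integral>\<^sup>+z. F (z - y) \<partial>lborel)" by (subst nn_integral_distr) auto
    finally show ?thesis by simp
  qed
  have "(\<integral>\<^sup>+x. f x powe r \<partial>lborel) powe (1 / r) = (\<integral>\<^sup>+y. (\<integral>\<^sup>+x. f x powe r \<partial>lborel) powe (1 / r) * g y \<partial>lborel)"
    by (simp add: nn_integral_cmult g)
  also have "\<dots> = (\<integral>\<^sup>+y. (\<integral>\<^sup>+z. (f (z - y) * g y) powe r \<partial>lborel) powe (1 / r) \<partial>lborel)"
    using r tr[of "\<lambda>x. f x powe r"] by (simp add: powe_mult nn_integral_multc powe_powe)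
  also have "\<dots> \<le> (\<integral>\<^sup>+z. (\<integral>\<^sup>+y. f (z - y) * g y \<partial>lborel) powe r \<partial>lborel) powe (1 / r)"
    by (rule reverse_Minkowski) (use r in \<open>auto intro: sigma_finite_lborel\<close>)
  finally show ?thesis unfolding conv_def by (rule powe_le_cancel[rotated]) (use r in simp)
qed

section \<open>The Prekopa--Leindler inequality\<close>

text \<open>Lets suprema and infima of sets be exhausted by sequences inside the sets, whether or not they
  are attained or finite.\<close>

lemma cofinal_sequence:
  fixes A :: "real set"
  assumes "A \<noteq> {}"
  obtains a where "incseq a" "\<And>n. a n \<in> A" "\<And>x. x \<in> A \<Longrightarrow> \<exists>n::nat. x \<le> a n"
proof -
  have "\<exists>a. (\<forall>n. a n \<in> A) \<and> (\<forall>x\<in>A. \<exists>n::nat. x \<le> a n)"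
  proof (cases "bdd_above A")
    case False
    then have "\<forall>n::nat. \<exists>x\<in>A. real n < x" unfolding bdd_above_def by (meson not_le)
    then obtain a where a: "\<And>n. a n \<in> A" "\<And>n::nat. real n < a n" by metis
    show ?thesis
      by (rule exI[of _ a]) (use a real_arch_simple less_imp_le order_trans in metis)
  next
    case True
    show ?thesis
    proof (cases "Sup A \<in> A")
      case True
      then show ?thesis using \<open>bdd_above A\<close> by (intro exI[of _ "\<lambda>_. Sup A"]) (auto intro: cSup_upper)
    next
      case False
      have "\<exists>x\<in>A. Sup A - 1 / real (Suc n) < x" for n
        unfolding less_cSup_iff[OF assms True, symmetric] by simp
      then obtain a where a: "\<And>n. a n \<in> A" "\<And>n. Sup A - 1 / real (Suc n) < a n" by metis
      have "\<exists>n. x \<le> a n" if "x \<in> A" for x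
      proof -
        have "x < Sup A" using False that cSup_upper[OF that True] by (metis order_le_less)
        then obtain n where "1 / real (Suc n) < Sup A - x"
          using nat_approx_posE[of "Sup A - x"] by auto
        with a(2)[of n] show ?thesis by (intro exI[of _ n]) linarith
      qed
      with a show ?thesis by blast
    qed
  qed
  then obtain a where a: "\<And>n. a n \<in> A" "\<And>x. x \<in> A \<Longrightarrow> \<exists>n::nat. x \<le> a n" by blast
  define b where "b n = Max (a ` {..n})" for n
  have "b n \<in> A" for n
  proof -
    have "b n \<in> a ` {..n}" unfolding b_def by (rule Max_in) auto
    then show ?thesis using a by auto
  qed
  moreover have "incseq b" unfolding b_def incseq_def by (intro allI impI Max_mono) auto
  moreover have "\<exists>n. x \<le> b n" if "x \<in> A" for x
  proof -
    from a(2)[OF that] obtain n where "x \<le> a n" by blast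
    also have "a n \<le> b n" unfolding b_def by (intro Max_ge) auto
    finally show ?thesis by blast
  qed
  ultimately show thesis using that[of b] by simp
qed

lemma emeasure_affine_image_le:
  fixes A C :: "real set"
  assumes "A \<in> sets borel" "C \<in> sets borel" "0 < k" "\<And>x. x \<in> A \<Longrightarrow> t + k * x \<in> C"
  shows "ennreal k * emeasure lborel A \<le> emeasure lborel C"
proof -
  note [measurable] = assms(1,2)
  have "emeasure lborel C = (\<integral>\<^sup>+x. indicator C x \<partial>lborel)" by simp
  also have "\<dots> = ennreal k * (\<integral>\<^sup>+x. indicator C (t + k * x) \<partial>lborel)"
    using assms(3) by (subst nn_integral_real_affine[where c = k and t = t]) auto
  also have "\<dots> \<ge> ennreal k * (\<integral>\<^sup>+x. indicator A x \<partial>lborel)"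
    by (intro mult_left_mono nn_integral_mono) (auto split: split_indicator intro: assms(4))
  finally show ?thesis by simp
qed

text \<open>For \<open>a \<in> A\<close> and \<open>b \<in> B\<close> the scaled translates \<open>(1 - l) * A + l * b\<close> of the part of \<open>A\<close> left of \<open>a\<close>
  and \<open>(1 - l) * a + l * B\<close> of the part of \<open>B\<close> right of \<open>b\<close> lie in \<open>C\<close> on different sides of
  \<open>(1 - l) * a + l * b\<close>. Now let \<open>a\<close> increase through \<open>A\<close> and \<open>b\<close> decrease through \<open>B\<close>.\<close>

lemma Brunn_Minkowski_line:
  fixes A B C :: "real set"
  assumes [measurable]: "A \<in> sets borel" "B \<in> sets borel" "C \<in> sets borel"
    and ne: "A \<noteq> {}" "B \<noteq> {}" and l: "0 < l" "l < 1"
    and C: "\<And>a b. a \<in> A \<Longrightarrow> b \<in> B \<Longrightarrow> (1 - l) * a + l * b \<in> C"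
  shows "ennreal (1 - l) * emeasure lborel A + ennreal l * emeasure lborel B \<le> emeasure lborel C"
proof -
  have cut: "ennreal (1 - l) * emeasure lborel (A \<inter> {..a}) + ennreal l * emeasure lborel (B \<inter> {b..}) \<le> emeasure lborel C"
    if "a \<in> A" "b \<in> B" for a b
  proof -
    define m where "m = (1 - l) * a + l * b"
    have "ennreal (1 - l) * emeasure lborel (A \<inter> {..a}) \<le> emeasure lborel (C \<inter> {..m})"
    proof (rule emeasure_affine_image_le[where t = "l * b"])
      fix x assume "x \<in> A \<inter> {..a}"
      then show "l * b + (1 - l) * x \<in> C \<inter> {..m}"
        using C[of x b] that l by (simp add: m_def add.commute mult_left_mono)
    qed (use l in auto)
    moreover have "ennreal l * emeasure lborel (B \<inter> {b..}) \<le> emeasure lborel (C \<inter> {m..})"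
    proof (rule emeasure_affine_image_le[where t = "(1 - l) * a"])
      fix x assume "x \<in> B \<inter> {b..}"
      then show "(1 - l) * a + l * x \<in> C \<inter> {m..}"
        using C[of a x] that l by (simp add: m_def mult_left_mono)
    qed (use l in auto)
    moreover have "emeasure lborel (C \<inter> {m..}) = emeasure lborel (C \<inter> {m<..})"
      by (rule emeasure_eq_AE) (use AE_lborel_singleton[of m] in \<open>auto elim!: eventually_mono\<close>)
    moreover have "emeasure lborel (C \<inter> {..m}) + emeasure lborel (C \<inter> {m<..}) = emeasure lborel C"
      by (subst plus_emeasure) (auto intro!: arg_cong[where f = "emeasure lborel"])
    ultimately show ?thesis by (metis add_mono)
  qed
  obtain a where a: "incseq a" "\<And>n. a n \<in> A" "\<And>x. x \<in> A \<Longrightarrow> \<exists>n::nat. x \<le> a n"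
    using cofinal_sequence[OF ne(1)] by blast
  obtain b' where b': "incseq b'" "\<And>n. b' n \<in> uminus ` B" "\<And>x. x \<in> uminus ` B \<Longrightarrow> \<exists>n::nat. x \<le> b' n"
    using cofinal_sequence[of "uminus ` B"] ne(2) by blast
  define b where "b n = - b' n" for n
  have b: "decseq b" "\<And>n. b n \<in> B" "\<And>x. x \<in> B \<Longrightarrow> \<exists>n. b n \<le> x"
  proof -
    show "decseq b" using b'(1) by (auto simp: b_def incseq_def decseq_def)
    show "b n \<in> B" for n using b'(2)[of n] by (auto simp: b_def)
    show "\<exists>n. b n \<le> x" if "x \<in> B" for x
      using b'(3)[of "- x"] that by (auto simp: b_def intro!: imageI) (metis minus_le_iff)
  qed
  have iA: "incseq (\<lambda>n. A \<inter> {..a n})" using a(1) by (fastforce simp: incseq_def intro: order_trans)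
  have iB: "incseq (\<lambda>n. B \<inter> {b n..})" using b(1) by (fastforce simp: incseq_def decseq_def intro: order_trans)
  have "emeasure lborel A = emeasure lborel (\<Union>n. A \<inter> {..a n})"
    using a(3) by (intro arg_cong[where f = "emeasure lborel"]) auto
  also have "\<dots> = (SUP n. emeasure lborel (A \<inter> {..a n}))"
    using iA by (intro SUP_emeasure_incseq[symmetric]) auto
  finally have A: "emeasure lborel A = (SUP n. emeasure lborel (A \<inter> {..a n}))" .
  have "emeasure lborel B = emeasure lborel (\<Union>n. B \<inter> {b n..})"
    using b(3) by (intro arg_cong[where f = "emeasure lborel"]) auto
  also have "\<dots> = (SUP n. emeasure lborel (B \<inter> {b n..}))"
    using iB by (intro SUP_emeasure_incseq[symmetric]) auto
  finally have B: "emeasure lborel B = (SUP n. emeasure lborel (B \<inter> {b n..}))" .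
  have "ennreal (1 - l) * emeasure lborel A + ennreal l * emeasure lborel B =
      (SUP n. ennreal (1 - l) * emeasure lborel (A \<inter> {..a n}) + ennreal l * emeasure lborel (B \<inter> {b n..}))"
    unfolding A B SUP_mult_left_ennreal
    by (rule ennreal_SUP_add[symmetric]) (use iA iB in \<open>simp_all add: incseq_def mult_left_mono emeasure_mono\<close>)
  also have "\<dots> \<le> emeasure lborel C" by (intro SUP_least cut a b)
  finally show ?thesis .
qed

text \<open>The scale \<open>a\<close> allows level sets of several functions to be compared at the same relative
  height.\<close>

lemma layer_cake:
  fixes \<phi> :: "real \<Rightarrow> ennreal"
  assumes [measurable]: "\<phi> \<in> borel_measurable borel" and a: "0 < a"
  shows "(\<integral>\<^sup>+x. \<phi> x \<partial>lborel) = ennreal a *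
    (\<integral>\<^sup>+t. indicator {0<..} t * emeasure lborel {x. ennreal (a * t) \<le> \<phi> x} \<partial>lborel)"
proof -
  have pt: "ennreal a * (\<integral>\<^sup>+t. indicator {t. 0 < t \<and> ennreal (a * t) \<le> y} t \<partial>lborel) = y" for y
  proof (cases "y = \<top>")
    case True
    have "(\<integral>\<^sup>+t. indicator {t. 0 < t \<and> ennreal (a * t) \<le> y} t \<partial>lborel) = emeasure lborel {0::real<..}"
      by (simp add: True greaterThan_def)
    moreover have "emeasure lborel {0::real<..} = \<top>"
    proof -
      have "of_nat n \<le> emeasure lborel {0::real<..}" for n
      proof -
        have "of_nat n = emeasure lborel {0<..real n}" by (simp add: ennreal_of_nat_eq_real_of_nat)
        also have "\<dots> \<le> emeasure lborel {0::real<..}" by (intro emeasure_mono) auto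
        finally show ?thesis .
      qed
      then have "(SUP n. of_nat n) \<le> emeasure lborel {0::real<..}" by (intro SUP_least)
      then show ?thesis by (simp add: ennreal_SUP_of_nat_eq_top top_unique)
    qed
    ultimately show ?thesis using a True by (simp add: ennreal_mult_top)
  next
    case False
    then obtain z where z: "0 \<le> z" "y = ennreal z" by (cases y) auto
    have "{t. 0 < t \<and> ennreal (a * t) \<le> y} = {0<..z / a}"
      using z a by (auto simp: field_simps)
    then show ?thesis using z a by (simp add: ennreal_mult[symmetric])
  qed
  have "(\<integral>\<^sup>+x. \<phi> x \<partial>lborel) = (\<integral>\<^sup>+x. ennreal a * (\<integral>\<^sup>+t. indicator {t. 0 < t \<and> ennreal (a * t) \<le> \<phi> x} t \<partial>lborel) \<partial>lborel)"
    by (simp only: pt)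
  also have "\<dots> = ennreal a * (\<integral>\<^sup>+x. \<integral>\<^sup>+t. indicator {0<..} t * indicator {x. ennreal (a * t) \<le> \<phi> x} x \<partial>lborel \<partial>lborel)"
  proof -
    have e: "indicator {t. 0 < t \<and> ennreal (a * t) \<le> \<phi> x} t =
        (indicator {0<..} t * indicator {x. ennreal (a * t) \<le> \<phi> x} x :: ennreal)" for t x
      by (simp split: split_indicator)
    show ?thesis unfolding e by (rule nn_integral_cmult) measurable
  qed
  also have "(\<integral>\<^sup>+x. \<integral>\<^sup>+t. indicator {0<..} t * indicator {x. ennreal (a * t) \<le> \<phi> x} x \<partial>lborel \<partial>lborel) =
      (\<integral>\<^sup>+t. \<integral>\<^sup>+x. indicator {0<..} t * indicator {x. ennreal (a * t) \<le> \<phi> x} x \<partial>lborel \<partial>lborel)"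
    by (rule lborel_pair.Fubini') measurable
  also have "\<dots> = (\<integral>\<^sup>+t. indicator {0<..} t * emeasure lborel {x. ennreal (a * t) \<le> \<phi> x} \<partial>lborel)"
    by (intro nn_integral_cong) (simp add: nn_integral_cmult)
  finally show ?thesis .
qed

text \<open>Scale \<open>\<phi>0\<close> and \<open>\<phi>1\<close> to have supremum 1. For \<open>0 < t < 1\<close> their level sets at height \<open>t\<close> are then
  both nonempty and \<open>Brunn_Minkowski_line\<close> compares them with that of \<open>\<phi>\<close>; integrating over \<open>t\<close> gives the
  arithmetic mean of the integrals, which dominates the geometric mean. Finite suprema are what makes the
  scaling possible.\<close>

lemma Prekopa_Leindler_bounded:
  fixes \<phi>0 \<phi>1 \<phi> :: "real \<Rightarrow> ennreal"
  assumes [measurable]: "\<phi>0 \<in> borel_measurable borel" "\<phi>1 \<in> borel_measurable borel" "\<phi> \<in> borel_measurable borel"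
    and l: "0 < l" "l < 1"
    and bd: "(SUP x. \<phi>0 x) \<noteq> \<top>" "(SUP x. \<phi>1 x) \<noteq> \<top>"
    and le: "\<And>x y. \<phi>0 x powe (1 - l) * \<phi>1 y powe l \<le> \<phi> ((1 - l) * x + l * y)"
  shows "(\<integral>\<^sup>+x. \<phi>0 x \<partial>lborel) powe (1 - l) * (\<integral>\<^sup>+x. \<phi>1 x \<partial>lborel) powe l \<le> (\<integral>\<^sup>+x. \<phi> x \<partial>lborel)"
proof (cases "(SUP x. \<phi>0 x) = 0 \<or> (SUP x. \<phi>1 x) = 0")
  case True
  then have "\<phi>0 = (\<lambda>_. 0) \<or> \<phi>1 = (\<lambda>_. 0)"
    by (auto simp: fun_eq_iff) (metis SUP_upper UNIV_I le_zero_eq)+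
  then show ?thesis using l by auto
next
  case False
  obtain a0 where a0: "0 < a0" "(SUP x. \<phi>0 x) = ennreal a0"
    using False bd by (cases "SUP x. \<phi>0 x" rule: ennreal_three_cases) auto
  obtain a1 where a1: "0 < a1" "(SUP x. \<phi>1 x) = ennreal a1"
    using False bd by (cases "SUP x. \<phi>1 x" rule: ennreal_three_cases) auto
  define K where "K = a0 powr (1 - l) * a1 powr l"
  have K: "0 < K" using a0 a1 by (simp add: K_def)
  define J where "J \<phi> a = (\<integral>\<^sup>+t. indicator {0<..<1} t * emeasure lborel {x. ennreal (a * t) \<le> \<phi> x} \<partial>lborel)"
    for \<phi> :: "real \<Rightarrow> ennreal" and a :: real
  have J: "(\<integral>\<^sup>+x. \<phi> x \<partial>lborel) = ennreal a * J \<phi> a"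
    if [measurable]: "\<phi> \<in> borel_measurable borel" and a: "0 < a" "(SUP x. \<phi> x) = ennreal a" for \<phi> a
  proof -
    have "{x. ennreal (a * t) \<le> \<phi> x} = {}" if "1 < t" for t
    proof -
      have "\<phi> x < ennreal (a * t)" for x
      proof -
        have "\<phi> x \<le> ennreal a" unfolding a(2)[symmetric] by (rule SUP_upper) simp
        also have "ennreal a < ennreal (a * t)" using a that by (simp add: ennreal_less_iff)
        finally show ?thesis .
      qed
      then show ?thesis by (auto simp: not_le)
    qed
    then have "AE t in lborel. indicator {0<..} t * emeasure lborel {x. ennreal (a * t) \<le> \<phi> x} =
       indicator {0<..<1} t * emeasure lborel {x. ennreal (a * t) \<le> \<phi> x}"
      using AE_lborel_singleton[of "1::real"]
      by (auto elim!: eventually_mono split: split_indicator simp: not_less)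
    then show ?thesis unfolding layer_cake[OF that(1) a(1)] J_def
      by (intro arg_cong2[where f = "(*)"] nn_integral_cong_AE) auto
  qed
  have level: "ennreal (1 - l) * emeasure lborel {x. ennreal (a0 * t) \<le> \<phi>0 x} + ennreal l * emeasure lborel {x. ennreal (a1 * t) \<le> \<phi>1 x}
      \<le> emeasure lborel {x. ennreal (K * t) \<le> \<phi> x}" if t: "0 < t" "t < 1" for t
  proof (rule Brunn_Minkowski_line)
    have ne: "{x. ennreal (a * t) \<le> \<phi> x} \<noteq> {}" if "0 < a" "(SUP x. \<phi> x) = ennreal a" for \<phi> :: "real \<Rightarrow> ennreal" and a
    proof -
      have "ennreal (a * t) < (SUP x. \<phi> x)" unfolding that(2) using that(1) t by (simp add: ennreal_less_iff)
      then obtain x where "ennreal (a * t) < \<phi> x" by (auto simp: less_SUP_iff)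
      then show ?thesis by (auto intro: less_imp_le)
    qed
    show "{x. ennreal (a0 * t) \<le> \<phi>0 x} \<noteq> {}" "{x. ennreal (a1 * t) \<le> \<phi>1 x} \<noteq> {}"
      using ne a0 a1 by blast+
    fix x y assume xy: "x \<in> {x. ennreal (a0 * t) \<le> \<phi>0 x}" "y \<in> {x. ennreal (a1 * t) \<le> \<phi>1 x}"
    have "(a0 * t) powr (1 - l) * (a1 * t) powr l = K * (t powr (1 - l) * t powr l)"
      unfolding K_def using t a0 a1 by (simp add: powr_mult)
    also have "t powr (1 - l) * t powr l = t" using t by (simp add: powr_add[symmetric])
    finally have "ennreal (K * t) = ennreal (a0 * t) powe (1 - l) * ennreal (a1 * t) powe l"
      using t a0 a1 by (simp add: powe_ennreal ennreal_mult'[symmetric])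
    also have "\<dots> \<le> \<phi>0 x powe (1 - l) * \<phi>1 y powe l"
      using xy l by (intro mult_mono powe_mono) auto
    also note le
    finally show "(1 - l) * x + l * y \<in> {x. ennreal (K * t) \<le> \<phi> x}" by simp
  qed (use l in auto)
  have "(\<integral>\<^sup>+x. \<phi>0 x \<partial>lborel) powe (1 - l) * (\<integral>\<^sup>+x. \<phi>1 x \<partial>lborel) powe l =
      ennreal K * (J \<phi>1 a1 powe l * J \<phi>0 a0 powe (1 - l))"
    unfolding J[OF assms(1) a0] J[OF assms(2) a1] using l a0 a1
    by (simp add: powe_mult powe_ennreal K_def ennreal_mult mult_ac)
  also have "\<dots> \<le> ennreal K * (ennreal l * J \<phi>1 a1 + ennreal (1 - l) * J \<phi>0 a0)"
    by (intro mult_left_mono powe_AM_GM l) auto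
  also have "ennreal l * J \<phi>1 a1 + ennreal (1 - l) * J \<phi>0 a0 =
     (\<integral>\<^sup>+t. indicator {0<..<1} t * (ennreal (1 - l) * emeasure lborel {x. ennreal (a0 * t) \<le> \<phi>0 x} + ennreal l * emeasure lborel {x. ennreal (a1 * t) \<le> \<phi>1 x}) \<partial>lborel)"
    unfolding J_def by (simp add: nn_integral_add[symmetric] nn_integral_cmult[symmetric] distrib_left mult_ac add.commute)
  also have "\<dots> \<le> (\<integral>\<^sup>+t. indicator {0<..} t * emeasure lborel {x. ennreal (K * t) \<le> \<phi> x} \<partial>lborel)"
    by (intro nn_integral_mono) (auto split: split_indicator intro: level)
  also have "ennreal K * \<dots> = (\<integral>\<^sup>+x. \<phi> x \<partial>lborel)" by (rule layer_cake[symmetric]) (use K in auto)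
  finally show ?thesis by (simp add: mult_left_mono)
qed

lemma SUP_inf_of_nat: "(SUP n::nat. inf x (of_nat n)) = (x :: ennreal)"
  by (simp add: inf_SUP[symmetric] ennreal_SUP_of_nat_eq_top)

theorem Prekopa_Leindler_line:
  fixes \<phi>0 \<phi>1 \<phi> :: "real \<Rightarrow> ennreal"
  assumes [measurable]: "\<phi>0 \<in> borel_measurable borel" "\<phi>1 \<in> borel_measurable borel" "\<phi> \<in> borel_measurable borel"
    and l: "0 < l" "l < 1"
    and le: "\<And>x y. \<phi>0 x powe (1 - l) * \<phi>1 y powe l \<le> \<phi> ((1 - l) * x + l * y)"
  shows "(\<integral>\<^sup>+x. \<phi>0 x \<partial>lborel) powe (1 - l) * (\<integral>\<^sup>+x. \<phi>1 x \<partial>lborel) powe l \<le> (\<integral>\<^sup>+x. \<phi> x \<partial>lborel)"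
proof -
  have S: "(\<integral>\<^sup>+x. \<phi> x \<partial>lborel) powe e = (SUP n. (\<integral>\<^sup>+x. inf (\<phi> x) (of_nat n) \<partial>lborel) powe e)"
    if [measurable]: "\<phi> \<in> borel_measurable borel" and e: "0 < e" for \<phi> :: "real \<Rightarrow> ennreal" and e
  proof -
    have "(\<integral>\<^sup>+x. \<phi> x \<partial>lborel) = (\<integral>\<^sup>+x. (SUP n. inf (\<phi> x) (of_nat n)) \<partial>lborel)"
      by (simp only: SUP_inf_of_nat)
    also have "\<dots> = (SUP n. \<integral>\<^sup>+x. inf (\<phi> x) (of_nat n) \<partial>lborel)"
      by (rule nn_integral_monotone_convergence_SUP)
         (auto intro!: incseq_SucI le_funI inf_mono of_nat_mono)
    finally show ?thesis using e by (simp add: powe_SUP)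
  qed
  have "(\<integral>\<^sup>+x. inf (\<phi>0 x) (of_nat m) \<partial>lborel) powe (1 - l) * (\<integral>\<^sup>+x. inf (\<phi>1 x) (of_nat n) \<partial>lborel) powe l
      \<le> (\<integral>\<^sup>+x. \<phi> x \<partial>lborel)" for m n
  proof (rule Prekopa_Leindler_bounded)
    have "(SUP x. inf (\<phi> x) (of_nat n)) \<le> of_nat n" for n and \<phi> :: "real \<Rightarrow> ennreal"
      by (rule SUP_least) simp
    then show "(SUP x. inf (\<phi>0 x) (of_nat m)) \<noteq> \<top>" "(SUP x. inf (\<phi>1 x) (of_nat n)) \<noteq> \<top>"
      by (metis ennreal_of_nat_neq_top infinity_ennreal_def top_unique)+
    show "inf (\<phi>0 x) (of_nat m) powe (1 - l) * inf (\<phi>1 y) (of_nat n) powe l \<le> \<phi> ((1 - l) * x + l * y)" for x y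
      by (rule order_trans[OF mult_mono[OF powe_mono powe_mono] le]) (use l in auto)
  qed (use l in auto)
  then have "(SUP m. (\<integral>\<^sup>+x. inf (\<phi>0 x) (of_nat m) \<partial>lborel) powe (1 - l)) *
      (SUP n. (\<integral>\<^sup>+x. inf (\<phi>1 x) (of_nat n) \<partial>lborel) powe l) \<le> (\<integral>\<^sup>+x. \<phi> x \<partial>lborel)"
    unfolding SUP_mult_left_ennreal SUP_mult_right_ennreal by (intro SUP_least)
  then show ?thesis
    using S[OF assms(1), of "1 - l"] S[OF assms(2), of l] l by simp
qed

text \<open>The hypothesis survives integration over one coordinate, by the one-dimensional case.\<close>

theorem Prekopa_Leindler_coordinates:
  fixes \<phi>0 \<phi>1 \<phi> :: "('i \<Rightarrow> real) \<Rightarrow> ennreal"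
  assumes I: "finite I" and l: "0 < l" "l < 1"
  shows "\<phi>0 \<in> borel_measurable (\<Pi>\<^sub>M i\<in>I. lborel) \<Longrightarrow> \<phi>1 \<in> borel_measurable (\<Pi>\<^sub>M i\<in>I. lborel) \<Longrightarrow>
    \<phi> \<in> borel_measurable (\<Pi>\<^sub>M i\<in>I. lborel) \<Longrightarrow>
    (\<And>x y. \<phi>0 x powe (1 - l) * \<phi>1 y powe l \<le> \<phi> (\<lambda>i\<in>I. (1 - l) * x i + l * y i)) \<Longrightarrow>
    (\<integral>\<^sup>+x. \<phi>0 x \<partial>(\<Pi>\<^sub>M i\<in>I. lborel)) powe (1 - l) * (\<integral>\<^sup>+x. \<phi>1 x \<partial>(\<Pi>\<^sub>M i\<in>I. lborel)) powe l
      \<le> (\<integral>\<^sup>+x. \<phi> x \<partial>(\<Pi>\<^sub>M i\<in>I. lborel))"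
  using I
proof (induction I arbitrary: \<phi>0 \<phi>1 \<phi> rule: finite_induct)
  case empty
  show ?case using empty.prems(4)[of "\<lambda>_. undefined" "\<lambda>_. undefined"]
    by (simp add: PiM_empty nn_integral_count_space_finite max.absorb2 restrict_def)
next
  case (insert i I)
  interpret product_sigma_finite "\<lambda>_::'i. lborel :: real measure" by standard
  note [measurable] = insert.prems(1-3)
  let ?P = "\<Pi>\<^sub>M i\<in>I. lborel :: real measure"
  let ?PI = "\<Pi>\<^sub>M i\<in>insert i I. lborel :: real measure"
  have upd [measurable]: "(\<lambda>x. (F x)(i := h x)) \<in> N \<rightarrow>\<^sub>M ?PI"
    if "F \<in> N \<rightarrow>\<^sub>M ?P" "h \<in> N \<rightarrow>\<^sub>M lborel" for F h and N :: "'n measure"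
    using that by (intro measurable_fun_upd[where J = I]) auto
  have res: "(\<lambda>x. restrict (F x) I) \<in> N \<rightarrow>\<^sub>M ?P" if "F \<in> N \<rightarrow>\<^sub>M ?P" for F and N :: "'n measure"
  proof (rule measurable_restrict)
    fix j assume "j \<in> I"
    then show "(\<lambda>x. F x j) \<in> N \<rightarrow>\<^sub>M lborel"
      using measurable_compose[OF that measurable_component_singleton] by simp
  qed
  have cut: "(\<lambda>s. f (x(i := s))) \<in> borel_measurable borel" if f: "f \<in> borel_measurable ?PI" and x: "x \<in> space ?P" for f :: "('i \<Rightarrow> real) \<Rightarrow> ennreal" and x
    using measurable_compose[OF upd[OF measurable_const[OF x] measurable_ident] f] by simp
  let ?r = "\<lambda>x. restrict x I"
  have marg: "(\<lambda>x. \<integral>\<^sup>+s. f ((?r x)(i := s)) \<partial>lborel) \<in> borel_measurable ?P" if f: "f \<in> borel_measurable ?PI" for f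
  proof -
    have "(\<lambda>p. f ((?r (fst p))(i := snd p))) \<in> borel_measurable (?P \<Otimes>\<^sub>M lborel)"
      by (rule measurable_compose[OF upd[OF res[OF measurable_fst] measurable_snd] f])
    then show ?thesis
      by (intro lborel.borel_measurable_nn_integral) (simp add: split_beta')
  qed
  have r: "?r x \<in> space ?P" for x by (simp add: space_PiM)
  have ext: "\<psi> (?r x) = \<psi> x" if "x \<in> space ?P" for \<psi> :: "('i \<Rightarrow> real) \<Rightarrow> ennreal" and x
    using that by (simp add: space_PiM PiE_def extensional_restrict)
  have "(\<integral>\<^sup>+x. \<phi>0 x \<partial>?PI) powe (1 - l) * (\<integral>\<^sup>+x. \<phi>1 x \<partial>?PI) powe l =
      (\<integral>\<^sup>+x. \<integral>\<^sup>+s. \<phi>0 ((?r x)(i := s)) \<partial>lborel \<partial>?P) powe (1 - l) * (\<integral>\<^sup>+x. \<integral>\<^sup>+s. \<phi>1 ((?r x)(i := s)) \<partial>lborel \<partial>?P) powe l"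
    using ext[of _ "\<lambda>x. \<integral>\<^sup>+s. \<phi>0 (x(i := s)) \<partial>lborel"] ext[of _ "\<lambda>x. \<integral>\<^sup>+s. \<phi>1 (x(i := s)) \<partial>lborel"]
    by (subst (1 2) product_nn_integral_insert[OF insert.hyps]) (auto cong: nn_integral_cong)
  also have "\<dots> \<le> (\<integral>\<^sup>+x. \<integral>\<^sup>+s. \<phi> ((?r x)(i := s)) \<partial>lborel \<partial>?P)"
  proof (rule insert.IH)
    fix x y
    show "(\<integral>\<^sup>+s. \<phi>0 ((?r x)(i := s)) \<partial>lborel) powe (1 - l) * (\<integral>\<^sup>+s. \<phi>1 ((?r y)(i := s)) \<partial>lborel) powe l
        \<le> (\<integral>\<^sup>+s. \<phi> ((?r (\<lambda>i\<in>I. (1 - l) * x i + l * y i))(i := s)) \<partial>lborel)"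
    proof (rule Prekopa_Leindler_line[OF _ _ _ l])
      fix s t
      have "(\<lambda>j\<in>insert i I. (1 - l) * ((?r x)(i := s)) j + l * ((?r y)(i := t)) j) =
          (?r (\<lambda>i\<in>I. (1 - l) * x i + l * y i))(i := (1 - l) * s + l * t)"
        using insert.hyps(2) by (auto simp: fun_eq_iff)
      from insert.prems(4)[of "(?r x)(i := s)" "(?r y)(i := t)", unfolded this]
      show "\<phi>0 ((?r x)(i := s)) powe (1 - l) * \<phi>1 ((?r y)(i := t)) powe l \<le>
        \<phi> ((?r (\<lambda>i\<in>I. (1 - l) * x i + l * y i))(i := (1 - l) * s + l * t))" .
    qed (use r cut insert.prems in blast)+
  qed (use marg insert.prems in blast)+
  also have "\<dots> = (\<integral>\<^sup>+x. \<phi> x \<partial>?PI)"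
    using ext[of _ "\<lambda>x. \<integral>\<^sup>+s. \<phi> (x(i := s)) \<partial>lborel"]
    by (subst product_nn_integral_insert[OF insert.hyps]) (auto cong: nn_integral_cong)
  finally show ?case .
qed

theorem Prekopa_Leindler:
  fixes \<phi>0 \<phi>1 \<phi> :: "'a::euclidean_space \<Rightarrow> ennreal"
  assumes [measurable]: "\<phi>0 \<in> borel_measurable borel" "\<phi>1 \<in> borel_measurable borel" "\<phi> \<in> borel_measurable borel"
    and l: "0 < l" "l < 1"
    and le: "\<And>x y. \<phi>0 x powe (1 - l) * \<phi>1 y powe l \<le> \<phi> ((1 - l) *\<^sub>R x + l *\<^sub>R y)"
  shows "(\<integral>\<^sup>+x. \<phi>0 x \<partial>lborel) powe (1 - l) * (\<integral>\<^sup>+x. \<phi>1 x \<partial>lborel) powe l \<le> (\<integral>\<^sup>+x. \<phi> x \<partial>lborel)"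
proof -
  define S :: "('a \<Rightarrow> real) \<Rightarrow> 'a" where "S w = (\<Sum>b\<in>Basis. w b *\<^sub>R b)" for w
  have [measurable]: "S \<in> (\<Pi>\<^sub>M b\<in>Basis. lborel) \<rightarrow>\<^sub>M borel" unfolding S_def by measurable
  have S: "S (\<lambda>i\<in>Basis. (1 - l) * x i + l * y i) = (1 - l) *\<^sub>R S x + l *\<^sub>R S y" for x y
    by (simp add: S_def scaleR_add_left sum.distrib scaleR_sum_right)
  have "(\<integral>\<^sup>+x. \<phi>0 (S x) \<partial>(\<Pi>\<^sub>M b\<in>Basis. lborel)) powe (1 - l) * (\<integral>\<^sup>+x. \<phi>1 (S x) \<partial>(\<Pi>\<^sub>M b\<in>Basis. lborel)) powe l
      \<le> (\<integral>\<^sup>+x. \<phi> (S x) \<partial>(\<Pi>\<^sub>M b\<in>Basis. lborel))"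
    by (rule Prekopa_Leindler_coordinates[OF finite_Basis l]) (auto simp: S le)
  then show ?thesis
    by (subst (1 2 3) nn_integral_lborel_coordinates) (auto simp: S_def)
qed

section \<open>Borell's comparison of moments\<close>

lemma nn_integral_Gamma:
  assumes q: "0 < q" and a: "0 < a"
  shows "(\<integral>\<^sup>+t. ennreal (indicator {0<..} t * t powr (q - 1) * exp (- a * t)) \<partial>lborel) = ennreal (Gamma q * a powr - q)"
proof -
  have "(\<integral>\<^sup>+t. ennreal (indicator {0<..} t * t powr (q - 1) * exp (- t)) \<partial>lborel) =
      (\<integral>\<^sup>+t. ennreal (t powr (q - 1) / exp t) * indicator {0..} t \<partial>lborel)"
    by (intro nn_integral_cong) (auto simp: exp_minus field_simps split: split_indicator)
  also have "\<dots> = ennreal (Gamma q)"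
    by (rule nn_integral_has_integral_lebesgue'[OF _ Gamma_integral_real[OF q]]) auto
  finally have G: "(\<integral>\<^sup>+t. ennreal (indicator {0<..} t * t powr (q - 1) * exp (- t)) \<partial>lborel) = ennreal (Gamma q)" .
  have "ennreal (Gamma q) = ennreal a * (\<integral>\<^sup>+t. ennreal (indicator {0<..} (a * t) * (a * t) powr (q - 1) * exp (- (a * t))) \<partial>lborel)"
    unfolding G[symmetric] using a by (subst nn_integral_real_affine[where c = a and t = 0]) auto
  also have "\<dots> = ennreal a * (\<integral>\<^sup>+t. ennreal (a powr (q - 1)) * ennreal (indicator {0<..} t * t powr (q - 1) * exp (- a * t)) \<partial>lborel)"
    using a by (intro arg_cong2[where f = "(*)"] refl nn_integral_cong)
      (auto simp: ennreal_mult'[symmetric] powr_mult zero_less_mult_iff split: split_indicator)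
  also have "\<dots> = ennreal (a powr q) * (\<integral>\<^sup>+t. ennreal (indicator {0<..} t * t powr (q - 1) * exp (- a * t)) \<partial>lborel)"
  proof -
    have "ennreal a * ennreal (a powr (q - 1)) = ennreal (a powr q)"
      using a by (simp add: ennreal_mult'[symmetric] powr_mult_base)
    then show ?thesis by (subst nn_integral_cmult) (simp_all only: mult.assoc[symmetric], measurable)
  qed
  finally have "ennreal (a powr - q) * ennreal (Gamma q) =
      ennreal (a powr - q * a powr q) * (\<integral>\<^sup>+t. ennreal (indicator {0<..} t * t powr (q - 1) * exp (- a * t)) \<partial>lborel)"
    by (simp add: ennreal_mult' mult.assoc)
  also have "a powr - q * a powr q = 1" using a by (simp add: powr_minus)
  finally show ?thesis using Gamma_real_pos[OF q] by (simp add: ennreal_mult less_imp_le mult.commute)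
qed

text \<open>Concavity of the power function, without division.\<close>

lemma powr_chord:
  fixes a b c e :: real
  assumes "0 < a" "a \<le> b" "b \<le> c" "0 < e" "e < 1"
  shows "(c - b) * a powr e + (b - a) * c powr e \<le> (c - a) * b powr e"
proof -
  have t: "x powr e * b powr (1 - e) \<le> e * x + (1 - e) * b" if "0 < x" for x
    using Youngs_inequality_0[of e "1 - e" x b] assms that by simp
  have "((c - b) * a powr e + (b - a) * c powr e) * b powr (1 - e) =
     (c - b) * (a powr e * b powr (1 - e)) + (b - a) * (c powr e * b powr (1 - e))"
    by (simp add: algebra_simps)
  also have "\<dots> \<le> (c - b) * (e * a + (1 - e) * b) + (b - a) * (e * c + (1 - e) * b)"
    using assms t[of a] t[of c] by (intro add_mono mult_left_mono) auto
  also have "\<dots> = (c - a) * b" by (simp add: algebra_simps)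
  also have "\<dots> = (c - a) * b powr e * b powr (1 - e)" using assms by (simp add: powr_add[symmetric])
  finally show ?thesis using assms by (simp add: mult_le_cancel_right)
qed

text \<open>A function that changes sign only at \<open>\<tau>\<close> keeps one sign after multiplication by
  \<open>\<tau> powr (n3 - n1) - t powr (n3 - n1)\<close>. If the two moments vanish, so does the integral of this product.\<close>

lemma vanishing_of_two_moments:
  fixes D :: "real \<Rightarrow> real"
  assumes sgn: "AE t in lborel. 0 < t \<longrightarrow> (t < \<tau> \<longrightarrow> 0 \<le> D t) \<and> (\<tau> < t \<longrightarrow> D t \<le> 0)"
    and \<tau>: "0 \<le> \<tau>" and d: "n1 < n3"
    and int: "integrable lborel (\<lambda>t. indicator {0<..} t * t powr (n1 - 1) * D t)"
      "integrable lborel (\<lambda>t. indicator {0<..} t * t powr (n3 - 1) * D t)"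
    and zero: "(\<integral>t. indicator {0<..} t * t powr (n1 - 1) * D t \<partial>lborel) = 0"
      "(\<integral>t. indicator {0<..} t * t powr (n3 - 1) * D t \<partial>lborel) = 0"
  shows "AE t in lborel. 0 < t \<longrightarrow> D t = 0"
proof -
  define P where "P t = \<tau> powr (n3 - n1) * (indicator {0<..} t * t powr (n1 - 1) * D t) - indicator {0<..} t * t powr (n3 - 1) * D t" for t
  have P: "P t = (\<tau> powr (n3 - n1) - t powr (n3 - n1)) * (t powr (n1 - 1) * D t)" if "0 < t" for t
    using that by (simp add: P_def algebra_simps powr_add[symmetric])
  have iP: "integrable lborel P" unfolding P_def by (intro Bochner_Integration.integrable_diff integrable_mult_right int)
  have "(\<integral>t. P t \<partial>lborel) = 0"
    unfolding P_def by (subst Bochner_Integration.integral_diff) (use int zero in auto)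
  moreover have pos: "AE t in lborel. 0 \<le> P t"
    using sgn
  proof eventually_elim
    case (elim t)
    show ?case
    proof (cases "0 < t")
      case True
      consider "t < \<tau>" | "t = \<tau>" | "\<tau> < t" by linarith
      then show ?thesis
      proof cases
        case 1
        then have "t powr (n3 - n1) \<le> \<tau> powr (n3 - n1)" using True d by (intro powr_mono2) auto
        then show ?thesis unfolding P[OF True] using elim True 1 by (intro mult_nonneg_nonneg) auto
      next
        case 3
        then have "\<tau> powr (n3 - n1) \<le> t powr (n3 - n1)" using \<tau> d by (intro powr_mono2) auto
        then show ?thesis unfolding P[OF True] using elim True 3
          by (intro mult_nonpos_nonpos mult_nonneg_nonpos) auto
      next
        case 2 then show ?thesis using P[OF True] by simp
      qed
    qed (simp add: P_def)
  qed
  ultimately have "AE t in lborel. P t = 0"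
    using integral_nonneg_eq_0_iff_AE[OF iP pos] by simp
  then show ?thesis
    using AE_lborel_singleton[of \<tau>]
  proof eventually_elim
    case (elim t)
    show ?case
    proof
      assume t: "0 < t"
      have "\<tau> powr (n3 - n1) \<noteq> t powr (n3 - n1)"
        using elim(2) t \<tau> d by (metis less_eq_real_def linorder_neqE_linordered_idom order_less_irrefl powr_less_mono2 diff_gt_0_iff_gt)
      with elim(1) t show "D t = 0" unfolding P[OF t] by simp
    qed
  qed
qed

text \<open>Compare \<open>K\<close> with the exponential \<open>E t = A * exp (- b * t)\<close> that has the same moments of order
  \<open>n1\<close> and \<open>n3\<close>; the bound to be proved is the moment of order \<open>n2\<close> of \<open>E\<close>. Because \<open>K\<close> is log-concave and
  \<open>E\<close> log-affine, \<open>K \<ge> E\<close> holds exactly on an interval \<open>S\<close>. If \<open>S\<close> has two different end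
  points, both positive and finite, a combination of the three powers of \<open>t\<close> is nonnegative on \<open>S\<close> and nonpositive outside, so its
  integral against \<open>K - E\<close> is nonnegative, and only the moment of order \<open>n2\<close> contributes to it. Otherwise
  \<open>K - E\<close> changes sign at most once and vanishes almost everywhere.\<close>

lemma Borell_moment_comparison:
  fixes K :: "real \<Rightarrow> ennreal"
  assumes [measurable]: "K \<in> borel_measurable borel"
    and lc: "\<And>s t l. 0 < s \<Longrightarrow> 0 < t \<Longrightarrow> 0 < l \<Longrightarrow> l < 1 \<Longrightarrow> K s powe (1 - l) * K t powe l \<le> K ((1 - l) * s + l * t)"
    and n: "0 < n1" "n1 < n2" "n2 < n3"
    and i1: "0 < i1" "(\<integral>\<^sup>+t. ennreal (indicator {0<..} t * t powr (n1 - 1)) * K t \<partial>lborel) = ennreal i1"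
    and i3: "0 < i3" "(\<integral>\<^sup>+t. ennreal (indicator {0<..} t * t powr (n3 - 1)) * K t \<partial>lborel) = ennreal i3"
    and \<theta>: "n2 = (1 - \<theta>) * n1 + \<theta> * n3"
  shows "ennreal (Gamma n2 * ((i1 / Gamma n1) powr (1 - \<theta>) * (i3 / Gamma n3) powr \<theta>)) \<le>
    (\<integral>\<^sup>+t. ennreal (indicator {0<..} t * t powr (n2 - 1)) * K t \<partial>lborel)"
proof -
  define \<delta> where "\<delta> = n3 - n1"
  have \<delta>: "0 < \<delta>" "n2 - n1 = \<theta> * \<delta>" "n3 = n1 + \<delta>" using n \<theta> by (auto simp: \<delta>_def algebra_simps)
  have \<theta>1: "0 < \<theta>" "\<theta> < 1"
  proof -
    have "0 < \<theta> * \<delta>" using \<delta>(2) n by simp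
    then show "0 < \<theta>" using \<delta>(1) by (simp add: zero_less_mult_iff)
    have "\<theta> * \<delta> = n2 - n1" using \<delta>(2) by simp
    also have "\<dots> < 1 * \<delta>" using n by (simp add: \<delta>_def)
    finally have "\<theta> * \<delta> < 1 * \<delta>" .
    then show "\<theta> < 1" by (rule mult_right_less_imp_less) (use \<delta>(1) in simp)
  qed
  have G: "0 < Gamma n1" "0 < Gamma n2" "0 < Gamma n3" using n by (auto intro: Gamma_real_pos)
  define j1 j3 where "j1 = i1 / Gamma n1" and "j3 = i3 / Gamma n3"
  have j: "0 < j1" "0 < j3" using i1 i3 G by (auto simp: j1_def j3_def)
  \<comment> \<open>The equations for the moments of order \<open>n1\<close> and \<open>n3\<close> of \<open>E\<close>, solved for \<open>b\<close> and \<open>A\<close>.\<close>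
  define b where "b = (j1 / j3) powr (1 / \<delta>)"
  have b: "0 < b" using j by (simp add: b_def)
  define A where "A = j1 * b powr n1"
  have A: "0 < A" using j b by (simp add: A_def)
  have bd: "b powr \<delta> = j1 / j3" using \<delta> j by (simp add: b_def powr_powr)
  have A1: "A * b powr - n1 = j1" using b by (simp add: A_def powr_minus)
  have A3: "A * b powr - n3 = j3"
  proof -
    have "A * b powr - n3 = j1 * (b powr n1 * b powr (- n3))" by (simp add: A_def)
    also have "b powr n1 * b powr (- n3) = inverse (b powr \<delta>)"
      using b by (simp add: powr_add[symmetric] \<delta>(3) powr_minus[symmetric])
    finally show ?thesis using j bd by simp
  qed
  have A2: "A * b powr - n2 = j1 powr (1 - \<theta>) * j3 powr \<theta>"
  proof -
    have "A * b powr - n2 = j1 * (b powr \<delta>) powr - \<theta>"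
    proof -
      have "A * b powr - n2 = j1 * b powr (n1 + - n2)"
        by (simp only: A_def powr_add mult.assoc)
      also have "n1 + - n2 = \<delta> * - \<theta>" using \<delta>(2) by (simp add: algebra_simps)
      finally show ?thesis by (simp only: powr_powr)
    qed
    also have "\<dots> = j1 powr (1 - \<theta>) * j3 powr \<theta>"
      unfolding bd using j by (simp add: powr_divide powr_minus powr_diff field_simps)
    finally show ?thesis .
  qed
  define E where "E t = A * exp (- b * t)" for t
  have E0: "0 < E t" for t using A by (simp add: E_def)
  have [measurable]: "E \<in> borel_measurable borel" unfolding E_def by measurable
  define m where "m n t = indicator {0<..} t * t powr (n - 1)" for n t :: real
  have m0: "0 \<le> m n t" for n t by (simp add: m_def)
  have [measurable]: "m n \<in> borel_measurable borel" for n unfolding m_def by measurable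
  have nE: "(\<integral>\<^sup>+t. ennreal (m n t * E t) \<partial>lborel) = ennreal (Gamma n * (A * b powr - n))" if "0 < n" for n
  proof -
    have "(\<integral>\<^sup>+t. ennreal (m n t * E t) \<partial>lborel) = ennreal A * (\<integral>\<^sup>+t. ennreal (indicator {0<..} t * t powr (n - 1) * exp (- b * t)) \<partial>lborel)"
      using A by (subst nn_integral_cmult[symmetric]) (auto simp: m_def E_def ennreal_mult'[symmetric] mult_ac)
    then show ?thesis using nn_integral_Gamma[OF that b] A by (simp add: ennreal_mult'[symmetric] mult_ac)
  qed
  show ?thesis
  proof (cases "(\<integral>\<^sup>+t. ennreal (m n2 t) * K t \<partial>lborel) = \<top>")
    case True then show ?thesis by (simp add: m_def)
  next
    case False
    define k where "k t = enn2real (K t)" for t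
    have [measurable]: "k \<in> borel_measurable borel" unfolding k_def by measurable
    have "AE t in lborel. ennreal (m n1 t) * K t \<noteq> \<top>"
      using nn_integral_PInf_AE[of "\<lambda>t. ennreal (m n1 t) * K t" lborel] i1 by (simp add: m_def)
    then have kK: "AE t in lborel. 0 < t \<longrightarrow> K t = ennreal (k t)"
      by eventually_elim (auto simp: k_def m_def ennreal_mult_eq_top_iff less_top)
    have nk: "(\<integral>\<^sup>+t. ennreal (m n t) * K t \<partial>lborel) = (\<integral>\<^sup>+t. ennreal (m n t * k t) \<partial>lborel)" for n
    proof (rule nn_integral_cong_AE)
      show "AE t in lborel. ennreal (m n t) * K t = ennreal (m n t * k t)"
        using kK by eventually_elim (auto simp: m_def k_def ennreal_mult' split: split_indicator)
    qed
    have hb: "has_bochner_integral lborel (\<lambda>t. m n t * F t) x"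
      if "(\<integral>\<^sup>+t. ennreal (m n t * F t) \<partial>lborel) = ennreal x" "0 \<le> x" "\<And>t. 0 \<le> F t" "F \<in> borel_measurable borel" for n F x
      using that by (intro has_bochner_integral_nn_integral) (auto simp: m0)
    obtain i2 where i2: "0 \<le> i2" "(\<integral>\<^sup>+t. ennreal (m n2 t) * K t \<partial>lborel) = ennreal i2"
      using False by (cases "(\<integral>\<^sup>+t. ennreal (m n2 t) * K t \<partial>lborel)") auto
    define D where "D t = k t - E t" for t
    have hD: "has_bochner_integral lborel (\<lambda>t. m n t * D t) (x - y)"
      if "(\<integral>\<^sup>+t. ennreal (m n t) * K t \<partial>lborel) = ennreal x" "0 \<le> x" "0 < n" "y = Gamma n * (A * b powr - n)" for n x y
    proof -
      have "has_bochner_integral lborel (\<lambda>t. m n t * k t - m n t * E t) (x - y)"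
      proof (rule has_bochner_integral_diff)
        show "has_bochner_integral lborel (\<lambda>t. m n t * k t) x"
          by (rule hb) (use that nk in \<open>auto simp: k_def\<close>)
        show "has_bochner_integral lborel (\<lambda>t. m n t * E t) y"
          by (rule hb) (use that nE A Gamma_real_pos[of n] E0 in \<open>auto simp: less_imp_le\<close>)
      qed
      then show ?thesis by (simp add: D_def right_diff_distrib)
    qed
    have h1: "has_bochner_integral lborel (\<lambda>t. m n1 t * D t) 0"
    proof -
      have "i1 = Gamma n1 * (A * b powr - n1)" unfolding A1 j1_def using G by simp
      from hD[OF i1(2)[folded m_def] less_imp_le[OF i1(1)] _ this] show ?thesis using n by simp
    qed
    have h3: "has_bochner_integral lborel (\<lambda>t. m n3 t * D t) 0"
    proof -
      have "i3 = Gamma n3 * (A * b powr - n3)" unfolding A3 j3_def using G by simp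
      from hD[OF i3(2)[folded m_def] less_imp_le[OF i3(1)] _ this] show ?thesis using n by simp
    qed
    have h2: "has_bochner_integral lborel (\<lambda>t. m n2 t * D t) (i2 - Gamma n2 * (j1 powr (1 - \<theta>) * j3 powr \<theta>))"
      by (rule hD) (use i2 n A2 in auto)
    have van: "0 \<le> (\<integral>t. m n2 t * D t \<partial>lborel)" if "AE t in lborel. 0 < t \<longrightarrow> D t = 0"
    proof -
      have "(\<integral>t. m n2 t * D t \<partial>lborel) = (\<integral>t. 0 \<partial>(lborel :: real measure))"
        by (rule integral_cong_AE) (use that in \<open>auto simp: D_def m_def elim!: eventually_mono\<close>)
      then show ?thesis by simp
    qed
    define S where "S = {t. 0 < t \<and> ennreal (E t) \<le> K t}"
    have S_conv: "x \<in> S" if "s \<in> S" "t \<in> S" "s \<le> x" "x \<le> t" for s t x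
    proof (cases "x = s \<or> x = t")
      case False
      then have "s < x" "x < t" using that by auto
      define l where "l = (x - s) / (t - s)"
      have l: "0 < l" "l < 1" using \<open>s < x\<close> \<open>x < t\<close> by (auto simp: l_def field_simps)
      have "l * (t - s) = x - s" using \<open>s < x\<close> \<open>x < t\<close> by (simp add: l_def)
      then have x: "x = (1 - l) * s + l * t" by (simp add: algebra_simps)
      have "E x = E s powr (1 - l) * E t powr l"
      proof -
        have "E s powr (1 - l) * E t powr l = (A powr (1 - l) * A powr l) * (exp (- b * s * (1 - l)) * exp (- b * t * l))"
          unfolding E_def using A by (simp add: powr_mult exp_powr_real mult_ac)
        also have "A powr (1 - l) * A powr l = A" using A by (simp add: powr_add[symmetric])
        also have "exp (- b * s * (1 - l)) * exp (- b * t * l) = exp (- b * x)"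
          unfolding x exp_add[symmetric] by (simp add: algebra_simps)
        finally show ?thesis by (simp add: E_def)
      qed
      then have "ennreal (E x) = ennreal (E s) powe (1 - l) * ennreal (E t) powe l"
        using E0 by (simp add: powe_ennreal ennreal_mult'[symmetric])
      also have "\<dots> \<le> K s powe (1 - l) * K t powe l"
        using that l by (intro mult_mono powe_mono) (auto simp: S_def)
      also have "\<dots> \<le> K x" unfolding x using that l by (intro lc) (auto simp: S_def)
      finally show ?thesis using that \<open>s < x\<close> by (simp add: S_def)
    qed (use that in auto)
    have DS: "AE t in lborel. 0 < t \<longrightarrow> (t \<in> S \<longrightarrow> 0 \<le> D t) \<and> (t \<notin> S \<longrightarrow> D t \<le> 0)"
      using kK
    proof eventually_elim
      case (elim t)
      have "0 \<le> k t" by (simp add: k_def)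
      then have "t \<in> S \<longleftrightarrow> E t \<le> k t" if "0 < t"
        using elim that by (simp add: S_def)
      then show ?case by (auto simp: D_def)
    qed
    have vm: "AE t in lborel. 0 < t \<longrightarrow> D t = 0"
      if "AE t in lborel. 0 < t \<longrightarrow> (t < \<tau> \<longrightarrow> 0 \<le> D t) \<and> (\<tau> < t \<longrightarrow> D t \<le> 0)" "0 \<le> \<tau>" for \<tau>
      by (rule vanishing_of_two_moments[OF that, of n1 n3])
         (use n h1 h3 in \<open>auto simp: m_def has_bochner_integral_iff\<close>)
    have vm': "AE t in lborel. 0 < t \<longrightarrow> D t = 0"
      if "AE t in lborel. 0 < t \<longrightarrow> (t < \<tau> \<longrightarrow> D t \<le> 0) \<and> (\<tau> < t \<longrightarrow> 0 \<le> D t)" "0 \<le> \<tau>" for \<tau>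
    proof -
      have "AE t in lborel. 0 < t \<longrightarrow> - D t = 0"
        by (rule vanishing_of_two_moments[of \<tau> "\<lambda>t. - D t" n1 n3])
           (use that n h1 h3 in \<open>auto simp: m_def has_bochner_integral_iff\<close>)
      then show ?thesis by simp
    qed
    have "0 \<le> (\<integral>t. m n2 t * D t \<partial>lborel)"
    proof (cases "S = {}")
      case True
      show ?thesis by (rule van, rule vm[of 0]) (use DS True in \<open>auto elim!: eventually_mono\<close>)
    next
      case ne: False
      have S0: "bdd_below S" by (rule bdd_belowI[of _ 0]) (auto simp: S_def)
      define t1 where "t1 = Inf S"
      have t1: "0 \<le> t1" unfolding t1_def by (rule cInf_greatest[OF ne]) (auto simp: S_def)
      have below: "t \<notin> S" if "t < t1" for t
        using that cInf_lower[OF _ S0, of t] by (auto simp: t1_def)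
      show ?thesis
      proof (cases "bdd_above S")
        case False
        have "t \<in> S" if t: "t1 < t" for t
        proof -
          obtain s where "s \<in> S" "s < t" using t cInf_less_iff[OF ne S0] by (auto simp: t1_def)
          moreover obtain s' where "s' \<in> S" "t < s'" using False unfolding bdd_above_def by (meson not_le)
          ultimately show ?thesis using S_conv[of s s' t] by simp
        qed
        then show ?thesis
          by (intro van vm'[OF _ t1]) (use DS below in \<open>auto elim!: eventually_mono\<close>)
      next
        case bdd: True
        define t2 where "t2 = Sup S"
        have above: "t \<notin> S" if "t2 < t" for t
          using that cSup_upper[OF _ bdd, of t] by (auto simp: t2_def)
        have t12: "t1 \<le> t2" using ne S0 bdd by (simp add: t1_def t2_def cInf_le_cSup)
        have inside: "t \<in> S" if t: "t1 < t" "t < t2" for t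
        proof -
          obtain s where "s \<in> S" "s < t" using t cInf_less_iff[OF ne S0] by (auto simp: t1_def)
          moreover obtain s' where "s' \<in> S" "t < s'" using t less_cSup_iff[OF ne bdd] by (auto simp: t2_def)
          ultimately show ?thesis using S_conv[of s s' t] by simp
        qed
        consider "t1 = 0" | "t1 = t2" | "0 < t1" "t1 < t2" using t1 t12 by linarith
        then show ?thesis
        proof cases
          case 1
          show ?thesis
            by (rule van, rule vm[of t2]) (use DS inside above 1 t12 in \<open>auto elim!: eventually_mono\<close>)
        next
          case 2
          have "AE t in lborel. 0 < t \<longrightarrow> D t \<le> 0"
            using DS AE_lborel_singleton[of t1]
          proof eventually_elim
            case (elim t)
            then show ?case using below[of t] above[of t] 2 by (metis linorder_neqE_linordered_idom)
          qed
          then show ?thesis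
            by (intro van vm[of 0]) (auto elim!: eventually_mono)
        next
          case 3
          define u1 u2 where "u1 = t1 powr \<delta>" and "u2 = t2 powr \<delta>"
          have u: "0 < u1" "u1 < u2" using 3 \<delta> by (auto simp: u1_def u2_def intro: powr_less_mono2)
          \<comment> \<open>\<open>x powr \<theta>\<close> minus its chord over \<open>[u1, u2]\<close>, scaled by \<open>u2 - u1\<close>; here \<open>x\<close> stands for \<open>t powr \<delta>\<close>.\<close>
          define \<psi> where "\<psi> x = (u2 - u1) * x powr \<theta> - (u2 - x) * u1 powr \<theta> - (x - u1) * u2 powr \<theta>" for x
          have \<psi>_in: "0 \<le> \<psi> x" if "u1 \<le> x" "x \<le> u2" for x
            using powr_chord[of u1 x u2 \<theta>] that u \<theta>1 by (simp add: \<psi>_def)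
          have \<psi>_lo: "\<psi> x \<le> 0" if "0 < x" "x \<le> u1" for x
            using powr_chord[of x u1 u2 \<theta>] that u \<theta>1 by (simp add: \<psi>_def algebra_simps)
          have \<psi>_hi: "\<psi> x \<le> 0" if "u2 \<le> x" for x
            using powr_chord[of u1 u2 x \<theta>] that u \<theta>1 by (simp add: \<psi>_def algebra_simps)
          define P where "P t = (u2 - u1) * (m n2 t * D t) - (u2 * u1 powr \<theta> - u1 * u2 powr \<theta>) * (m n1 t * D t) -
             (u2 powr \<theta> - u1 powr \<theta>) * (m n3 t * D t)" for t
          have P: "P t = m n1 t * (\<psi> (t powr \<delta>) * D t)" for t
          proof (cases "0 < t")
            case True
            have "m n2 t = m n1 t * (t powr \<delta>) powr \<theta>"
            proof -
              have "n2 - 1 = (n1 - 1) + \<delta> * \<theta>" using \<delta>(2) by (simp add: mult.commute)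
              then have "m n2 t = indicator {0<..} t * t powr ((n1 - 1) + \<delta> * \<theta>)" by (simp only: m_def)
              then show ?thesis by (simp only: m_def powr_add powr_powr mult.assoc)
            qed
            moreover have "m n3 t = m n1 t * t powr \<delta>"
            proof -
              have "n3 - 1 = (n1 - 1) + \<delta>" by (simp add: \<delta>(3))
              then have "m n3 t = indicator {0<..} t * t powr ((n1 - 1) + \<delta>)" by (simp only: m_def)
              then show ?thesis by (simp only: m_def powr_add mult.assoc)
            qed
            ultimately show ?thesis unfolding P_def \<psi>_def by (simp add: algebra_simps)
          qed (simp add: P_def m_def)
          have "has_bochner_integral lborel P ((u2 - u1) * (\<integral>t. m n2 t * D t \<partial>lborel) -
             (u2 * u1 powr \<theta> - u1 * u2 powr \<theta>) * 0 - (u2 powr \<theta> - u1 powr \<theta>) * 0)"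
            unfolding P_def using h2
            by (intro has_bochner_integral_diff has_bochner_integral_mult_right h1 h3) (auto simp: has_bochner_integral_iff)
          then have "(u2 - u1) * (\<integral>t. m n2 t * D t \<partial>lborel) = (\<integral>t. P t \<partial>lborel)"
            by (simp add: has_bochner_integral_iff)
          also have "\<dots> \<ge> 0"
          proof (rule integral_nonneg_AE)
            show "AE t in lborel. 0 \<le> P t"
              using DS AE_lborel_singleton[of t1] AE_lborel_singleton[of t2]
            proof eventually_elim
              case (elim t)
              show ?case
              proof (cases "0 < t")
                case True
                consider "t < t1" | "t1 < t" "t < t2" | "t2 < t" using elim by linarith
                then have "0 \<le> \<psi> (t powr \<delta>) * D t"
                proof cases
                  case 1
                  then have "t powr \<delta> \<le> u1" using True \<delta> by (auto simp: u1_def intro!: powr_mono2)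
                  then show ?thesis using elim(1) below[OF 1] True \<psi>_lo[of "t powr \<delta>"] by (intro mult_nonpos_nonpos) auto
                next
                  case 2
                  then have "t powr \<delta> \<le> u2" "u1 \<le> t powr \<delta>" using True 3 \<delta> by (auto simp: u1_def u2_def intro!: powr_mono2)
                  then show ?thesis using elim(1) inside[OF 2] True \<psi>_in[of "t powr \<delta>"] by (intro mult_nonneg_nonneg) auto
                next
                  case hi: 3
                  then have "u2 \<le> t powr \<delta>" using True 3 \<delta> by (auto simp: u2_def intro!: powr_mono2)
                  then show ?thesis using elim(1) above[OF hi] True \<psi>_hi[of "t powr \<delta>"] by (intro mult_nonpos_nonpos) auto
                qed
                then show ?thesis unfolding P by (rule mult_nonneg_nonneg[OF m0])
              qed (simp add: P_def m_def)
            qed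
          qed
          finally show ?thesis using u by (simp add: zero_le_mult_iff)
        qed
      qed
    qed
    then have "Gamma n2 * (j1 powr (1 - \<theta>) * j3 powr \<theta>) \<le> i2"
      using h2 by (simp add: has_bochner_integral_iff)
    then show ?thesis using i2 by (simp add: m_def j1_def j3_def ennreal_leI)
  qed
qed

section \<open>Moments of s-concave functions\<close>

lemma Gamma_falling_product:
  fixes q :: real
  assumes "real d < q"
  shows "Gamma q = Gamma (q - real d) * (\<Prod>k=1..d. q - real k)"
  using assms
proof (induction d)
  case (Suc d)
  have "Gamma (q - real (Suc d) + 1) = (q - real (Suc d)) * Gamma (q - real (Suc d))"
    using Suc.prems by (intro Gamma_plus1) (auto elim!: nonpos_Ints_cases)
  moreover have "q - real (Suc d) + 1 = q - real d" by simp
  ultimately show ?case using Suc by simp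
qed simp

text \<open>The normalisation for which the moments of the extremal function
  \<open>x \<mapsto> (1 + x\<^sub>1 + ... + x\<^sub>d) powr (1 / s)\<close> on the positive orthant do not depend on \<open>p\<close>.\<close>

definition moment_weight :: "real \<Rightarrow> nat \<Rightarrow> real \<Rightarrow> real" where
  "moment_weight s d p = (\<Prod>k=1..d. p + real k * s)"

lemma moment_weight_pos:
  assumes "s < 0" "- s * real d < p"
  shows "0 < moment_weight s d p"
  unfolding moment_weight_def
proof (rule prod_pos)
  fix k assume "k \<in> {1..d}"
  then have "s * real d \<le> s * real k" using assms(1) by (intro mult_left_mono_neg) auto
  then show "0 < p + real k * s" using assms(2) by (simp add: mult.commute)
qed

text \<open>The factor \<open>(- s) ^ d\<close> does not depend on \<open>p\<close> and drops out of log-concavity.\<close>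

lemma Gamma_moment_weight:
  assumes s: "s < 0" and p: "- s * real d < p"
  shows "Gamma (p / - s) = Gamma (p / - s - real d) * (moment_weight s d p / (- s) ^ d)"
proof -
  have "real d < p / - s" using s p by (simp add: field_simps)
  moreover have "(\<Prod>k=1..d. p / - s - real k) = (\<Prod>k=1..d. (p + real k * s) / - s)"
    using s by (intro prod.cong) (auto simp: field_simps)
  moreover have "\<dots> = moment_weight s d p / (- s) ^ d"
    unfolding moment_weight_def prod_dividef by simp
  ultimately show ?thesis using Gamma_falling_product[of d "p / - s"] by simp
qed

lemma nn_integral_scaleR:
  fixes H :: "'a::euclidean_space \<Rightarrow> ennreal"
  assumes [measurable]: "H \<in> borel_measurable borel" and t: "0 < t"
  shows "(\<integral>\<^sup>+y. H ((1 / t) *\<^sub>R y) \<partial>lborel) = ennreal (t ^ DIM('a)) * (\<integral>\<^sup>+x. H x \<partial>lborel)"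
  using t by (subst lborel_affine[of t 0]) (simp_all add: nn_integral_density nn_integral_distr nn_integral_cmult)

lemma s_concave_powr_convex:
  assumes f: "s_concave s f" and s: "s < 0" and m: "0 < m" "m < 1" and pos: "0 < f x" "0 < f y"
  shows "0 < f ((1 - m) *\<^sub>R x + m *\<^sub>R y)"
    and "f ((1 - m) *\<^sub>R x + m *\<^sub>R y) powr s \<le> (1 - m) * f x powr s + m * f y powr s"
proof -
  let ?L = "(1 - m) * f x powr s + m * f y powr s"
  have L: "0 < ?L" using m pos by (intro add_pos_pos) auto
  have le: "?L powr (1 / s) \<le> f ((1 - m) *\<^sub>R x + m *\<^sub>R y)"
    using f m pos unfolding s_concave_def by auto
  moreover have "0 < ?L powr (1 / s)" using L by simp
  ultimately show "0 < f ((1 - m) *\<^sub>R x + m *\<^sub>R y)" by linarith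
  have "f ((1 - m) *\<^sub>R x + m *\<^sub>R y) powr s \<le> (?L powr (1 / s)) powr s"
    using le L s by (intro powr_mono2') auto
  also have "\<dots> = ?L" using L s by (simp add: powr_powr)
  finally show "f ((1 - m) *\<^sub>R x + m *\<^sub>R y) powr s \<le> ?L" .
qed

text \<open>Let \<open>g = f powr s\<close>, a convex function on the set where \<open>f\<close> is positive. The function
  \<open>t * g (y / t)\<close> is jointly convex in \<open>t\<close> and \<open>y\<close>, hence \<open>K t\<close>, the integral of \<open>exp (- t * g (y / t))\<close> over
  \<open>y\<close>, is log-concave by Prekopa--Leindler. Substituting \<open>y = t * x\<close> and integrating over \<open>t\<close> first, the
  moment of order \<open>p / - s - d\<close> of \<open>K\<close> is \<open>Gamma (p / - s)\<close> times the integral of \<open>f powr p\<close>, so that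
  \<open>Borell_moment_comparison\<close> applies; the quotient of Gamma values is \<open>moment_weight\<close> up to a constant.\<close>

theorem s_concave_moment_log_concave:
  fixes f :: "'a::euclidean_space \<Rightarrow> real"
  assumes f: "s_concave s f" and [measurable]: "f \<in> borel_measurable borel" and s: "s < 0"
    and p: "- s * real DIM('a) < p1" "p1 < p2" "p2 < p3" and \<theta>: "p2 = (1 - \<theta>) * p1 + \<theta> * p3"
    and j1: "0 < j1" "(\<integral>\<^sup>+x. ennreal (f x powr p1) \<partial>lborel) = ennreal j1"
    and j3: "0 < j3" "(\<integral>\<^sup>+x. ennreal (f x powr p3) \<partial>lborel) = ennreal j3"
  shows "ennreal ((moment_weight s DIM('a) p1 * j1) powr (1 - \<theta>) * (moment_weight s DIM('a) p3 * j3) powr \<theta>) \<le>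
    ennreal (moment_weight s DIM('a) p2) * (\<integral>\<^sup>+x. ennreal (f x powr p2) \<partial>lborel)"
proof -
  let ?d = "DIM('a)"
  define F where "F t y = (if 0 < f ((1 / t) *\<^sub>R y) then ennreal (exp (- (t * f ((1 / t) *\<^sub>R y) powr s))) else 0)" for t :: real and y :: 'a
  have [measurable]: "(\<lambda>(t, y). F t y) \<in> borel_measurable (borel \<Otimes>\<^sub>M borel)"
    unfolding F_def by measurable
  define K where "K t = (\<integral>\<^sup>+y. F t y \<partial>lborel)" for t
  have [measurable]: "K \<in> borel_measurable borel" unfolding K_def by measurable
  have lc: "K t0 powe (1 - l) * K t1 powe l \<le> K ((1 - l) * t0 + l * t1)" if t: "0 < t0" "0 < t1" and l: "0 < l" "l < 1" for t0 t1 l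
    unfolding K_def
  proof (rule Prekopa_Leindler[OF _ _ _ l])
    fix y0 y1 :: 'a
    define t where "t = (1 - l) * t0 + l * t1"
    have t_pos: "0 < t" unfolding t_def using t l by (intro add_pos_pos) auto
    show "F t0 y0 powe (1 - l) * F t1 y1 powe l \<le> F ((1 - l) * t0 + l * t1) ((1 - l) *\<^sub>R y0 + l *\<^sub>R y1)"
    proof (cases "0 < f ((1 / t0) *\<^sub>R y0) \<and> 0 < f ((1 / t1) *\<^sub>R y1)")
      case False then show ?thesis using l by (auto simp: F_def)
    next
      case True
      define x0 x1 where "x0 = (1 / t0) *\<^sub>R y0" and "x1 = (1 / t1) *\<^sub>R y1"
      \<comment> \<open>\<open>y / t\<close> at the mixed point is the convex combination of \<open>x0\<close> and \<open>x1\<close> with weight \<open>m\<close>.\<close>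
      define m where "m = l * t1 / t"
      have m1: "1 - m = (1 - l) * t0 / t" using t_pos by (simp add: m_def field_simps) (simp add: t_def algebra_simps)
      have m: "0 < m" "m < 1"
      proof -
        show "0 < m" using l t t_pos by (simp add: m_def)
        have "0 < 1 - m" unfolding m1 using l t t_pos by simp
        then show "m < 1" by simp
      qed
      have x: "(1 / t) *\<^sub>R ((1 - l) *\<^sub>R y0 + l *\<^sub>R y1) = (1 - m) *\<^sub>R x0 + m *\<^sub>R x1"
        unfolding m1 using t t_pos by (simp add: m_def x0_def x1_def scaleR_add_right)
      note sc = s_concave_powr_convex[OF f s m True[THEN conjunct1] True[THEN conjunct2], folded x0_def x1_def, folded x]
      have "t * f ((1 / t) *\<^sub>R ((1 - l) *\<^sub>R y0 + l *\<^sub>R y1)) powr s \<le> t * ((1 - m) * f x0 powr s + m * f x1 powr s)"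
        using sc(2) t_pos by (intro mult_left_mono) auto
      also have "\<dots> = t * (1 - m) * f x0 powr s + t * m * f x1 powr s" by (simp add: algebra_simps)
      also have "t * (1 - m) = (1 - l) * t0" unfolding m1 using t_pos by simp
      also have "t * m = l * t1" using t_pos by (simp add: m_def)
      finally have le: "t * f ((1 / t) *\<^sub>R ((1 - l) *\<^sub>R y0 + l *\<^sub>R y1)) powr s \<le> (1 - l) * t0 * f x0 powr s + l * t1 * f x1 powr s" .
      have "F t0 y0 powe (1 - l) * F t1 y1 powe l =
          ennreal (exp (- (t0 * f x0 powr s)) powr (1 - l) * exp (- (t1 * f x1 powr s)) powr l)"
        using True by (simp add: F_def x0_def[symmetric] x1_def[symmetric] powe_ennreal ennreal_mult')
      also have "exp (- (t0 * f x0 powr s)) powr (1 - l) * exp (- (t1 * f x1 powr s)) powr l =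
         exp (- ((1 - l) * t0 * f x0 powr s + l * t1 * f x1 powr s))"
        by (simp add: exp_powr_real exp_add[symmetric] algebra_simps)
      also have "ennreal \<dots> \<le> ennreal (exp (- (t * f ((1 / t) *\<^sub>R ((1 - l) *\<^sub>R y0 + l *\<^sub>R y1)) powr s)))"
        using le by (intro ennreal_leI) simp
      also have "\<dots> = F t ((1 - l) *\<^sub>R y0 + l *\<^sub>R y1)" using sc(1) by (simp add: F_def)
      finally show ?thesis by (simp add: t_def)
    qed
  qed measurable
  define J where "J p = (\<integral>\<^sup>+x. ennreal (f x powr p) \<partial>lborel)" for p
  have mom: "(\<integral>\<^sup>+t. ennreal (indicator {0<..} t * t powr (p / - s - real ?d - 1)) * K t \<partial>lborel) = ennreal (Gamma (p / - s)) * J p"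
    if p: "- s * real ?d < p" for p
  proof -
    have ppos: "0 < p" using p s by (metis less_trans mult_pos_pos neg_0_less_iff_less of_nat_0_less_iff DIM_positive)
    have q: "0 < p / - s" using ppos s by (simp add: field_simps)
    define G where "G t x = (if 0 < f x then ennreal (indicator {0<..} t * t powr (p / - s - 1) * exp (- (f x powr s) * t)) else 0)" for t x
    have [measurable]: "(\<lambda>(t, x). G t x) \<in> borel_measurable (borel \<Otimes>\<^sub>M borel)"
      unfolding G_def by measurable
    have "(\<integral>\<^sup>+t. ennreal (indicator {0<..} t * t powr (p / - s - real ?d - 1)) * K t \<partial>lborel) = (\<integral>\<^sup>+t. \<integral>\<^sup>+x. G t x \<partial>lborel \<partial>lborel)"
    proof (rule nn_integral_cong)
      fix t :: real
      show "ennreal (indicator {0<..} t * t powr (p / - s - real ?d - 1)) * K t = (\<integral>\<^sup>+x. G t x \<partial>lborel)"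
      proof (cases "0 < t")
        case True
        have "K t = ennreal (t ^ ?d) * (\<integral>\<^sup>+x. (if 0 < f x then ennreal (exp (- (t * f x powr s))) else 0) \<partial>lborel)"
          unfolding K_def F_def using True by (subst nn_integral_scaleR[symmetric]) auto
        then have "ennreal (indicator {0<..} t * t powr (p / - s - real ?d - 1)) * K t =
            (\<integral>\<^sup>+x. ennreal (t powr (p / - s - real ?d - 1) * t ^ ?d) * (if 0 < f x then ennreal (exp (- (t * f x powr s))) else 0) \<partial>lborel)"
          using True by (subst nn_integral_cmult) (auto simp: ennreal_mult mult.assoc)
        also have "t powr (p / - s - real ?d - 1) * t ^ ?d = t powr (p / - s - 1)"
          using True by (simp add: powr_realpow[symmetric] powr_add[symmetric])
        also have "(\<integral>\<^sup>+x. ennreal (t powr (p / - s - 1)) * (if 0 < f x then ennreal (exp (- (t * f x powr s))) else 0) \<partial>lborel) = (\<integral>\<^sup>+x. G t x \<partial>lborel)"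
          using True by (intro nn_integral_cong) (auto simp: G_def ennreal_mult'[symmetric] mult.commute)
        finally show ?thesis .
      qed (simp add: G_def cong: if_cong)
    qed
    also have "\<dots> = (\<integral>\<^sup>+x. \<integral>\<^sup>+t. G t x \<partial>lborel \<partial>lborel)"
      by (rule pair_sigma_finite.Fubini'[symmetric]) (auto intro!: pair_sigma_finite.intro sigma_finite_lborel)
    also have "\<dots> = (\<integral>\<^sup>+x. ennreal (Gamma (p / - s)) * ennreal (f x powr p) \<partial>lborel)"
    proof (rule nn_integral_cong)
      fix x :: 'a
      show "(\<integral>\<^sup>+t. G t x \<partial>lborel) = ennreal (Gamma (p / - s)) * ennreal (f x powr p)"
      proof (cases "0 < f x")
        case True
        have "(\<integral>\<^sup>+t. G t x \<partial>lborel) = ennreal (Gamma (p / - s) * (f x powr s) powr - (p / - s))"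
          using nn_integral_Gamma[OF q, of "f x powr s"] True by (simp add: G_def)
        also have "(f x powr s) powr - (p / - s) = f x powr p" using s by (simp add: powr_powr)
        finally show ?thesis using Gamma_real_pos[OF q] by (simp add: ennreal_mult')
      next
        case False
        then have "f x = 0" using f by (auto simp: s_concave_def order.antisym not_less)
        then show ?thesis by (simp add: G_def)
      qed
    qed
    finally show ?thesis by (simp add: nn_integral_cmult J_def)
  qed
  define n where "n p = p / - s - real ?d" for p
  have np: "0 < n p" if "- s * real ?d < p" for p using that s by (simp add: n_def field_simps)
  have p': "- s * real ?d < p2" "- s * real ?d < p3" using p by auto
  have nlt: "n p < n q" if "p < q" for p q
    using that s by (simp add: n_def divide_strict_right_mono_neg)
  have n\<theta>: "n p2 = (1 - \<theta>) * n p1 + \<theta> * n p3"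
    unfolding n_def \<theta> using s by (simp add: field_simps)
  have ratio: "Gamma (p / - s) * j / Gamma (n p) = moment_weight s ?d p * j / (- s) ^ ?d" if "- s * real ?d < p" for p j
    using Gamma_real_pos[OF np[OF that]] Gamma_moment_weight[OF s that] by (simp add: n_def)
  have Gq: "0 < Gamma (p / - s)" if "- s * real ?d < p" for p
    using np[OF that] by (intro Gamma_real_pos) (simp add: n_def)
  have "ennreal (Gamma (n p2) * ((Gamma (p1 / - s) * j1 / Gamma (n p1)) powr (1 - \<theta>) * (Gamma (p3 / - s) * j3 / Gamma (n p3)) powr \<theta>)) \<le>
      (\<integral>\<^sup>+t. ennreal (indicator {0<..} t * t powr (n p2 - 1)) * K t \<partial>lborel)"
  proof (rule Borell_moment_comparison[OF _ lc _ _ _ _ _ _ _ n\<theta>])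
    show "(\<integral>\<^sup>+t. ennreal (indicator {0<..} t * t powr (n p1 - 1)) * K t \<partial>lborel) = ennreal (Gamma (p1 / - s) * j1)"
      using mom[OF p(1)] j1 Gq[OF p(1)] by (simp add: n_def J_def ennreal_mult)
    show "(\<integral>\<^sup>+t. ennreal (indicator {0<..} t * t powr (n p3 - 1)) * K t \<partial>lborel) = ennreal (Gamma (p3 / - s) * j3)"
      using mom[OF p'(2)] j3 Gq[OF p'(2)] by (simp add: n_def J_def ennreal_mult)
  qed (use np nlt p p' Gq j1 j3 in auto)
  also have "\<dots> = ennreal (Gamma (p2 / - s)) * J p2" using mom[OF p'(1)] by (simp add: n_def)
  finally have main: "ennreal (Gamma (n p2) * ((moment_weight s ?d p1 * j1 / (- s) ^ ?d) powr (1 - \<theta>) * (moment_weight s ?d p3 * j3 / (- s) ^ ?d) powr \<theta>)) \<le> ennreal (Gamma (p2 / - s)) * J p2"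
    unfolding ratio[OF p(1)] ratio[OF p'(2)] .
  show ?thesis
  proof (cases "J p2 = \<top>")
    case True
    then show ?thesis using moment_weight_pos[OF s p'(1)] by (simp add: J_def[symmetric] ennreal_mult_top)
  next
    case False
    then obtain j2 where j2: "0 \<le> j2" "J p2 = ennreal j2" by (cases "J p2") auto
    define \<sigma> where "\<sigma> = (- s) ^ ?d"
    have \<sigma>: "0 < \<sigma>" using s by (simp add: \<sigma>_def)
    have W: "0 < moment_weight s ?d p1" "0 < moment_weight s ?d p2" "0 < moment_weight s ?d p3"
      using moment_weight_pos[OF s] p p' by auto
    have "Gamma (n p2) * ((moment_weight s ?d p1 * j1 / \<sigma>) powr (1 - \<theta>) * (moment_weight s ?d p3 * j3 / \<sigma>) powr \<theta>) \<le> Gamma (p2 / - s) * j2"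
      using main j2 Gq[OF p'(1)] unfolding \<sigma>_def[symmetric] by (simp add: ennreal_mult[symmetric] less_imp_le)
    also have "\<dots> = Gamma (n p2) * (moment_weight s ?d p2 / \<sigma> * j2)"
      using Gamma_moment_weight[OF s p'(1)] by (simp add: n_def \<sigma>_def)
    finally have "(moment_weight s ?d p1 * j1 / \<sigma>) powr (1 - \<theta>) * (moment_weight s ?d p3 * j3 / \<sigma>) powr \<theta> \<le> moment_weight s ?d p2 / \<sigma> * j2"
      using Gamma_real_pos[OF np[OF p'(1)]] by (rule mult_left_le_imp_le)
    moreover have "(moment_weight s ?d p1 * j1 / \<sigma>) powr (1 - \<theta>) * (moment_weight s ?d p3 * j3 / \<sigma>) powr \<theta> =
      (moment_weight s ?d p1 * j1) powr (1 - \<theta>) * (moment_weight s ?d p3 * j3) powr \<theta> / \<sigma>"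
    proof -
      have "\<sigma> powr (1 - \<theta>) * \<sigma> powr \<theta> = \<sigma>" using \<sigma> by (simp add: powr_add[symmetric])
      then show ?thesis using W j1 j3 \<sigma> by (simp add: powr_divide)
    qed
    ultimately have "(moment_weight s ?d p1 * j1) powr (1 - \<theta>) * (moment_weight s ?d p3 * j3) powr \<theta> \<le> moment_weight s ?d p2 * j2"
      using \<sigma> by (simp add: divide_le_cancel field_simps)
    then show ?thesis using j2 W by (simp add: J_def[symmetric] ennreal_mult[symmetric] less_imp_le ennreal_leI)
  qed
qed

section \<open>The worst splitting is one half\<close>

definition binary_entropy :: "real \<Rightarrow> real" where
  "binary_entropy l = - (l * ln l) - (1 - l) * ln (1 - l)"

lemma tendsto_binary_entropy_0: "(binary_entropy \<longlongrightarrow> 0) (at_right 0)"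
proof -
  have "((\<lambda>l::real. l * ln l) \<longlongrightarrow> 0) (at_right 0)"
  proof -
    have "((\<lambda>x::real. - (ln x / x)) \<longlongrightarrow> 0) at_top"
      using tendsto_minus[OF ln_x_over_x_tendsto_0] by simp
    then have "((\<lambda>x::real. inverse x * ln (inverse x)) \<longlongrightarrow> 0) at_top"
      by (rule Lim_transform_eventually)
         (auto intro!: eventually_mono[OF eventually_gt_at_top[of 0]] simp: ln_inverse divide_inverse)
    then show ?thesis by (subst filterlim_at_right_to_top)
  qed
  moreover have "((\<lambda>l::real. (1 - l) * ln (1 - l)) \<longlongrightarrow> (1 - 0) * ln (1 - 0)) (at_right 0)"
    by (intro tendsto_intros) auto
  ultimately have "((\<lambda>l::real. - (l * ln l) - (1 - l) * ln (1 - l)) \<longlongrightarrow> - 0 - (1 - 0) * ln (1 - 0)) (at_right 0)"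
    by (intro tendsto_diff tendsto_minus)
  then show ?thesis by (simp add: binary_entropy_def[abs_def])
qed

lemma binary_entropy_DERIV:
  assumes "0 < l" "l < 1"
  shows "(binary_entropy has_real_derivative ln (1 - l) - ln l) (at l)"
  unfolding binary_entropy_def[abs_def]
  by (rule derivative_eq_intros refl | use assms in force)+

lemma binary_entropy_half: "binary_entropy (1 / 2) = ln 2"
  by (simp add: binary_entropy_def ln_div)

text \<open>The mean value form of the monotone rule of l'Hospital. The function
  \<open>Q l = D (1 / 2) * binary_entropy l - ln 2 * D l\<close> vanishes at 0 and at 1/2, and \<open>Q'\<close> vanishes at 1/2. By
  monotonicity \<open>l * (1 - l) * Q'' l\<close> increases on \<open>(0, 1/2)\<close>. A negative value of \<open>Q\<close> would make \<open>Q'\<close> negative,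
  then positive, then zero from left to right, hence \<open>Q''\<close> positive and later negative.\<close>

lemma second_difference_le_entropy:
  fixes e e1 e2 :: "real \<Rightarrow> real"
  assumes c: "0 < c"
    and e1: "\<And>x. 0 \<le> x \<Longrightarrow> x \<le> c \<Longrightarrow> (e has_real_derivative e1 x) (at x)"
    and e2: "\<And>x. 0 \<le> x \<Longrightarrow> x \<le> c \<Longrightarrow> (e1 has_real_derivative e2 x) (at x)"
    and mono: "\<And>l k. 0 < l \<Longrightarrow> l < k \<Longrightarrow> k < 1 / 2 \<Longrightarrow>
      k * (1 - k) * (e2 (k * c) + e2 ((1 - k) * c)) \<le> l * (1 - l) * (e2 (l * c) + e2 ((1 - l) * c))"
    and D: "\<And>l. D l = e (l * c) + e ((1 - l) * c) - e 0 - e c"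
    and l: "0 < l" "l < 1"
  shows "D l * ln 2 \<le> D (1 / 2) * binary_entropy l"
proof -
  define Q where "Q l = D (1 / 2) * binary_entropy l - ln 2 * D l" for l
  define Q1 where "Q1 l = D (1 / 2) * (ln (1 - l) - ln l) - ln 2 * (c * (e1 (l * c) - e1 ((1 - l) * c)))" for l
  define Q2 where "Q2 l = D (1 / 2) * (- 1 / (1 - l) - 1 / l) - ln 2 * (c * (c * (e2 (l * c) + e2 ((1 - l) * c))))" for l
  have in0: "0 \<le> l * c" "l * c \<le> c" "0 \<le> (1 - l) * c" "(1 - l) * c \<le> c" if "0 \<le> l" "l \<le> 1" for l
    using that c by (auto simp: mult_left_le_one_le mult_le_cancel_right1)
  have inner: "((\<lambda>l. l * c) has_real_derivative c) (at l)" "((\<lambda>l. (1 - l) * c) has_real_derivative - c) (at l)" for l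
    by (auto intro!: derivative_eq_intros)
  have dD: "(D has_real_derivative c * (e1 (l * c) - e1 ((1 - l) * c))) (at l)" if "0 \<le> l" "l \<le> 1" for l
  proof -
    have "((\<lambda>l. e (l * c) + e ((1 - l) * c) - e 0 - e c) has_real_derivative e1 (l * c) * c + e1 ((1 - l) * c) * - c - 0 - 0) (at l)"
      by (intro DERIV_diff DERIV_add DERIV_const DERIV_chain2[OF e1 inner(1)] DERIV_chain2[OF e1 inner(2)] in0 that)
    then show ?thesis unfolding D[abs_def] by (simp add: algebra_simps)
  qed
  have dQ: "(Q has_real_derivative Q1 l) (at l)" if "0 < l" "l < 1" for l
    unfolding Q_def[abs_def] Q1_def
    by (rule DERIV_diff DERIV_cmult binary_entropy_DERIV dD that less_imp_le)+
  have dQ1: "(Q1 has_real_derivative Q2 l) (at l)" if "0 < l" "l < 1" for l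
    unfolding Q1_def[abs_def] Q2_def
  proof (intro DERIV_diff DERIV_cmult)
    show "((\<lambda>l. ln (1 - l)) has_real_derivative - 1 / (1 - l)) (at l)"
      by (rule derivative_eq_intros refl | use that in force)+
    show "(ln has_real_derivative 1 / l) (at l)" using that by (auto intro!: derivative_eq_intros)
    have "((\<lambda>l. e1 (l * c) - e1 ((1 - l) * c)) has_real_derivative e2 (l * c) * c - e2 ((1 - l) * c) * - c) (at l)"
      by (intro DERIV_diff DERIV_chain2[OF e2 inner(1)] DERIV_chain2[OF e2 inner(2)] in0 less_imp_le that)
    then show "((\<lambda>l. e1 (l * c) - e1 ((1 - l) * c)) has_real_derivative c * (e2 (l * c) + e2 ((1 - l) * c))) (at l)"
      by (simp add: algebra_simps)
  qed
  have Q2_eq: "l * (1 - l) * Q2 l = - D (1 / 2) - ln 2 * c\<^sup>2 * (l * (1 - l) * (e2 (l * c) + e2 ((1 - l) * c)))"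
    if "0 < l" "l < 1" for l
    unfolding Q2_def using that by (simp add: field_simps power2_eq_square)
  have Q2_sign: "Q2 l < 0" if "0 < l" "l < k" "k < 1 / 2" "Q2 k < 0" for l k
  proof -
    have "l * (1 - l) * Q2 l \<le> k * (1 - k) * Q2 k"
      using Q2_eq[of l] Q2_eq[of k] mult_left_mono[OF mono[OF that(1,2,3)], of "ln 2 * c\<^sup>2"] that by simp
    also have "\<dots> < 0" using that by (intro mult_pos_neg) auto
    finally show ?thesis using that by (simp add: mult_less_0_iff)
  qed
  have main: "0 \<le> Q x" if x: "0 < x" "x < 1 / 2" for x
  proof (rule ccontr)
    assume "\<not> 0 \<le> Q x"
    then have neg: "Q x < 0" by simp
    have "(D \<longlongrightarrow> D 0) (at_right 0)"
      using DERIV_isCont[OF dD[of 0]] by (simp add: isCont_def filterlim_at_split)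
    then have "(Q \<longlongrightarrow> D (1 / 2) * 0 - ln 2 * D 0) (at_right 0)"
      unfolding Q_def[abs_def] by (intro tendsto_diff tendsto_mult tendsto_const tendsto_binary_entropy_0)
    then have "(Q \<longlongrightarrow> 0) (at_right 0)" by (simp add: D)
    then have "eventually (\<lambda>y. Q x < Q y) (at_right 0)" using neg by (rule order_tendstoD)
    then obtain b where b: "0 < b" "\<And>y. 0 < y \<Longrightarrow> y < b \<Longrightarrow> Q x < Q y"
      by (auto simp: eventually_at_right[OF x(1)])
    \<comment> \<open>The entropy is not differentiable at 0, so the mean value theorem starts at a small \<open>x0\<close> instead.\<close>
    define x0 where "x0 = min (b / 2) (x / 2)"
    have x0: "0 < x0" "x0 < x" "Q x < Q x0" using b x by (auto simp: x0_def)
    obtain x1 where x1: "x0 < x1" "x1 < x" "Q x - Q x0 = (x - x0) * Q1 x1"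
      using MVT2[OF x0(2), of Q Q1] dQ x0(1) x by auto
    have Qh: "Q (1 / 2) = 0" by (simp add: Q_def binary_entropy_half)
    obtain x2 where x2: "x < x2" "x2 < 1 / 2" "Q (1 / 2) - Q x = (1 / 2 - x) * Q1 x2"
      using MVT2[OF x(2), of Q Q1] dQ x by auto
    have s1: "Q1 x1 < 0"
    proof (rule ccontr)
      assume "\<not> Q1 x1 < 0"
      then have "0 \<le> (x - x0) * Q1 x1" using x0 by (intro mult_nonneg_nonneg) auto
      with x1 x0 show False by simp
    qed
    have s2: "0 < Q1 x2"
    proof (rule ccontr)
      assume "\<not> 0 < Q1 x2"
      then have "(1 / 2 - x) * Q1 x2 \<le> 0" using x by (intro mult_nonneg_nonpos) auto
      with x2(3) neg Qh show False by linarith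
    qed
    have Q1h: "Q1 (1 / 2) = 0" by (simp add: Q1_def)
    have x12: "x1 < x2" using x1 x2 by simp
    obtain x3 where x3: "x1 < x3" "x3 < x2" "Q1 x2 - Q1 x1 = (x2 - x1) * Q2 x3"
      using MVT2[OF x12, of Q1 Q2] dQ1 x0 x1 x2 by auto
    obtain x4 where x4: "x2 < x4" "x4 < 1 / 2" "Q1 (1 / 2) - Q1 x2 = (1 / 2 - x2) * Q2 x4"
      using MVT2[OF x2(2), of Q1 Q2] dQ1 x x2 by auto
    have "0 < Q2 x3"
    proof (rule ccontr)
      assume "\<not> 0 < Q2 x3"
      then have "(x2 - x1) * Q2 x3 \<le> 0" using x12 by (intro mult_nonneg_nonpos) auto
      with x3 s1 s2 show False by simp
    qed
    moreover have "Q2 x4 < 0"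
    proof (rule ccontr)
      assume "\<not> Q2 x4 < 0"
      then have "0 \<le> (1 / 2 - x2) * Q2 x4" using x2 by (intro mult_nonneg_nonneg) auto
      with x4(3) s2 Q1h show False by linarith
    qed
    ultimately show False using Q2_sign[of x3 x4] x0 x1 x3 x4 by simp
  qed
  have sym: "Q (1 - l) = Q l" for l by (simp add: Q_def D binary_entropy_def algebra_simps)
  consider "l < 1 / 2" | "l = 1 / 2" | "1 / 2 < l" by linarith
  then have "0 \<le> Q l"
  proof cases
    case 1 then show ?thesis using main l by simp
  next
    case 2 then show ?thesis unfolding Q_def 2 binary_entropy_half by simp
  next
    case 3 then show ?thesis using main[of "1 - l"] l by (simp add: sym)
  qed
  then show ?thesis by (simp add: Q_def mult.commute)
qed

text \<open>The sums of reciprocals at \<open>l * c\<close> and \<open>(1 - l) * c\<close> have this form in \<open>v = l * (1 - l)\<close>.\<close>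

lemma mobius_mono:
  fixes A P e v w :: real
  assumes "0 \<le> A" "0 < P" "0 \<le> e" "0 < v" "v < w"
  shows "v * (A / (P + e * v)) \<le> w * (A / (P + e * w))"
proof -
  have p: "0 < P + e * v" "0 < P + e * w" using assms by (auto intro!: add_pos_nonneg)
  have "v * A * (P + e * w) \<le> w * A * (P + e * v)"
  proof -
    have "0 \<le> A * P * (w - v)" using assms by simp
    then show ?thesis by (simp add: algebra_simps)
  qed
  then show ?thesis using p by (simp add: field_simps)
qed

text \<open>In terms of \<open>a = 1 / (P + e * v)\<close> the expression is a concave quadratic polynomial, so it
  increases with \<open>v\<close> where \<open>a\<close> is to the right of the vertex. At \<open>v = 1/4\<close>, the smallest \<open>a\<close>, this means
  \<open>0 \<le> (2 * P - e) * (4 * P + e)\<close>. The hypothesis \<open>e \<le> 2 * P\<close> is what becomes \<open>y\<^sup>2 + 2 * y \<le> 2\<close> in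
  the application.\<close>

lemma inverse_square_sum_mono:
  fixes P e v w :: real
  assumes P: "0 < P" "0 < e" "e \<le> 2 * P" and w: "0 < v" "v < w" "w \<le> 1 / 4"
  shows "v * ((2 * P + e - 2 * e * v) / (P + e * v)\<^sup>2) \<le> w * ((2 * P + e - 2 * e * w) / (P + e * w)\<^sup>2)"
proof -
  have form: "x * ((2 * P + e - 2 * e * x) / (P + e * x)\<^sup>2) =
     (- 2 + (6 * P + e) * inverse (P + e * x) - P * (4 * P + e) * (inverse (P + e * x))\<^sup>2) / e" if "0 < x" for x
  proof -
    have z: "0 < P + e * x" using P that by (simp add: add_pos_pos)
    have gen: "(y - P) / e * ((4 * P + e - 2 * y) / y\<^sup>2) =
      (- 2 + (6 * P + e) * inverse y - P * (4 * P + e) * (inverse y)\<^sup>2) / e" if "0 < y" for y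
      using that P(2) by (simp add: field_simps power2_eq_square)
    have "x = ((P + e * x) - P) / e" using P by simp
    moreover have "2 * P + e - 2 * e * x = 4 * P + e - 2 * (P + e * x)" by (simp add: algebra_simps)
    ultimately have "x * ((2 * P + e - 2 * e * x) / (P + e * x)\<^sup>2) =
      ((P + e * x) - P) / e * ((4 * P + e - 2 * (P + e * x)) / (P + e * x)\<^sup>2)" by (simp only:)
    then show ?thesis unfolding gen[OF z] .
  qed
  define a b where "a = inverse (P + e * v)" and "b = inverse (P + e * w)"
  have pv: "0 < P + e * v" "0 < P + e * w" using P w by (auto intro!: add_pos_pos)
  have ba: "b < a" unfolding a_def b_def using pv P w by (intro less_imp_inverse_less) auto
  have bb: "6 * P + e \<le> 2 * (P * (4 * P + e)) * b"
  proof -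
    have "(P + e * w) * (6 * P + e) \<le> (P + e / 4) * (6 * P + e)"
      using P w by (intro mult_right_mono) auto
    also have "\<dots> \<le> 2 * (P * (4 * P + e))"
    proof -
      have "0 \<le> (2 * P - e) * (4 * P + e)" using P by (intro mult_nonneg_nonneg) auto
      then show ?thesis by (simp add: algebra_simps)
    qed
    finally show ?thesis using pv by (simp add: b_def field_simps)
  qed
  have "P * (4 * P + e) * b \<le> P * (4 * P + e) * a" using ba P by (intro mult_left_mono) auto
  with bb have "0 \<le> (a - b) * (P * (4 * P + e) * (a + b) - (6 * P + e))"
    using ba by (intro mult_nonneg_nonneg) (auto simp: algebra_simps)
  then have "(6 * P + e) * a - P * (4 * P + e) * a\<^sup>2 \<le> (6 * P + e) * b - P * (4 * P + e) * b\<^sup>2"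
    by (simp add: algebra_simps power2_eq_square)
  then show ?thesis
    using P w unfolding form[OF w(1)] form[OF less_trans[OF w(1,2)]] a_def[symmetric] b_def[symmetric]
    by (intro divide_right_mono) auto
qed

definition deficit_potential :: "real \<Rightarrow> nat \<Rightarrow> real \<Rightarrow> real" where
  "deficit_potential s d x =
     2 / real d * (\<Sum>k=1..d. (1 + x) * ln (1 + real k * s * (1 + x))) - (1 + x) * ln (1 + x)"

text \<open>\<open>binary_entropy l - deficit s d c l / c\<close> is the constant in the lower bound for the entropy
  power of a sum with the splitting \<open>l\<close> (\<open>young_const_moment_weight_exponent\<close>).\<close>

definition deficit :: "real \<Rightarrow> nat \<Rightarrow> real \<Rightarrow> real \<Rightarrow> real" where
  "deficit s d c l = deficit_potential s d (l * c) + deficit_potential s d ((1 - l) * c)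
     - deficit_potential s d 0 - deficit_potential s d c"

text \<open>Each summand of \<open>l * (1 - l)\<close> times the second derivative is monotone in \<open>l * (1 - l)\<close>. For the
  squares of the reciprocals this uses \<open>y = a * c / b \<le> sqrt 3 - 1\<close> where \<open>a = - k * s\<close> and \<open>b = 1 - a\<close>;
  the case \<open>k = d\<close> is the worst one and is the hypothesis on \<open>c\<close>.\<close>

lemma deficit_le_entropy:
  assumes d: "0 < d" and s: "- 1 / real d < s" "s < 0"
    and c: "0 < c" "c \<le> (sqrt 3 - 1) * (- 1 - 1 / (s * real d))"
    and l: "0 < l" "l < 1"
  shows "deficit s d c l * ln 2 \<le> deficit s d c (1 / 2) * binary_entropy l"
proof -
  define U where "U k x = 1 + real k * s * (1 + x)" for k x
  define e1 where "e1 x = 2 / real d * (\<Sum>k=1..d. ln (U k x) + (1 + x) * (real k * s) / U k x) - (ln (1 + x) + 1)" for x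
  define e2 where "e2 x = 2 / real d * (\<Sum>k=1..d. real k * s * (1 / U k x + 1 / (U k x)\<^sup>2)) - 1 / (1 + x)" for x
  have A: "0 < - s * real d" "- s * real d < 1" using s d by (auto simp: field_simps mult_neg_pos)
  have s3: "1 < sqrt 3" "sqrt 3 < 2" by (auto intro: real_less_rsqrt real_less_lsqrt)
  have ac: "- (real k * s) * c \<le> (sqrt 3 - 1) * (1 + real k * s)" "0 < - (real k * s)" "- (real k * s) < 1" if k: "k \<in> {1..d}" for k
  proof -
    have "- s * real k \<le> - s * real d" using k s by (intro mult_left_mono) auto
    then have ka: "- (real k * s) \<le> - s * real d" by (simp add: mult.commute)
    show "0 < - (real k * s)" using k s by (auto simp: mult_pos_neg)
    show "- (real k * s) < 1" using ka A by linarith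
    have "- (real k * s) * c \<le> (- s * real d) * c" using ka c by (intro mult_right_mono) auto
    also have "\<dots> \<le> (- s * real d) * ((sqrt 3 - 1) * (- 1 - 1 / (s * real d)))" using c A by (intro mult_left_mono) auto
    also have "\<dots> = (sqrt 3 - 1) * (1 - - s * real d)" using s d by (simp add: field_simps)
    also have "\<dots> \<le> (sqrt 3 - 1) * (1 - - (real k * s))" using ka s3 by (intro mult_left_mono) auto
    finally show "- (real k * s) * c \<le> (sqrt 3 - 1) * (1 + real k * s)" by simp
  qed
  have U_pos: "0 < U k x" if "k \<in> {1..d}" "0 \<le> x" "x \<le> c" for k x
  proof -
    have "- (real k * s) * x \<le> - (real k * s) * c" using ac(2)[OF that(1)] that by (intro mult_left_mono) auto
    also note ac(1)[OF that(1)]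
    also have "(sqrt 3 - 1) * (1 + real k * s) < 1 * (1 + real k * s)"
      using ac(3)[OF that(1)] s3 by (intro mult_strict_right_mono) auto
    finally show ?thesis by (simp add: U_def algebra_simps)
  qed
  show ?thesis
  proof (rule second_difference_le_entropy[where e = "deficit_potential s d" and ?e1.0 = e1 and ?e2.0 = e2 and c = c])
    fix x assume x: "0 \<le> x" "x \<le> c"
    show "(deficit_potential s d has_real_derivative e1 x) (at x)"
    proof -
      have "((\<lambda>x. (1 + x) * ln (U k x)) has_real_derivative ln (U k x) + (1 + x) * (real k * s) / U k x) (at x)" if "k \<in> {1..d}" for k
        unfolding U_def by (rule derivative_eq_intros refl | use U_pos[OF that x] in \<open>force simp: U_def\<close>)+
      then have "((\<lambda>x. 2 / real d * (\<Sum>k=1..d. (1 + x) * ln (U k x)) - (1 + x) * ln (1 + x)) has_real_derivative e1 x) (at x)"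
        unfolding e1_def using x
        by (intro DERIV_diff DERIV_cmult DERIV_sum) (auto intro!: derivative_eq_intros)
      then show ?thesis unfolding deficit_potential_def[abs_def] U_def .
    qed
    show "(e1 has_real_derivative e2 x) (at x)"
    proof -
      have "((\<lambda>x. ln (U k x) + (1 + x) * (real k * s) / U k x) has_real_derivative real k * s * (1 / U k x + 1 / (U k x)\<^sup>2)) (at x)" if k: "k \<in> {1..d}" for k
      proof -
        define a where "a = real k * s"
        have u: "0 < 1 + a * (1 + x)" using U_pos[OF k x] by (simp add: U_def a_def)
        have dU: "((\<lambda>x. 1 + a * (1 + x)) has_real_derivative a) (at x)" by (auto intro!: derivative_eq_intros)
        have dV: "((\<lambda>x. (1 + x) * a) has_real_derivative a) (at x)" by (auto intro!: derivative_eq_intros)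
        have "((\<lambda>x. ln (1 + a * (1 + x)) + (1 + x) * a / (1 + a * (1 + x))) has_real_derivative
           inverse (1 + a * (1 + x)) * a + (a * (1 + a * (1 + x)) - (1 + x) * a * a) / ((1 + a * (1 + x)) * (1 + a * (1 + x)))) (at x)"
          using u by (intro DERIV_add DERIV_chain2[OF DERIV_ln dU] DERIV_divide dU dV) auto
        moreover have "a * (1 + a * (1 + x)) - (1 + x) * a * a = a" by (simp add: algebra_simps)
        moreover have "inverse y * a + a / (y * y) = a * (1 / y + 1 / y\<^sup>2)" for y :: real
          by (simp add: divide_inverse power2_eq_square distrib_left mult.commute)
        ultimately show ?thesis unfolding U_def a_def[symmetric] by (simp only:)
      qed
      then show ?thesis
        unfolding e1_def[abs_def] e2_def using x
        by (intro DERIV_diff DERIV_cmult DERIV_sum) (auto intro!: derivative_eq_intros)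
    qed
  next
    fix l k :: real assume lk: "0 < l" "l < k" "k < 1 / 2"
    define w where "w x = x * (1 - x)" for x :: real
    have w: "0 < w l" "w l < w k" "w k \<le> 1 / 4"
    proof -
      show "0 < w l" using lk by (simp add: w_def)
      have "0 < (k - l) * (1 - k - l)" using lk by (intro mult_pos_pos) auto
      then show "w l < w k" by (simp add: w_def algebra_simps)
      have "0 \<le> (1 - 2 * k)\<^sup>2" by simp
      then show "w k \<le> 1 / 4" by (simp add: w_def power2_eq_square algebra_simps)
    qed
    have e2_sum: "w x * (e2 (x * c) + e2 ((1 - x) * c)) = 2 / real d *
        (\<Sum>j=1..d. real j * s * (w x * (1 / U j (x * c) + 1 / U j ((1 - x) * c)) + w x * (1 / (U j (x * c))\<^sup>2 + 1 / (U j ((1 - x) * c))\<^sup>2)))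
        - w x * (1 / (1 + x * c) + 1 / (1 + (1 - x) * c))" for x
      unfolding e2_def by (simp add: sum_distrib_left sum.distrib[symmetric] algebra_simps)
    have f1: "w x * (1 / (1 + x * c) + 1 / (1 + (1 - x) * c)) = w x * ((2 + c) / ((1 + c) + c\<^sup>2 * w x))" if "0 < x" "x < 1" for x
    proof -
      have p: "0 < 1 + x * c" "0 < 1 + (1 - x) * c" using that c by (auto intro!: add_pos_pos)
      have "(1 + x * c) * (1 + (1 - x) * c) = (1 + c) + c\<^sup>2 * w x" by (simp add: w_def power2_eq_square algebra_simps)
      moreover have "(1 + x * c) + (1 + (1 - x) * c) = 2 + c" by (simp add: algebra_simps)
      moreover have "1 / (1 + x * c) + 1 / (1 + (1 - x) * c) = ((1 + x * c) + (1 + (1 - x) * c)) / ((1 + x * c) * (1 + (1 - x) * c))"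
        using p by (simp add: add_frac_eq)
      ultimately show ?thesis by simp
    qed
    have m1: "w l * (1 / (1 + l * c) + 1 / (1 + (1 - l) * c)) \<le> w k * (1 / (1 + k * c) + 1 / (1 + (1 - k) * c))"
      using f1[of l] f1[of k] lk mobius_mono[of "2 + c" "1 + c" "c\<^sup>2" "w l" "w k"] c w by simp
    have m2: "real j * s * (w k * (1 / U j (k * c) + 1 / U j ((1 - k) * c)) + w k * (1 / (U j (k * c))\<^sup>2 + 1 / (U j ((1 - k) * c))\<^sup>2)) \<le>
       real j * s * (w l * (1 / U j (l * c) + 1 / U j ((1 - l) * c)) + w l * (1 / (U j (l * c))\<^sup>2 + 1 / (U j ((1 - l) * c))\<^sup>2))"
      if j: "j \<in> {1..d}" for j
    proof (rule mult_left_mono_neg)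
      define a b where "a = - (real j * s)" and "b = 1 + real j * s"
      have ab: "0 < a" "a * c \<le> (sqrt 3 - 1) * b" "0 < b" "b = 1 - a"
        using ac[OF j] by (auto simp: a_def b_def)
      have bac: "0 < b - a * c"
      proof -
        have "(sqrt 3 - 1) * b < 1 * b" using ab s3 by (intro mult_strict_right_mono) auto
        with ab(2) show ?thesis by linarith
      qed
      define P e where "P = b * (b - a * c)" and "e = (a * c)\<^sup>2"
      have Pe: "0 < P" "0 < e" using ab bac c by (auto simp: P_def e_def)
      have "(a * c + b)\<^sup>2 \<le> (sqrt 3 * b)\<^sup>2"
      proof (rule power_mono)
        show "a * c + b \<le> sqrt 3 * b" using ab(2) unfolding left_diff_distrib by linarith
        show "0 \<le> a * c + b" using ab c by simp
      qed
      then have eP: "e \<le> 2 * P" by (simp add: e_def P_def power2_eq_square algebra_simps)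
      have Ux: "U j (x * c) = b - a * c * x" "U j ((1 - x) * c) = b - a * c * (1 - x)" for x
        by (simp_all add: U_def a_def b_def algebra_simps)
      have Upos: "0 < U j (x * c)" "0 < U j ((1 - x) * c)" if "0 < x" "x < 1" for x
        using that c by (auto intro!: U_pos[OF j] simp: mult_le_cancel_right1)
      have prod: "U j (x * c) * U j ((1 - x) * c) = P + e * w x" for x
        unfolding Ux P_def e_def w_def by (simp add: power2_eq_square algebra_simps)
      have sm: "U j (x * c) + U j ((1 - x) * c) = 2 * b - a * c" for x
        unfolding Ux by (simp add: algebra_simps)
      have g1: "1 / U j (x * c) + 1 / U j ((1 - x) * c) = (2 * b - a * c) / (P + e * w x)" if "0 < x" "x < 1" for x
        unfolding prod[symmetric] sm[of x, symmetric] using Upos[OF that] by (simp add: add_frac_eq)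
      have g2: "1 / (U j (x * c))\<^sup>2 + 1 / (U j ((1 - x) * c))\<^sup>2 = (2 * P + e - 2 * e * w x) / (P + e * w x)\<^sup>2" if "0 < x" "x < 1" for x
      proof -
        have "(U j (x * c))\<^sup>2 + (U j ((1 - x) * c))\<^sup>2 = (U j (x * c) + U j ((1 - x) * c))\<^sup>2 - 2 * (U j (x * c) * U j ((1 - x) * c))"
          by (simp add: power2_eq_square algebra_simps)
        also have "\<dots> = 2 * P + e - 2 * e * w x"
          unfolding prod sm by (simp add: P_def e_def power2_eq_square algebra_simps)
        finally have "2 * P + e - 2 * e * w x = (U j (x * c))\<^sup>2 + (U j ((1 - x) * c))\<^sup>2" ..
        then show ?thesis
          unfolding prod[symmetric] using Upos[OF that] by (simp add: power_mult_distrib add_frac_eq)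
      qed
      have "w l * ((2 * b - a * c) / (P + e * w l)) \<le> w k * ((2 * b - a * c) / (P + e * w k))"
        by (rule mobius_mono) (use Pe w bac ab in auto)
      moreover have "w l * ((2 * P + e - 2 * e * w l) / (P + e * w l)\<^sup>2) \<le> w k * ((2 * P + e - 2 * e * w k) / (P + e * w k)\<^sup>2)"
        by (rule inverse_square_sum_mono) (use Pe eP w in auto)
      ultimately show "w l * (1 / U j (l * c) + 1 / U j ((1 - l) * c)) + w l * (1 / (U j (l * c))\<^sup>2 + 1 / (U j ((1 - l) * c))\<^sup>2)
        \<le> w k * (1 / U j (k * c) + 1 / U j ((1 - k) * c)) + w k * (1 / (U j (k * c))\<^sup>2 + 1 / (U j ((1 - k) * c))\<^sup>2)"
        using lk by (simp add: g1 g2)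
      show "real j * s \<le> 0" using ac(2)[OF j] by simp
    qed
    have "w k * (e2 (k * c) + e2 ((1 - k) * c)) \<le> w l * (e2 (l * c) + e2 ((1 - l) * c))"
      unfolding e2_sum by (intro diff_mono mult_left_mono sum_mono m1 m2) auto
    then show "k * (1 - k) * (e2 (k * c) + e2 ((1 - k) * c)) \<le> l * (1 - l) * (e2 (l * c) + e2 ((1 - l) * c))"
      by (simp add: w_def)
  qed (use c l in \<open>auto simp: deficit_def\<close>)
qed

section \<open>The threshold and the exponent\<close>

lemma epi_alpha_eq_deficit:
  assumes d: "0 < d" and c: "0 < c"
  shows "epi_alpha s (1 / (1 + c)) d = inverse (1 - deficit s d c (1 / 2) / (c * ln 2))"
proof -
  define r where "r = 1 / (1 + c)"
  have r: "0 < r" "1 / r = 1 + c" "r * (1 + c) = 1" using c by (auto simp: r_def)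
  have h: "(r + 1) / (2 * r) = 1 + c / 2" using r by (simp add: field_simps)
  have lr: "ln r = - ln (1 + c)" unfolding r_def using c by (simp add: ln_div)
  have t1: "1 + real k * s / r = 1 + real k * s * (1 + c)" for k
    using r(2) by (metis divide_inverse inverse_eq_divide)
  have t2: "1 + real k * s * (r + 1) / (2 * r) = 1 + real k * s * (1 + c / 2)" for k
    using h by (metis times_divide_eq_right)
  have C: "(1 + c) * epi_C s r d = 2 / real d * (\<Sum>k=1..d. (1 + c) * ln (1 + real k * s * (1 + c)) + ln (1 + real k * s)
      - 2 * ((1 + c / 2) * ln (1 + real k * s * (1 + c / 2))))"
  proof -
    have "(1 + c) * (ln A + r * ln B - (r + 1) * ln D) = (1 + c) * ln A + ln B - 2 * ((1 + c / 2) * ln D)" for A B D :: real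
    proof -
      have "(1 + c) * (ln A + r * ln B - (r + 1) * ln D) =
        (1 + c) * ln A + (r * (1 + c)) * ln B - (r * (1 + c) + (1 + c)) * ln D" by (simp add: algebra_simps)
      then show ?thesis unfolding r(3) by (simp add: algebra_simps)
    qed
    then show ?thesis
      unfolding epi_C_def t1 t2 mult.left_commute[of "1 + c"] sum_distrib_left[of "1 + c"] by (simp only:)
  qed
  have "(1 + c) * (ln r + (r + 1) * ln ((r + 1) / (2 * r)) + epi_C s r d) =
      - (1 + c) * ln (1 + c) + (r * (1 + c) + (1 + c)) * ln (1 + c / 2) + (1 + c) * epi_C s r d"
    unfolding lr h by (simp add: algebra_simps)
  also have "\<dots> = - (1 + c) * ln (1 + c) + (2 + c) * ln (1 + c / 2) + 2 / real d * (\<Sum>k=1..d. (1 + c) * ln (1 + real k * s * (1 + c)) + ln (1 + real k * s)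
      - 2 * ((1 + c / 2) * ln (1 + real k * s * (1 + c / 2))))"
    unfolding C r(3) by simp
  also have "\<dots> = - deficit s d c (1 / 2)"
  proof -
    define S where "S x = (\<Sum>k=1..d. (1 + x) * ln (1 + real k * s * (1 + x)))" for x
    have "(\<Sum>k=1..d. (1 + c) * ln (1 + real k * s * (1 + c)) + ln (1 + real k * s)
      - 2 * ((1 + c / 2) * ln (1 + real k * s * (1 + c / 2)))) = S c + S 0 - 2 * S (c / 2)"
      unfolding S_def sum_distrib_left by (simp add: sum.distrib sum_subtractf)
    note sum_eq = this
    have pot: "deficit_potential s d x = 2 / real d * S x - (1 + x) * ln (1 + x)" for x
      by (simp add: deficit_potential_def S_def)
    have half: "1 / 2 * c = c / 2" "(1 - 1 / 2) * c = c / 2" by simp_all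
    show ?thesis unfolding sum_eq deficit_def pot half by (simp add: algebra_simps add_divide_distrib)
  qed
  finally have N: "(1 + c) * (ln r + (r + 1) * ln ((r + 1) / (2 * r)) + epi_C s r d) = - deficit s d c (1 / 2)" .
  have "(1 + c) * (1 - r) = c" using r(3) by (simp add: algebra_simps)
  then have "(ln r + (r + 1) * ln ((r + 1) / (2 * r)) + epi_C s r d) / ((1 - r) * ln 2) = - deficit s d c (1 / 2) / (c * ln 2)"
    unfolding N[symmetric] using c by (metis (no_types, lifting) add_pos_pos less_numeral_extra(1) mult.assoc mult_divide_mult_cancel_left order_less_irrefl)
  then show ?thesis unfolding epi_alpha_def r_def[symmetric] by simp
qed

text \<open>The terms \<open>(1 + x) * ln (1 + x)\<close> that come from \<open>young_const\<close> appear twice, with the opposite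
  sign, in \<open>moment_weight\<close> at \<open>1 / (1 + x)\<close>; this leaves them once, with a negative sign, as in
  \<open>deficit_potential\<close>.\<close>

lemma young_const_moment_weight_exponent:
  assumes d: "0 < d" and s: "s < 0" and c: "0 < c" and sc: "- s * real d * (1 + c) < 1" and l: "0 < l" "l < 1"
  shows "2 * ln (young_const c l) + 2 / real d *
      ((1 + c) * ln (moment_weight s d (1 / (1 + c))) + ln (moment_weight s d 1)
       - (1 + l * c) * ln (moment_weight s d (1 / (1 + l * c)))
       - (1 + (1 - l) * c) * ln (moment_weight s d (1 / (1 + (1 - l) * c)))) =
    c * binary_entropy l - deficit s d c l"
proof -
  define \<Psi> where "\<Psi> x = (\<Sum>k=1..d. (1 + x) * ln (1 + real k * s * (1 + x)))" for x
  define \<phi> where "\<phi> x = (1 + x) * ln (1 + x)" for x :: real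
  have e: "deficit_potential s d x = 2 / real d * \<Psi> x - \<phi> x" for x
    by (simp add: deficit_potential_def \<Psi>_def \<phi>_def)
  have W: "(1 + x) * ln (moment_weight s d (1 / (1 + x))) = \<Psi> x - real d * \<phi> x" if x: "0 \<le> x" "x \<le> c" for x
  proof -
    have pos: "0 < 1 + real k * s * (1 + x)" if "k \<in> {1..d}" for k
    proof -
      have "- s * real k * (1 + x) \<le> - s * real d * (1 + c)" using that s x by (intro mult_mono mult_left_mono) (auto simp: mult_nonpos_nonneg)
      then show ?thesis using sc by (simp add: algebra_simps)
    qed
    have eq: "1 / (1 + x) + real k * s = (1 + real k * s * (1 + x)) / (1 + x)" for k
      using x by (simp add: field_simps)
    have "ln (moment_weight s d (1 / (1 + x))) = (\<Sum>k=1..d. ln ((1 + real k * s * (1 + x)) / (1 + x)))"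
      unfolding moment_weight_def eq
    proof (rule ln_prod)
      show "(1 + real k * s * (1 + x)) / (1 + x) \<noteq> 0" if "k \<in> {1..d}" for k
        using pos[OF that] x by simp
    qed simp
    also have "\<dots> = (\<Sum>k=1..d. ln (1 + real k * s * (1 + x)) - ln (1 + x))"
    proof (rule sum.cong[OF refl])
      fix k assume "k \<in> {1..d}"
      from pos[OF this] x show "ln ((1 + real k * s * (1 + x)) / (1 + x)) = ln (1 + real k * s * (1 + x)) - ln (1 + x)"
        by (subst ln_div) auto
    qed
    finally show ?thesis by (simp add: \<Psi>_def \<phi>_def sum_subtractf right_diff_distrib sum_distrib_left)
  qed
  have lc: "0 \<le> l * c" "l * c \<le> c" "0 \<le> (1 - l) * c" "(1 - l) * c \<le> c"
    using l c by (auto simp: mult_le_cancel_right1)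
  have W1: "ln (moment_weight s d 1) = \<Psi> 0" using W[of 0] c by (simp add: \<phi>_def)
  have lnY: "2 * ln (young_const c l) = \<phi> c - \<phi> (l * c) - \<phi> ((1 - l) * c) + c * binary_entropy l"
  proof -
    have p: "0 < 1 + l * c" "0 < 1 + (1 - l) * c" using l c by (auto intro!: add_pos_pos)
    define m where "m = 1 - l"
    have m: "0 < m" using l by (simp add: m_def)
    define A B where "A = 1 + l * c" and "B = 1 + m * c"
    have AB: "0 < A" "0 < B" using p by (auto simp: A_def B_def m_def)
    have "ln (young_const c l) = ((1 + c) * ln (1 + c) - (l * c * ln l + A * ln A + (m * c * ln m + B * ln B))) / 2"
      unfolding young_const_def m_def[symmetric] unfolding A_def[symmetric] B_def[symmetric]
      using l c m AB by (simp add: ln_sqrt ln_div ln_mult ln_powr)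
    then show ?thesis unfolding \<phi>_def binary_entropy_def m_def[symmetric] unfolding A_def[symmetric] B_def[symmetric]
      by (simp add: algebra_simps)
  qed
  have "2 / real d * (X - real d * Y) = 2 / real d * X - 2 * Y" for X Y :: real
    using d by (simp add: field_simps)
  then have "2 / real d * ((\<Psi> c - real d * \<phi> c) + \<Psi> 0 - (\<Psi> (l * c) - real d * \<phi> (l * c)) - (\<Psi> ((1 - l) * c) - real d * \<phi> ((1 - l) * c))) =
     2 / real d * (\<Psi> c + \<Psi> 0 - \<Psi> (l * c) - \<Psi> ((1 - l) * c)) - 2 * (\<phi> c - \<phi> (l * c) - \<phi> ((1 - l) * c))"
    using d by (simp add: field_simps)
  moreover have "\<phi> 0 = 0" by (simp add: \<phi>_def)
  ultimately show ?thesis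
    unfolding W[OF less_imp_le[OF c] order_refl] W[OF lc(1,2)] W[OF lc(3,4)] W1 lnY deficit_def e
    using d by (simp add: algebra_simps add_divide_distrib diff_divide_distrib)
qed

text \<open>The condition \<open>- s * d * (1 + c) < 1\<close> says that \<open>r > - s * d\<close>, so that \<open>moment_weight\<close> is
  positive at \<open>r\<close>.\<close>

lemma epi_r0_bounds:
  assumes d: "0 < d" and s: "- 1 / real d < s" "s < 0"
  shows "0 < epi_r0 s d" "epi_r0 s d < 1"
    and "\<And>r. epi_r0 s d < r \<Longrightarrow> r < 1 \<Longrightarrow> \<exists>c>0. r = 1 / (1 + c) \<and>
      c \<le> (sqrt 3 - 1) * (- 1 - 1 / (s * real d)) \<and> - s * real d * (1 + c) < 1"
proof -
  define t where "t = - s * real d"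
  have t: "0 < t" "t < 1" using s d by (auto simp: t_def field_simps mult_neg_pos)
  define \<kappa> where "\<kappa> = sqrt 3 - 1"
  have \<kappa>: "0 < \<kappa>" "\<kappa> < 1" by (auto simp: \<kappa>_def intro: real_less_rsqrt real_less_lsqrt)
  have k2: "2 / (1 + sqrt 3) = \<kappa>"
  proof -
    have "(sqrt 3 - 1) * (1 + sqrt 3) = 2" by (simp add: algebra_simps)
    then show ?thesis unfolding \<kappa>_def by (metis add_pos_pos nonzero_eq_divide_eq order_less_irrefl real_sqrt_gt_zero zero_less_numeral zero_less_one)
  qed
  have st: "1 / (s * real d) = - (1 / t)" by (simp add: t_def)
  have r0: "epi_r0 s d = inverse (1 + \<kappa> * (1 / t - 1))"
    unfolding epi_r0_def k2 st by (simp add: algebra_simps)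
  have g: "0 < \<kappa> * (1 / t - 1)" using t \<kappa> by simp
  show "0 < epi_r0 s d" "epi_r0 s d < 1" unfolding r0 using g by (auto intro!: add_pos_pos simp: inverse_less_1_iff)
  fix r assume r: "epi_r0 s d < r" "r < 1"
  have r_pos: "0 < r" using r \<open>0 < epi_r0 s d\<close> by simp
  define c where "c = 1 / r - 1"
  have c: "0 < c" "r = 1 / (1 + c)" using r_pos r by (auto simp: c_def)
  have "inverse r < 1 + \<kappa> * (1 / t - 1)"
    using r(1) g unfolding r0 by (metis \<open>0 < epi_r0 s d\<close> inverse_inverse_eq less_imp_inverse_less r0)
  then have cb: "c < \<kappa> * (1 / t - 1)" by (simp add: c_def inverse_eq_divide)
  also have "\<dots> \<le> 1 * (1 / t - 1)" using \<kappa> t by (intro mult_right_mono) auto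
  finally have "t * (1 + c) < 1" using t by (simp add: field_simps)
  moreover have "c \<le> (sqrt 3 - 1) * (- 1 - 1 / (s * real d))"
    using cb unfolding st \<kappa>_def by simp
  ultimately show "\<exists>c>0. r = 1 / (1 + c) \<and>
      c \<le> (sqrt 3 - 1) * (- 1 - 1 / (s * real d)) \<and> - s * real d * (1 + c) < 1"
    using c unfolding t_def by blast
qed

text \<open>The numerator in \<open>epi_alpha\<close> and its derivative vanish at \<open>r = 1\<close>, so the quantity that is
  inverted tends to 1.\<close>

lemma epi_alpha_eventually_pos:
  assumes d: "0 < d" and s: "- 1 / real d < s" "s < 0"
  shows "eventually (\<lambda>r. 0 < epi_alpha s r d) (at_left 1)"
proof -
  define N where "N r = ln r + (r + 1) * ln ((r + 1) / (2 * r)) + epi_C s r d" for r :: real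
  have N1: "N 1 = 0" by (simp add: N_def epi_C_def)
  have "(N has_real_derivative 0) (at 1)"
  proof -
    have d1: "((\<lambda>r. (r + 1) / (2 * r)) has_real_derivative - 1 / 2) (at (1 :: real))"
      by (rule derivative_eq_intros refl | simp)+
    have a: "((\<lambda>r::real. ln r + (r + 1) * ln ((r + 1) / (2 * r))) has_real_derivative 1 + (1 * ln ((1 + 1) / (2 * 1)) + (1 / ((1 + 1) / (2 * 1)) * (- 1 / 2)) * (1 + 1))) (at 1)"
      by (intro DERIV_add DERIV_mult DERIV_chain2[OF DERIV_ln_divide d1]) (auto intro!: derivative_eq_intros)
    have b: "((\<lambda>r. ln (1 + real k * s / r) + r * ln (1 + real k * s) - (r + 1) * ln (1 + real k * s * (r + 1) / (2 * r))) has_real_derivative 0) (at 1)"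
      if k: "k \<in> {1..d}" for k
    proof -
      define q where "q = real k * s"
      have "s * real d \<le> s * real k" using k s by (intro mult_left_mono_neg) auto
      moreover have "- 1 < s * real d" using s d by (simp add: field_simps)
      ultimately have q: "0 < 1 + q" by (simp add: q_def mult.commute)
      have d2: "((\<lambda>r. 1 + q / r) has_real_derivative - q) (at 1)"
        by (rule derivative_eq_intros refl | simp)+
      have d3: "((\<lambda>r. 1 + q * (r + 1) / (2 * r)) has_real_derivative - q / 2) (at 1)"
        by (rule derivative_eq_intros refl | simp)+
      have "((\<lambda>r. ln (1 + q / r) + r * ln (1 + q) - (r + 1) * ln (1 + q * (r + 1) / (2 * r))) has_real_derivative
          1 / (1 + q / 1) * (- q) + 1 * ln (1 + q) - (1 * ln (1 + q * (1 + 1) / (2 * 1)) + (1 / (1 + q * (1 + 1) / (2 * 1)) * (- q / 2)) * (1 + 1))) (at 1)"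
        using q by (intro DERIV_diff DERIV_add DERIV_mult DERIV_chain2[OF DERIV_ln_divide d2] DERIV_chain2[OF DERIV_ln_divide d3])
          (auto intro!: derivative_eq_intros)
      moreover have "q * 2 / (2 + q * 2) = q / (1 + q)"
        using q by (subst frac_eq_eq) (auto simp: algebra_simps)
      ultimately show ?thesis by (simp add: q_def[symmetric])
    qed
    have "((\<lambda>r. ln r + (r + 1) * ln ((r + 1) / (2 * r)) + 2 / real d * (\<Sum>k=1..d. ln (1 + real k * s / r) + r * ln (1 + real k * s) - (r + 1) * ln (1 + real k * s * (r + 1) / (2 * r)))) has_real_derivative
       (1 + (1 * ln ((1 + 1) / (2 * 1)) + (1 / ((1 + 1) / (2 * 1)) * (- 1 / 2)) * (1 + 1))) + 2 / real d * (\<Sum>k=1..d. 0)) (at 1)"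
      by (intro DERIV_add a DERIV_cmult DERIV_sum b) auto
    then show ?thesis unfolding N_def[abs_def] epi_C_def by simp
  qed
  then have "((\<lambda>r. N r / (r - 1)) \<longlongrightarrow> 0) (at 1)"
    by (simp add: has_field_derivative_iff N1)
  then have "((\<lambda>r. N r / (r - 1)) \<longlongrightarrow> 0) (at_left 1)" by (simp add: filterlim_at_split)
  then have "((\<lambda>r. 1 - N r / (r - 1) / ln 2) \<longlongrightarrow> 1 - 0 / ln 2) (at_left 1)" by (intro tendsto_intros) auto
  then have "((\<lambda>r. 1 - N r / (r - 1) / ln 2) \<longlongrightarrow> 1) (at_left 1)" by simp
  then have "eventually (\<lambda>r. 0 < 1 - N r / (r - 1) / ln 2) (at_left 1)"
    by (rule order_tendstoD) simp
  then show ?thesis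
  proof eventually_elim
    case (elim r)
    have "1 - N r / (r - 1) / ln 2 = 1 + N r / ((1 - r) * ln 2)"
      by (metis (no_types, lifting) diff_conv_add_uminus divide_divide_eq_left minus_diff_eq minus_divide_right mult_minus_left)
    then show ?case using elim unfolding epi_alpha_def N_def by simp
  qed
qed

section \<open>Entropy powers of sums\<close>

lemma renyi_power_eq_powe:
  fixes X :: "'w \<Rightarrow> 'a::euclidean_space"
  assumes X: "distributed M lborel X F" and fin: "AE x in lborel. F x \<noteq> \<top>" and r: "0 < r"
  shows "renyi_power r M X = (\<integral>\<^sup>+x. F x powe r \<partial>lborel) powe (2 / real DIM('a) * (1 / (1 - r)))"
proof -
  have d: "density lborel F = distr M lborel X" and m: "F \<in> borel_measurable lborel"
    using X by (auto simp: distributed_def)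
  have "AE x in lborel. F x = RN_deriv lborel (distr M lborel X) x"
    by (rule sigma_finite_measure.RN_deriv_unique[OF sigma_finite_lborel m d])
  then have "AE x in lborel. ennreal (enn2real (RN_deriv lborel (distr M lborel X) x) powr r) = F x powe r"
    using fin
  proof eventually_elim
    case (elim x)
    then show ?case unfolding elim(1)[symmetric] using r
      by (cases "F x" rule: ennreal_three_cases) (auto simp: powe_ennreal)
  qed
  then have "(\<integral>\<^sup>+x. ennreal (enn2real (RN_deriv lborel (distr M lborel X) x) powr r) \<partial>lborel) = (\<integral>\<^sup>+x. F x powe r \<partial>lborel)"
    by (rule nn_integral_cong_AE)
  then show ?thesis
    unfolding renyi_power_def renyi_entropy_def powr_ennreal_def by (simp add: mult.assoc[symmetric])
qed

lemma conv_commute: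
  fixes f g :: "'a::euclidean_space \<Rightarrow> ennreal"
  assumes [measurable]: "f \<in> borel_measurable borel" "g \<in> borel_measurable borel"
  shows "conv f g z = conv g f z"
proof -
  have eq: "(lborel :: 'a measure) = density (distr lborel borel (\<lambda>x. z - x)) (\<lambda>_. 1)"
    using lborel_affine[of "- 1" z] by simp
  show ?thesis
    unfolding conv_def by (subst eq) (simp add: nn_integral_density nn_integral_distr mult.commute)
qed

lemma distributed_add_conv:
  fixes X Y :: "'w \<Rightarrow> 'a::euclidean_space"
  assumes "prob_space M" and ind: "prob_space.indep_var M borel X borel Y"
    and X: "distributed M lborel X F" and Y: "distributed M lborel Y G"
  shows "distributed M lborel (\<lambda>w. X w + Y w) (conv F G)"
proof -
  interpret prob_space M by fact
  have [measurable]: "F \<in> borel_measurable borel" "G \<in> borel_measurable borel"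
      "X \<in> M \<rightarrow>\<^sub>M borel" "Y \<in> M \<rightarrow>\<^sub>M borel"
    and dX: "distr M lborel X = density lborel F" and dY: "distr M lborel Y = density lborel G"
    using X Y by (auto simp: distributed_def)
  have dX': "distr M borel X = density lborel F" and dY': "distr M borel Y = density lborel G"
    using dX dY by (simp_all cong: distr_cong)
  interpret PX: prob_space "density lborel F" using prob_space_distr[of X borel] by (simp add: dX')
  interpret PY: prob_space "density lborel G" using prob_space_distr[of Y borel] by (simp add: dY')
  have joint: "distr M (borel \<Otimes>\<^sub>M borel) (\<lambda>w. (X w, Y w)) = density lborel F \<Otimes>\<^sub>M density lborel G"
    using ind unfolding indep_var_distribution_eq dX' dY' by simp
  have tr: "(\<integral>\<^sup>+x. H x * indicator A (x + y) \<partial>lborel) = (\<integral>\<^sup>+z. H (z - y) * indicator A z \<partial>lborel)"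
    if [measurable]: "H \<in> borel_measurable borel" "A \<in> sets borel" for H :: "'a \<Rightarrow> ennreal" and A y
  proof -
    have "(\<integral>\<^sup>+z. H (z - y) * indicator A z \<partial>lborel) = (\<integral>\<^sup>+z. H (z - y) * indicator A z \<partial>distr lborel borel ((+) y))"
      by (simp add: lborel_distr_plus)
    also have "\<dots> = (\<integral>\<^sup>+x. H x * indicator A (x + y) \<partial>lborel)"
      by (subst nn_integral_distr) (auto simp: add.commute)
    finally show ?thesis by simp
  qed
  have "distr M lborel (\<lambda>w. X w + Y w) = density lborel (conv F G)"
  proof (rule measure_eqI)
    fix A assume "A \<in> sets (distr M lborel (\<lambda>w. X w + Y w))"
    then have [measurable]: "A \<in> sets borel" by simp
    have "emeasure (distr M lborel (\<lambda>w. X w + Y w)) A = (\<integral>\<^sup>+z. indicator A z \<partial>distr M lborel (\<lambda>w. X w + Y w))"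
      by simp
    also have "\<dots> = (\<integral>\<^sup>+w. indicator A (X w + Y w) \<partial>M)"
      by (subst nn_integral_distr) auto
    also have "\<dots> = (\<integral>\<^sup>+p. indicator A (fst p + snd p) \<partial>distr M (borel \<Otimes>\<^sub>M borel) (\<lambda>w. (X w, Y w)))"
      by (subst nn_integral_distr) auto
    also have "\<dots> = (\<integral>\<^sup>+x. \<integral>\<^sup>+y. indicator A (x + y) \<partial>density lborel G \<partial>density lborel F)"
      unfolding joint by (subst PY.nn_integral_fst[symmetric]) auto
    also have "\<dots> = (\<integral>\<^sup>+x. \<integral>\<^sup>+y. F x * (G y * indicator A (x + y)) \<partial>lborel \<partial>lborel)"
      by (simp add: nn_integral_density nn_integral_cmult)
    also have "\<dots> = (\<integral>\<^sup>+y. \<integral>\<^sup>+x. F x * (G y * indicator A (x + y)) \<partial>lborel \<partial>lborel)"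
      by (rule lborel_pair.Fubini') measurable
    also have "\<dots> = (\<integral>\<^sup>+y. \<integral>\<^sup>+z. F (z - y) * G y * indicator A z \<partial>lborel \<partial>lborel)"
    proof (rule nn_integral_cong)
      fix y :: 'a
      show "(\<integral>\<^sup>+x. F x * (G y * indicator A (x + y)) \<partial>lborel) = (\<integral>\<^sup>+z. F (z - y) * G y * indicator A z \<partial>lborel)"
        using tr[of "\<lambda>x. F x * G y" A y] by (simp add: mult.assoc)
    qed
    also have "\<dots> = (\<integral>\<^sup>+z. \<integral>\<^sup>+y. F (z - y) * G y * indicator A z \<partial>lborel \<partial>lborel)"
      by (rule lborel_pair.Fubini') measurable
    also have "\<dots> = (\<integral>\<^sup>+z. conv F G z * indicator A z \<partial>lborel)"
      unfolding conv_def by (intro nn_integral_cong nn_integral_multc) measurable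
    also have "\<dots> = emeasure (density lborel (conv F G)) A" by (simp add: emeasure_density)
    finally show "emeasure (distr M lborel (\<lambda>w. X w + Y w)) A = emeasure (density lborel (conv F G)) A" .
  qed simp
  then show ?thesis by (simp add: distributed_def)
qed

text \<open>Log-concavity of the weighted moments between \<open>1 / (1 + c)\<close> and 1, evaluated at the
  intermediate exponent \<open>1 / (1 + l * c)\<close>; the moment of order 1 is the total mass 1.\<close>

lemma s_concave_density_moment_bound:
  fixes f :: "'a::euclidean_space \<Rightarrow> real"
  assumes f: "s_concave s f" and [measurable]: "f \<in> borel_measurable borel" and s: "s < 0"
    and c: "0 < c" "- s * real DIM('a) * (1 + c) < 1" and l: "0 < l" "l < 1"
    and one: "(\<integral>\<^sup>+x. ennreal (f x) \<partial>lborel) = 1"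
    and x: "0 < x" "(\<integral>\<^sup>+x. ennreal (f x) powe (1 / (1 + c)) \<partial>lborel) = ennreal x"
  shows "ennreal ((moment_weight s DIM('a) (1 / (1 + c)) * x) powr (l * (1 + c)) * moment_weight s DIM('a) 1 powr (1 - l)
      / moment_weight s DIM('a) (1 / (1 + l * c)) powr (1 + l * c)) \<le>
    qnorm lborel (1 + l * c) (\<lambda>x. ennreal (f x))"
proof -
  have f0: "0 \<le> f x" for x using f by (simp add: s_concave_def)
  have lc: "0 < l * c" "l * c < c" "0 < 1 + l * c" using l c by (auto simp: add_pos_pos)
  define p1 p2 where "p1 = 1 / (1 + c)" and "p2 = 1 / (1 + l * c)"
  have p: "- s * real DIM('a) < p1" "p1 < p2" "p2 < 1" "0 < p1"
    using c lc by (auto simp: p1_def p2_def field_simps)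
  define \<theta> where "\<theta> = (1 - l) * p2"
  have \<theta>1: "1 - \<theta> = l * (1 + c) * p2"
    using lc unfolding \<theta>_def p2_def by (simp add: field_simps)
  have \<theta>: "p2 = (1 - \<theta>) * p1 + \<theta> * 1"
    unfolding \<theta>1 using c by (simp add: \<theta>_def p1_def) (simp add: algebra_simps)
  let ?W = "moment_weight s DIM('a)"
  have W: "0 < ?W p1" "0 < ?W p2" "0 < ?W 1" using moment_weight_pos[OF s] p by auto
  have "ennreal ((?W p1 * x) powr (1 - \<theta>) * (?W 1 * 1) powr \<theta>) \<le> ennreal (?W p2) * (\<integral>\<^sup>+x. ennreal (f x powr p2) \<partial>lborel)"
  proof (rule s_concave_moment_log_concave[OF f _ s p(1-3) \<theta> x(1)])
    show "(\<integral>\<^sup>+x. ennreal (f x powr p1) \<partial>lborel) = ennreal x"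
      using x(2) f0 p by (simp add: powe_ennreal' p1_def)
    show "(\<integral>\<^sup>+x. ennreal (f x powr 1) \<partial>lborel) = ennreal 1"
      using one f0 by simp
  qed auto
  then have "ennreal ((?W p1 * x) powr (1 - \<theta>) * ?W 1 powr \<theta>) powe (1 + l * c) \<le>
     (ennreal (?W p2) * (\<integral>\<^sup>+x. ennreal (f x) powe p2 \<partial>lborel)) powe (1 + l * c)"
    using lc f0 p by (intro powe_mono) (auto simp: powe_ennreal')
  also have "\<dots> = ennreal (?W p2 powr (1 + l * c)) * (\<integral>\<^sup>+x. ennreal (f x) powe p2 \<partial>lborel) powe (1 + l * c)"
    using lc W by (simp add: powe_mult powe_ennreal)
  also have "ennreal ((?W p1 * x) powr (1 - \<theta>) * ?W 1 powr \<theta>) powe (1 + l * c) = ennreal ((?W p1 * x) powr (l * (1 + c)) * ?W 1 powr (1 - l))"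
  proof -
    have "(1 - \<theta>) * (1 + l * c) = l * (1 + c)" "\<theta> * (1 + l * c) = 1 - l"
      unfolding \<theta>1 unfolding \<theta>_def p2_def using lc by simp_all
    then show ?thesis using W x lc by (simp add: powe_ennreal powr_mult powr_powr)
  qed
  finally have le: "ennreal ((?W p1 * x) powr (l * (1 + c)) * ?W 1 powr (1 - l)) \<le>
     ennreal (?W p2 powr (1 + l * c)) * (\<integral>\<^sup>+x. ennreal (f x) powe p2 \<partial>lborel) powe (1 + l * c)" .
  have "ennreal ((?W p1 * x) powr (l * (1 + c)) * ?W 1 powr (1 - l) / ?W p2 powr (1 + l * c)) =
     ennreal (1 / ?W p2 powr (1 + l * c)) * ennreal ((?W p1 * x) powr (l * (1 + c)) * ?W 1 powr (1 - l))"
    by (simp add: ennreal_mult'[symmetric])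
  also have "\<dots> \<le> ennreal (1 / ?W p2 powr (1 + l * c)) * (ennreal (?W p2 powr (1 + l * c)) * (\<integral>\<^sup>+x. ennreal (f x) powe p2 \<partial>lborel) powe (1 + l * c))"
    using le by (rule mult_left_mono) simp
  also have "\<dots> = (\<integral>\<^sup>+x. ennreal (f x) powe p2 \<partial>lborel) powe (1 + l * c)"
    using W by (simp add: mult.assoc[symmetric] ennreal_mult'[symmetric])
  finally show ?thesis unfolding p1_def p2_def .
qed

text \<open>The best splitting is proportional to the summands on the left: for it, the entropy of the
  splitting turns the weighted mean of their logarithms into the logarithm of their sum.\<close>

lemma entropy_power_from_weighted_bounds:
  fixes x y z \<kappa> \<alpha> :: real
  assumes pos: "0 < x" "0 < y" "0 < z" and \<alpha>: "0 < \<alpha>"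
    and bound: "\<And>l. 0 < l \<Longrightarrow> l < 1 \<Longrightarrow> binary_entropy l / \<alpha> + \<kappa> * (l * ln x + (1 - l) * ln y) \<le> \<kappa> * ln z"
  shows "x powr (\<kappa> * \<alpha>) + y powr (\<kappa> * \<alpha>) \<le> z powr (\<kappa> * \<alpha>)"
proof -
  define u v where "u = x powr (\<kappa> * \<alpha>)" and "v = y powr (\<kappa> * \<alpha>)"
  define l where "l = u / (u + v)"
  have uv: "0 < u" "0 < v" using pos by (auto simp: u_def v_def)
  have l: "0 < l" "l < 1" "1 - l = v / (u + v)" using uv by (auto simp: l_def field_simps)
  have lnu: "ln l = ln u - ln (u + v)" "ln (1 - l) = ln v - ln (u + v)"
    using uv unfolding l(3) by (auto simp: l_def ln_div)
  have "\<alpha> * (binary_entropy l / \<alpha> + \<kappa> * (l * ln x + (1 - l) * ln y)) \<le> \<alpha> * (\<kappa> * ln z)"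
    using bound[OF l(1,2)] \<alpha> by (intro mult_left_mono) auto
  moreover have "\<alpha> * (binary_entropy l / \<alpha> + \<kappa> * (l * ln x + (1 - l) * ln y)) = binary_entropy l + l * ln u + (1 - l) * ln v"
    using \<alpha> pos by (simp add: u_def v_def ln_powr algebra_simps)
  moreover have "binary_entropy l + l * ln u + (1 - l) * ln v = ln (u + v)"
    unfolding binary_entropy_def lnu by (simp add: algebra_simps)
  moreover have "\<alpha> * (\<kappa> * ln z) = ln (z powr (\<kappa> * \<alpha>))" using pos by (simp add: ln_powr mult_ac)
  ultimately have "ln (u + v) \<le> ln (z powr (\<kappa> * \<alpha>))" by simp
  then have "u + v \<le> z powr (\<kappa> * \<alpha>)"
    using uv pos by (subst (asm) ln_le_cancel_iff) auto
  then show ?thesis by (simp only: u_def v_def)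
qed

text \<open>For each splitting, \<open>reverse_Young\<close> and the moment bounds for both densities give a weighted
  bound with constant \<open>binary_entropy l - deficit l / c\<close>; by \<open>deficit_le_entropy\<close> this is at least
  \<open>binary_entropy l / \<alpha>\<close>.\<close>

lemma renyi_epi_s_concave:
  fixes X Y :: "'w \<Rightarrow> 'a::euclidean_space"
  assumes s: "- 1 / real DIM('a) < s" "s < 0"
    and r: "epi_r0 s DIM('a) < r" "r < 1" and \<alpha>: "0 < epi_alpha s r DIM('a)"
    and M: "prob_space M" and ind: "prob_space.indep_var M borel X borel Y"
    and X: "has_s_concave_density s M X" and Y: "has_s_concave_density s M Y"
  shows "renyi_power r M X powe epi_alpha s r DIM('a) + renyi_power r M Y powe epi_alpha s r DIM('a)
    \<le> renyi_power r M (\<lambda>w. X w + Y w) powe epi_alpha s r DIM('a)"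
proof -
  interpret prob_space M by fact
  let ?d = "DIM('a)"
  define \<alpha> where "\<alpha> = epi_alpha s r ?d"
  have \<alpha>_pos: "0 < \<alpha>" using \<alpha> by (simp add: \<alpha>_def)
  obtain c where c: "0 < c" "r = 1 / (1 + c)" "c \<le> (sqrt 3 - 1) * (- 1 - 1 / (s * real ?d))" "- s * real ?d * (1 + c) < 1"
    using epi_r0_bounds(3)[OF DIM_positive s r] by auto
  have r_pos: "0 < r" using c by simp
  define \<kappa> where "\<kappa> = 2 / real ?d * (1 / (1 - r))"
  have "1 - r = c / (1 + c)" unfolding c(2) using c(1) by (simp add: field_simps)
  then have \<kappa>: "\<kappa> = 2 / real ?d * ((1 + c) / c)" by (simp add: \<kappa>_def)
  have \<kappa>_pos: "0 < \<kappa>" unfolding \<kappa> using c by simp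
  have density: "\<exists>f. s_concave s f \<and> f \<in> borel_measurable borel \<and> (\<integral>\<^sup>+x. ennreal (f x) \<partial>lborel) = 1 \<and> distributed M lborel X (\<lambda>x. ennreal (f x))"
    if X: "has_s_concave_density s M X" for X :: "'w \<Rightarrow> 'a"
  proof -
    obtain f where f: "s_concave s f" "distributed M lborel X (\<lambda>x. ennreal (f x))"
      using X by (auto simp: has_s_concave_density_def)
    have f0: "0 \<le> f x" for x using f by (simp add: s_concave_def)
    have "(\<lambda>x. ennreal (f x)) \<in> borel_measurable borel" using f(2) by (auto simp: distributed_def)
    then have "(\<lambda>x. enn2real (ennreal (f x))) \<in> borel_measurable borel" by measurable
    then have m: "f \<in> borel_measurable borel" using f0 by simp
    have dX: "distr M lborel X = density lborel (\<lambda>x. ennreal (f x))" and mX: "X \<in> M \<rightarrow>\<^sub>M lborel"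
      using f(2) by (auto simp: distributed_def)
    have "(\<integral>\<^sup>+x. ennreal (f x) \<partial>lborel) = emeasure (distr M lborel X) UNIV"
      using m unfolding dX by (simp add: emeasure_density)
    also have "\<dots> = 1" using prob_space.emeasure_space_1[OF prob_space_distr[OF mX]] by simp
    finally show ?thesis using f m by blast
  qed
  obtain f where f: "s_concave s f" "f \<in> borel_measurable borel" "(\<integral>\<^sup>+x. ennreal (f x) \<partial>lborel) = 1" "distributed M lborel X (\<lambda>x. ennreal (f x))"
    using density[OF X] by blast
  obtain g where g: "s_concave s g" "g \<in> borel_measurable borel" "(\<integral>\<^sup>+x. ennreal (g x) \<partial>lborel) = 1" "distributed M lborel Y (\<lambda>x. ennreal (g x))"
    using density[OF Y] by blast
  note [measurable] = f(2) g(2)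
  define F G where "F x = ennreal (f x)" and "G x = ennreal (g x)" for x
  have [measurable]: "F \<in> borel_measurable borel" "G \<in> borel_measurable borel" unfolding F_def G_def by measurable
  have FG1: "(\<integral>\<^sup>+x. F x \<partial>lborel) = 1" "(\<integral>\<^sup>+x. G x \<partial>lborel) = 1" using f(3) g(3) by (simp_all add: F_def G_def)
  define RX RY RZ where "RX = (\<integral>\<^sup>+x. F x powe r \<partial>lborel)" and "RY = (\<integral>\<^sup>+x. G x powe r \<partial>lborel)"
    and "RZ = (\<integral>\<^sup>+x. conv F G x powe r \<partial>lborel)"
  have dZ: "distributed M lborel (\<lambda>w. X w + Y w) (conv F G)"
    using distributed_add_conv[OF M ind f(4) g(4)] by (simp add: F_def[abs_def] G_def[abs_def])
  have "(\<integral>\<^sup>+x. conv F G x \<partial>lborel) = emeasure (distr M lborel (\<lambda>w. X w + Y w)) UNIV"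
    using dZ by (simp add: distributed_def emeasure_density)
  also have "\<dots> = 1"
    using dZ prob_space.emeasure_space_1[OF prob_space_distr[of "\<lambda>w. X w + Y w" lborel]] by (simp add: distributed_def)
  finally have "AE x in lborel. conv F G x \<noteq> \<top>"
    using nn_integral_PInf_AE[of "conv F G" lborel] by simp
  then have NZ: "renyi_power r M (\<lambda>w. X w + Y w) = RZ powe \<kappa>"
    unfolding RZ_def \<kappa>_def by (rule renyi_power_eq_powe[OF dZ _ r_pos])
  have NX: "renyi_power r M X = RX powe \<kappa>" unfolding RX_def \<kappa>_def F_def
    by (rule renyi_power_eq_powe[OF f(4) _ r_pos]) simp
  have NY: "renyi_power r M Y = RY powe \<kappa>" unfolding RY_def \<kappa>_def G_def
    by (rule renyi_power_eq_powe[OF g(4) _ r_pos]) simp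
  have XZ: "RX \<le> RZ" unfolding RX_def RZ_def
    by (rule nn_integral_conv_powe_ge) (use r_pos r FG1 in auto)
  have YZ: "RY \<le> RZ"
  proof -
    have "RY \<le> (\<integral>\<^sup>+x. conv G F x powe r \<partial>lborel)" unfolding RY_def
      by (rule nn_integral_conv_powe_ge) (use r_pos r FG1 in auto)
    then show ?thesis by (simp add: RZ_def conv_commute[of G F])
  qed
  have nz: "(\<integral>\<^sup>+x. H x powe r \<partial>lborel) \<noteq> 0" if [measurable]: "H \<in> borel_measurable borel" and H: "(\<integral>\<^sup>+x. H x \<partial>lborel) = 1" for H :: "'a \<Rightarrow> ennreal"
  proof
    assume "(\<integral>\<^sup>+x. H x powe r \<partial>lborel) = 0"
    then have "AE x in lborel. H x = 0" using r_pos by (subst (asm) nn_integral_0_iff_AE) auto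
    then have "(\<integral>\<^sup>+x. H x \<partial>lborel) = 0" by (subst nn_integral_0_iff_AE) auto
    with H show False by simp
  qed
  have "RX powe (\<kappa> * \<alpha>) + RY powe (\<kappa> * \<alpha>) \<le> RZ powe (\<kappa> * \<alpha>)"
  proof (cases "RZ = \<top>")
    case True then show ?thesis using \<kappa>_pos \<alpha>_pos by simp
  next
    case False
    have RX: "RX \<noteq> \<top>" "RX \<noteq> 0" and RY: "RY \<noteq> \<top>" "RY \<noteq> 0"
      using False XZ YZ nz[of F] nz[of G] FG1 by (auto simp: top_unique RX_def RY_def)
    obtain x where x: "0 < x" "RX = ennreal x" using RX by (cases RX rule: ennreal_three_cases) auto
    obtain y where y: "0 < y" "RY = ennreal y" using RY by (cases RY rule: ennreal_three_cases) auto
    have "RZ \<noteq> 0" using XZ RX by auto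
    with False obtain z where z: "0 < z" "RZ = ennreal z" by (cases RZ rule: ennreal_three_cases) auto
    have "x powr (\<kappa> * \<alpha>) + y powr (\<kappa> * \<alpha>) \<le> z powr (\<kappa> * \<alpha>)"
    proof (rule entropy_power_from_weighted_bounds[OF x(1) y(1) z(1) \<alpha>_pos])
      fix l :: real assume l: "0 < l" "l < 1"
      let ?W = "moment_weight s ?d"
      define m where "m = 1 - l"
      have m: "0 < m" "m < 1" "1 - m = l" using l by (auto simp: m_def)
      define p q where "p = 1 / (1 + l * c)" and "q = 1 / (1 + m * c)"
      have lc: "0 < 1 + l * c" "0 < 1 + m * c" using l m c by (auto simp: add_pos_pos)
      have "- s * real ?d < 1 / (1 + c)" using c by (simp add: field_simps)
      also have "1 / (1 + c) \<le> p" "1 / (1 + c) \<le> q" "1 / (1 + c) \<le> 1"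
        using l m c lc by (auto simp: p_def q_def field_simps)
      ultimately have "0 < ?W r" "0 < ?W p" "0 < ?W q" "0 < ?W 1"
        using s moment_weight_pos[OF s(2), of ?d] unfolding c(2) by (auto intro: less_le_trans)
      note W = this
      define A where "A = (?W r * x) powr (l * (1 + c)) * ?W 1 powr m / ?W p powr (1 + l * c)"
      define B where "B = (?W r * y) powr (m * (1 + c)) * ?W 1 powr l / ?W q powr (1 + m * c)"
      have AB: "0 < A" "0 < B" unfolding A_def B_def using W x y by simp_all
      have A: "ennreal A \<le> (\<integral>\<^sup>+x. F x powe p \<partial>lborel) powe (1 + l * c)"
        unfolding A_def p_def m_def c(2) F_def
        by (rule s_concave_density_moment_bound[OF f(1,2) s(2) c(1,4) l f(3) x(1)])
           (use x(2) in \<open>simp add: RX_def F_def c(2)\<close>)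
      have B: "ennreal B \<le> (\<integral>\<^sup>+x. G x powe q \<partial>lborel) powe (1 + m * c)"
        unfolding B_def q_def m(3)[symmetric] c(2) G_def
        by (rule s_concave_density_moment_bound[OF g(1,2) s(2) c(1,4) m(1,2) g(3) y(1)])
           (use y(2) in \<open>simp add: RY_def G_def c(2)\<close>)
      define k where "k = young_const c l"
      have k: "0 < k" unfolding k_def by (rule young_const_pos[OF l c(1)])
      have "ennreal (k ^ ?d * (A * B)) = ennreal k ^ ?d * (ennreal A * ennreal B)"
        using k AB by (simp add: ennreal_mult' ennreal_power less_imp_le)
      also have "\<dots> \<le> ennreal k ^ ?d * ((\<integral>\<^sup>+x. F x powe p \<partial>lborel) powe (1 + l * c) * (\<integral>\<^sup>+x. G x powe q \<partial>lborel) powe (1 + m * c))"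
        by (intro mult_left_mono mult_mono A B) auto
      also have "\<dots> \<le> RZ powe (1 + c)"
        unfolding k_def p_def q_def m_def RZ_def c(2) by (rule reverse_Young) (use c l in auto)
      also have "\<dots> = ennreal (z powr (1 + c))" using z by (simp add: powe_ennreal)
      finally have "k ^ ?d * (A * B) \<le> z powr (1 + c)" by simp
      moreover have "0 < k ^ ?d * (A * B)" using k AB by simp
      ultimately have "ln (k ^ ?d * (A * B)) \<le> ln (z powr (1 + c))"
        using z by (subst ln_le_cancel_iff) auto
      also have "ln (z powr (1 + c)) = (1 + c) * ln z" using z by (simp add: ln_powr)
      also have "ln (k ^ ?d * (A * B)) = real ?d * ln k + (ln A + ln B)"
        using k AB by (simp add: ln_mult ln_realpow)
      also have "ln A = l * (1 + c) * (ln (?W r) + ln x) + m * ln (?W 1) - (1 + l * c) * ln (?W p)"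
        unfolding A_def using W x by (simp add: ln_div ln_mult ln_powr)
      also have "ln B = m * (1 + c) * (ln (?W r) + ln y) + l * ln (?W 1) - (1 + m * c) * ln (?W q)"
        unfolding B_def using W y by (simp add: ln_div ln_mult ln_powr)
      finally have ln_le: "real ?d * ln k + ((l * (1 + c) * (ln (?W r) + ln x) + m * ln (?W 1) - (1 + l * c) * ln (?W p)) +
         (m * (1 + c) * (ln (?W r) + ln y) + l * ln (?W 1) - (1 + m * c) * ln (?W q))) \<le> (1 + c) * ln z" .
      define E where "E = (1 + c) * ln (?W r) + ln (?W 1) - (1 + l * c) * ln (?W p) - (1 + m * c) * ln (?W q)"
      have "(l * (1 + c) * (ln (?W r) + ln x) + m * ln (?W 1) - (1 + l * c) * ln (?W p)) +
         (m * (1 + c) * (ln (?W r) + ln y) + l * ln (?W 1) - (1 + m * c) * ln (?W q)) =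
         E + (1 + c) * (l * ln x + m * ln y)"
        unfolding E_def m_def by (simp add: algebra_simps)
      with ln_le have "real ?d * ln k + (E + (1 + c) * (l * ln x + m * ln y)) \<le> (1 + c) * ln z" by simp
      then have "2 / real ?d * (real ?d * ln k + (E + (1 + c) * (l * ln x + m * ln y))) \<le> 2 / real ?d * ((1 + c) * ln z)"
        by (intro mult_left_mono) auto
      moreover have "2 / real ?d * (real ?d * ln k + (E + (1 + c) * (l * ln x + m * ln y))) =
          (2 * ln k + 2 / real ?d * E) + 2 / real ?d * ((1 + c) * (l * ln x + m * ln y))"
        by (simp add: distrib_left)
      moreover have "2 * ln k + 2 / real ?d * E = c * binary_entropy l - deficit s ?d c l"
        unfolding k_def E_def p_def q_def m_def c(2)
        by (rule young_const_moment_weight_exponent) (use s c l in auto)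
      ultimately have "c * binary_entropy l - deficit s ?d c l + 2 / real ?d * ((1 + c) * (l * ln x + m * ln y)) \<le> 2 / real ?d * ((1 + c) * ln z)"
        by simp
      then have main: "(c * binary_entropy l - deficit s ?d c l + 2 / real ?d * ((1 + c) * (l * ln x + m * ln y))) / c \<le> 2 / real ?d * ((1 + c) * ln z) / c"
        using c by (intro divide_right_mono) auto
      have gen: "2 / real ?d * ((1 + c) * T) / c = \<kappa> * T" for T unfolding \<kappa> by simp
      have e1: "(c * binary_entropy l - deficit s ?d c l + 2 / real ?d * ((1 + c) * (l * ln x + m * ln y))) / c =
          (binary_entropy l - deficit s ?d c l / c) + \<kappa> * (l * ln x + m * ln y)"
        unfolding add_divide_distrib diff_divide_distrib gen using c by simp
      have "binary_entropy l / \<alpha> \<le> binary_entropy l - deficit s ?d c l / c"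
      proof -
        have "1 / \<alpha> = 1 - deficit s ?d c (1 / 2) / (c * ln 2)"
          unfolding \<alpha>_def c(2) epi_alpha_eq_deficit[OF DIM_positive c(1)] by (simp add: inverse_eq_divide)
        then have "binary_entropy l / \<alpha> = binary_entropy l * (1 - deficit s ?d c (1 / 2) / (c * ln 2))"
          by (metis divide_inverse inverse_eq_divide)
        also have "\<dots> = binary_entropy l - (deficit s ?d c (1 / 2) * binary_entropy l) / (c * ln 2)"
          by (simp add: algebra_simps)
        also have "\<dots> \<le> binary_entropy l - (deficit s ?d c l * ln 2) / (c * ln 2)"
          using deficit_le_entropy[OF DIM_positive s c(1,3) l] c by (intro diff_left_mono divide_right_mono) auto
        also have "(deficit s ?d c l * ln 2) / (c * ln 2) = deficit s ?d c l / c" by simp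
        finally show ?thesis .
      qed
      with main show "binary_entropy l / \<alpha> + \<kappa> * (l * ln x + (1 - l) * ln y) \<le> \<kappa> * ln z"
        unfolding e1 gen by (simp add: m_def)
    qed
    then show ?thesis
      using x y z \<kappa>_pos \<alpha>_pos by (simp add: powe_ennreal ennreal_plus[symmetric] ennreal_leI del: ennreal_plus)
  qed
  then show ?thesis
    unfolding NX NY NZ \<alpha>_def[symmetric] using \<kappa>_pos by (simp add: powe_powe)
qed

theorem theorem3:
  fixes s :: real
  assumes "- 1 / real DIM('a::euclidean_space) < s" and "s < 0"
  shows
    "(\<exists>(r0::real) (\<alpha>::real \<Rightarrow> real). 0 < r0 \<and> r0 < 1 \<and>
        (\<forall>r. r0 < r \<and> r < 1 \<longrightarrow>
          (\<forall>(M::'w measure) (X::'w \<Rightarrow> 'a) (Y::'w \<Rightarrow> 'a).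
             prob_space M \<and> prob_space.indep_var M borel X borel Y \<and>
             has_s_concave_density s M X \<and> has_s_concave_density s M Y \<longrightarrow>
             powr_ennreal (renyi_power r M (\<lambda>w. X w + Y w)) (\<alpha> r)
               \<ge> powr_ennreal (renyi_power r M X) (\<alpha> r) + powr_ennreal (renyi_power r M Y) (\<alpha> r)))) \<and>
     (0 < epi_r0 s DIM('a) \<and> epi_r0 s DIM('a) < 1 \<and>
        (\<forall>\<^sub>F r in at_left 1. 0 < epi_alpha s r DIM('a)) \<and>
        (\<forall>r. epi_r0 s DIM('a) < r \<and> r < 1 \<and> 0 < epi_alpha s r DIM('a) \<longrightarrow>
          (\<forall>(M::'w measure) (X::'w \<Rightarrow> 'a) (Y::'w \<Rightarrow> 'a).
             prob_space M \<and> prob_space.indep_var M borel X borel Y \<and>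
             has_s_concave_density s M X \<and> has_s_concave_density s M Y \<longrightarrow>
             powr_ennreal (renyi_power r M (\<lambda>w. X w + Y w)) (epi_alpha s r DIM('a))
               \<ge> powr_ennreal (renyi_power r M X) (epi_alpha s r DIM('a))
                  + powr_ennreal (renyi_power r M Y) (epi_alpha s r DIM('a)))))"
proof -
  note bounds = epi_r0_bounds[OF DIM_positive assms]
  note eventually_pos = epi_alpha_eventually_pos[OF DIM_positive assms]
  note epi = renyi_epi_s_concave[OF assms]
  obtain b where b: "b < 1" "\<And>r. b < r \<Longrightarrow> r < 1 \<Longrightarrow> 0 < epi_alpha s r DIM('a)"
    using eventually_pos unfolding eventually_at_left[OF zero_less_one] by blast
  define r0 where "r0 = max b (epi_r0 s DIM('a))"
  have "0 < r0 \<and> r0 < 1" using b bounds by (auto simp: r0_def)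
  moreover have "epi_r0 s DIM('a) < r \<and> 0 < epi_alpha s r DIM('a)" if "r0 < r" "r < 1" for r
    using that b by (auto simp: r0_def)
  ultimately show ?thesis
    using bounds(1,2) eventually_pos
    by (intro conjI exI[of _ r0] exI[of _ "\<lambda>r. epi_alpha s r DIM('a)"] allI impI; (elim conjE)?)
       (assumption | rule epi | simp)+
qed

end
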